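(* Let $\Phi$ be a symbol with $\operatorname{char}(\Phi)=0$ for which the boundary limit $\Phi^*$ exists almost everywhere on $\mathbb T^\infty$. Assume that $(f\circ\Phi)^*(\chi)=f(\Phi^*(\chi))$ for almost every $\chi\in\mathbb T^\infty$ and all $f\in\mathcal N_u$, and suppose that $\overline{\Phi(\mathbb C_0)}$ is a compact subset of $\mathbb C_0$. Then $C_\Phi:\mathcal N_u\to\mathcal N_u$ is bounded if and only if $\mu_{\Phi^*}$ satisfies the Carleson embedding condition for $\mathcal N_u$, that is, there exists a constant $C>0$ such that $$\int_{\mathbb C_0}\log(1+|f(s)|)\,d\mu_{\Phi^*}(s)\le C\|f\|_0\qquad\text{for all } f\in\mathcal N_u .$$
   Context: For $\theta\in\mathbb R$ put $\mathbb C_\theta=\{s\in\mathbb C:\operatorname{Re}s>\theta\}$. A Dirichlet series is a series $f(s)=\sum_{n\ge1}a_nn^{-s}$; its abscissa of uniform convergence $\sigma_u(f)$ is the infimum of all $\theta\in\mathbb R$ such that the series converges uniformly on $\mathbb C_\theta$. The Nevanlinna class of Dirichlet series $\mathcal N_u$ consists of all Dirichlet series $f$ with $\sigma_u(f)\le0$ and $\limsup_{\sigma\to0^+}\lim_{T\to\infty}\frac1{2T}\int_{-T}^T\log^+|f(\sigma+it)|\,dt<\infty$, where $\log^+x=\max\{\log x,0\}$; such $f$ are holomorphic on $\mathbb C_0$. For $f\in\mathcal N_u$, $\|f\|_0=\limsup_{\sigma\to0^+}\lim_{T\to\infty}\frac1{2T}\int_{-T}^T\log(1+|f(\sigma+it)|)\,dt$.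 A symbol with $\operatorname{char}(\Phi)=0$ is here a holomorphic function $\Phi$ on $\mathbb C_0$ represented (in some half-plane) by a Dirichlet series $\Phi(s)=\sum_{n\ge1}c_nn^{-s}$. $C_\Phi f=f\circ\Phi$; $C_\Phi$ is bounded on $\mathcal N_u$ if it maps $\mathcal N_u$ into itself and there is $C>0$ with $\|f\circ\Phi\|_0\le C\|f\|_0$ for all $f\in\mathcal N_u$. $\mathbb T^\infty$ is the countably infinite product of unit circles with normalized Haar measure $m_\infty$. A point $\chi=(\chi_1,\chi_2,\dots)\in\mathbb T^\infty$ is identified with the completely multiplicative function $\chi:\mathbb N\to\mathbb T$ with $\chi(p_j)=\chi_j$, $p_j$ the $j$-th prime. For a Dirichlet series $g(s)=\sum_nb_nn^{-s}$, the vertical limit function is $g_\chi(s)=\sum_nb_n\chi(n)n^{-s}$ (extended analytically to $\mathbb C_0$ where possible), and $g^*(\chi)=\lim_{\sigma\to0^+}g_\chi(\sigma)$; in particular $\Phi^*(\chi)=\lim_{\sigma\to0^+}\Phi_\chi(\sigma)$. The push-forward measure is $\mu_{\Phi^*}(E)=m_\infty(\{\chi\in\mathbb T^\infty:\Phi^*(\chi)\in E\})$ for Borel $E\subset\mathbb C_0$. *)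

theory Defs
  imports
    "HOL-Probability.Probability"
    "HOL-Complex_Analysis.Complex_Analysis"
    "HOL-Computational_Algebra.Primes"
    "HOL-Library.Infinite_Set"
begin

definition half_plane :: "real \<Rightarrow> complex set" where
  "half_plane \<theta> = {s. Re s > \<theta>}"

text \<open>
  A Dirichlet series is given by its coefficient sequence \<open>a\<close>; only the values \<open>a n\<close>
  for \<open>n \<ge> 1\<close> are ever used.
\<close>

definition dirichlet_partial :: "(nat \<Rightarrow> complex) \<Rightarrow> nat \<Rightarrow> complex \<Rightarrow> complex" where
  "dirichlet_partial a N s = (\<Sum>n=1..N. a n * of_nat n powr (- s))"

definition dirichlet_fun :: "(nat \<Rightarrow> complex) \<Rightarrow> complex \<Rightarrow> complex" where
  "dirichlet_fun a s = lim (\<lambda>N. dirichlet_partial a N s)"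

definition represented_by :: "(complex \<Rightarrow> complex) \<Rightarrow> (nat \<Rightarrow> complex) \<Rightarrow> bool" where
  "represented_by g b \<longleftrightarrow>
     (\<exists>\<theta>. \<forall>s\<in>half_plane \<theta>. (\<lambda>N. dirichlet_partial b N s) \<longlonglongrightarrow> g s)"

definition abscissa_unif :: "(nat \<Rightarrow> complex) \<Rightarrow> ereal" where
  "abscissa_unif a =
     Inf {ereal \<theta> | \<theta>. uniformly_convergent_on (half_plane \<theta>) (dirichlet_partial a)}"

definition log_plus :: "real \<Rightarrow> real" where
  "log_plus x = max (ln x) 0"

text \<open>
  If \<open>g\<close> is the sum of a Dirichlet series with \<open>\<sigma>\<^sub>u \<le> 0\<close> and \<open>\<phi>\<close> is continuous on
  \<open>[0, \<infinity>)\<close>, then \<open>\<phi> |g(\<sigma> + it)|\<close> is almost periodic in \<open>t\<close> for \<open>\<sigma> > 0\<close>, so the limit below exists.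
\<close>

definition vertical_mean :: "(real \<Rightarrow> real) \<Rightarrow> (complex \<Rightarrow> complex) \<Rightarrow> real \<Rightarrow> real" where
  "vertical_mean \<phi> g \<sigma> =
     Lim at_top (\<lambda>T. 1 / (2 * T) * integral {-T..T} (\<lambda>t. \<phi> (norm (g (Complex \<sigma> t)))))"

definition Nevanlinna_u :: "(nat \<Rightarrow> complex) set" where
  "Nevanlinna_u = {a. abscissa_unif a \<le> 0 \<and>
     Limsup (at_right 0) (\<lambda>\<sigma>. ereal (vertical_mean log_plus (dirichlet_fun a) \<sigma>)) < \<infinity>}"

definition Nevanlinna_norm :: "(complex \<Rightarrow> complex) \<Rightarrow> ereal" where
  "Nevanlinna_norm g =
     Limsup (at_right 0) (\<lambda>\<sigma>. ereal (vertical_mean (\<lambda>x. ln (1 + x)) g \<sigma>))"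

definition char_zero_symbol :: "(complex \<Rightarrow> complex) \<Rightarrow> bool" where
  "char_zero_symbol \<Phi> \<longleftrightarrow> \<Phi> holomorphic_on half_plane 0 \<and> (\<exists>c. represented_by \<Phi> c)"

text \<open>
  The inclusion \<open>\<Phi> ` half_plane 0 \<subseteq> half_plane 0\<close> is what makes \<open>f \<circ> \<Phi>\<close> meaningful for all
  \<open>f\<close> in the class.
\<close>

definition composition_bounded :: "(complex \<Rightarrow> complex) \<Rightarrow> bool" where
  "composition_bounded \<Phi> \<longleftrightarrow>
     \<Phi> ` half_plane 0 \<subseteq> half_plane 0 \<and>
     (\<forall>a\<in>Nevanlinna_u. \<exists>b\<in>Nevanlinna_u.
        \<forall>s\<in>half_plane 0. dirichlet_fun a (\<Phi> s) = dirichlet_fun b s) \<and>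
     (\<exists>C>0. \<forall>a\<in>Nevanlinna_u.
        Nevanlinna_norm (dirichlet_fun a \<circ> \<Phi>) \<le> ereal C * Nevanlinna_norm (dirichlet_fun a))"

definition circle_measure :: "complex measure" where
  "circle_measure =
     distr (uniform_measure lborel {0..<2 * pi}) (restrict_space borel (sphere 0 1)) cis"

definition polytorus :: "(nat \<Rightarrow> complex) measure" where
  "polytorus = PiM UNIV (\<lambda>_. circle_measure)"

definition nth_prime :: "nat \<Rightarrow> nat" where
  "nth_prime j = enumerate {p. prime p} j"

text \<open>
  The completely multiplicative function with value \<open>\<omega> j\<close> at \<open>nth_prime j\<close>
  (indices start at 0, so \<open>nth_prime 0 = 2\<close>); meaningful for \<open>n \<ge> 1\<close>.
\<close>

definition multiplicative_ext :: "(nat \<Rightarrow> complex) \<Rightarrow> nat \<Rightarrow> complex" where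
  "multiplicative_ext \<omega> n =
     (\<Prod>j\<in>{j. nth_prime j dvd n}. \<omega> j ^ multiplicity (nth_prime j) n)"

text \<open>
  \<open>h\<close> is the vertical limit function \<open>g\<^sub>\<omega>\<close>, continued analytically to \<open>half_plane 0\<close>.
  On that half-plane \<open>h\<close> is unique, by uniqueness of Dirichlet coefficients and the identity theorem.
\<close>

definition vertical_limit ::
    "(complex \<Rightarrow> complex) \<Rightarrow> (nat \<Rightarrow> complex) \<Rightarrow> (complex \<Rightarrow> complex) \<Rightarrow> bool" where
  "vertical_limit g \<omega> h \<longleftrightarrow> h holomorphic_on half_plane 0 \<and>
     (\<exists>b. represented_by g b \<and> represented_by h (\<lambda>n. b n * multiplicative_ext \<omega> n))"

definition has_boundary_value ::
    "(complex \<Rightarrow> complex) \<Rightarrow> (nat \<Rightarrow> complex) \<Rightarrow> complex \<Rightarrow> bool" where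
  "has_boundary_value g \<omega> z \<longleftrightarrow>
     (\<exists>h. vertical_limit g \<omega> h \<and> ((\<lambda>\<sigma>. h (complex_of_real \<sigma>)) \<longlongrightarrow> z) (at_right 0))"

text \<open>
  The default value 0 lies outside \<open>half_plane 0\<close>, so points without a boundary value
  do not contribute to the push-forward measure.
\<close>

definition boundary_fun :: "(complex \<Rightarrow> complex) \<Rightarrow> (nat \<Rightarrow> complex) \<Rightarrow> complex" where
  "boundary_fun g \<omega> =
     (if \<exists>z. has_boundary_value g \<omega> z then THE z. has_boundary_value g \<omega> z else 0)"

definition boundary_pushforward :: "(complex \<Rightarrow> complex) \<Rightarrow> complex measure" where
  "boundary_pushforward \<Phi> =
     distr polytorus (restrict_space borel (half_plane 0)) (boundary_fun \<Phi>)"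

definition Carleson_embedding :: "complex measure \<Rightarrow> bool" where
  "Carleson_embedding \<mu> \<longleftrightarrow>
     (\<exists>C>0. \<forall>a\<in>Nevanlinna_u.
        enn2ereal (\<integral>\<^sup>+ s. ennreal (ln (1 + norm (dirichlet_fun a s))) \<partial>\<mu>)
          \<le> ereal C * Nevanlinna_norm (dirichlet_fun a))"

end

theory Submission imports Defs begin

text \<open>
  Under the compactness hypothesis the two conditions are the same inequality, because for every
  \<open>f\<close> in the class
  \<open>\<parallel>f \<circ> \<Phi>\<parallel>\<^sub>0 = \<integral> log (1 + |f|) d\<mu>\<close>, where \<open>\<mu>\<close> is the push-forward of Haar measure
  under \<open>\<Phi>\<^sup>*\<close>. This identity is the lemma \<open>compact_symbol_identity\<close>; its proof runs as follows.

  The function \<open>f\<close> is continuous on the compact set \<open>closure (\<Phi> ` half_plane 0)\<close>, so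
  \<open>g = f \<circ> \<Phi>\<close> is bounded, and it has a Dirichlet series in some half-plane: the assumption that
  \<open>g\<close> has boundary values presupposes one. Bohr's theorem (\<open>Bohr_uniform_convergence\<close>) turns this
  into uniform convergence on every \<open>half_plane \<theta>\<close> with \<open>\<theta> > 0\<close>. This puts the coefficients of
  \<open>g\<close> into \<open>Nevanlinna_u\<close>, so only the norm inequality is left in the boundedness of the
  composition operator. Bohr's theorem rests on the bound \<open>O(N\<^sup>\<eta>)\<close> for the partial sums,
  uniformly in the half-plane: the \<open>N\<close>-th partial sum is a vertical convolution of \<open>g\<close> with a
  kernel whose Fourier transform is a trapezoid, equal to 1 up to \<open>ln N\<close> and to 0 from
  \<open>ln (N + 1)\<close> on, and the \<open>L\<^sup>1\<close> norm of that kernel grows more slowly than any power of \<open>N\<close>.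

  By Kronecker's theorem every twist \<open>g\<^sub>\<omega>\<close> is a limit of vertical translates of \<open>g\<close>. Hence the
  twisted series converge uniformly in \<open>\<omega>\<close> as well, their values stay in the closure of the
  range of \<open>g\<close>, and \<open>g\<^sub>\<omega>(\<sigma>)\<close> is a uniform limit of trigonometric polynomials on the torus. For
  trigonometric polynomials, averaging along the flow \<open>t \<mapsto> (p\<^sub>j\<^sup>-\<^sup>i\<^sup>t)\<close> agrees with
  averaging over the torus, which gives (\<open>vertical_mean_eq_torus_integral\<close>)
  that the vertical mean of \<open>\<phi> |g|\<close> at \<open>\<sigma>\<close> is \<open>\<integral> \<phi> |g\<^sub>\<omega>(\<sigma>)| d\<omega>\<close>.
  As \<open>\<sigma> \<rightarrow> 0\<close> dominated convergence yields
  \<open>\<parallel>g\<parallel>\<^sub>0 = \<integral> log (1 + |g\<^sup>*|)\<close>, and \<open>g\<^sup>* = f \<circ> \<Phi>\<^sup>*\<close> almost everywhere by assumption.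

  One measure-theoretic point needs care. Haar measure is not completed here and the push-forward
  is formed with \<open>distr\<close>, so \<open>boundary_fun \<Phi>\<close> has to be Borel measurable everywhere, and it may leave
  the half-plane on a null set. Both are settled by writing the existence of a radial limit as a
  Cauchy condition over rational points.
\<close>

section \<open>A kernel with trapezoidal Fourier transform\<close>

text \<open>
  An antiderivative of the integrand is \<open>x * Si (x * t) - (1 - cos (x * t)) / t\<close>, and the sine
  integral \<open>Si\<close> tends to \<open>pi / 2\<close>.
\<close>

lemma has_bochner_integral_one_minus_cos_half:
  fixes x :: real
  assumes "x > 0"
  shows "has_bochner_integral lborel (\<lambda>t. indicator {0<..} t *\<^sub>R ((1 - cos (x * t)) / t\<^sup>2)) (x * pi / 2)"
proof -
  let ?F = "\<lambda>t. x * Si (x * t) - (1 - cos (x * t)) / t"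
  let ?f = "\<lambda>t. (1 - cos (x * t)) / t\<^sup>2"
  have d: "(?F has_real_derivative ?f t) (at t)" if "0 < t" for t
    using that assms
    by (auto intro!: derivative_eq_intros DERIV_chain2[OF DERIV_Si] simp: field_simps power2_eq_square)
  have c: "isCont ?f t" if "0 < t" for t
    using that by (auto intro!: continuous_intros)
  have l0: "(?F \<longlongrightarrow> 0) (at_right 0)"
  proof -
    have "((\<lambda>t. (1 - cos (x * t))/t) \<longlongrightarrow> 0) (at_right 0)"
      by real_asymp
    moreover have "((\<lambda>t. x * Si (x * t)) \<longlongrightarrow> x * Si (x * 0)) (at_right 0)"
      by (intro tendsto_intros isCont_tendsto_compose[OF isCont_Si])
    moreover have "Si 0 = 0"
      by (simp add: Si_def zero_ereal_def)
    ultimately show ?thesis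
      using tendsto_diff by fastforce
  qed
  have l1: "(?F \<longlongrightarrow> x * pi / 2) at_top"
  proof -
    have "((\<lambda>t. (1 - cos (x * t))/t) \<longlongrightarrow> 0) at_top"
    proof (rule Lim_null_comparison)
      show "\<forall>\<^sub>F t in at_top. norm ((1 - cos (x * t))/t) \<le> 2 / t"
        using eventually_gt_at_top[of 0]
      proof eventually_elim
        case (elim t)
        have "1 - cos (x*t) \<le> 2" "1 - cos (x*t) \<ge> 0" using cos_ge_minus_one[of "x*t"] by auto
        then show ?case using elim by (simp add: divide_right_mono)
      qed
      show "((\<lambda>t::real. 2 / t) \<longlongrightarrow> 0) at_top" by real_asymp
    qed
    moreover have "((\<lambda>t. x * Si (x * t)) \<longlongrightarrow> x * (pi/2)) at_top"
      by (intro tendsto_intros filterlim_compose[OF Si_at_top]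
           filterlim_tendsto_pos_mult_at_top[OF tendsto_const] filterlim_ident assms)
    ultimately show ?thesis
      using tendsto_diff by fastforce
  qed
  have nn: "AE t in lborel. ereal 0 < ereal t \<longrightarrow> ereal t < \<infinity> \<longrightarrow> 0 \<le> ?f t"
    by auto
  have "set_integrable lborel (einterval (ereal 0) \<infinity>) ?f"
    by (rule interval_integral_FTC_nonneg[where F="?F" and A=0 and B="x*pi/2"])
       (use d c l0 l1 in \<open>auto simp: ereal_tendsto_simps\<close>)
  moreover have "(LBINT t=ereal 0..\<infinity>. ?f t) = x*pi/2 - 0"
    by (rule interval_integral_FTC_nonneg[where F="?F" and A=0 and B="x*pi/2"])
       (use d c l0 l1 in \<open>auto simp: ereal_tendsto_simps\<close>)
  ultimately show ?thesis
    by (simp add: has_bochner_integral_iff set_integrable_def set_lebesgue_integral_def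
        interval_lebesgue_integral_def einterval_eq)
qed

text \<open>
  This is the Fourier representation of \<open>\<bar>x\<bar>\<close>. Piecewise linear functions such as the trapezoid
  below are combinations of shifts of \<open>\<bar>x\<bar>\<close>, so it determines their kernels.
\<close>

lemma has_bochner_integral_one_minus_cos:
  fixes x :: real
  shows "has_bochner_integral lborel (\<lambda>t. (1 - cos (x * t)) / t\<^sup>2) (pi * \<bar>x\<bar>)"
proof (cases "x = 0")
  case True
  then show ?thesis by (simp add: has_bochner_integral_zero)
next
  case False
  have 1: "has_bochner_integral lborel (\<lambda>t. indicator {0<..} t *\<^sub>R ((1 - cos (\<bar>x\<bar> * t)) / t\<^sup>2)) (\<bar>x\<bar> * pi / 2)"
    using has_bochner_integral_one_minus_cos_half[of "\<bar>x\<bar>"] False by auto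
  have "has_bochner_integral lborel (\<lambda>t. indicator {0<..} (0 + (-1) * t) *\<^sub>R ((1 - cos (\<bar>x\<bar> * (0 + (-1) * t))) / (0 + (-1)*t)\<^sup>2)) ((\<bar>x\<bar> * pi / 2) /\<^sub>R \<bar>-1\<bar>)"
    by (rule lborel_has_bochner_integral_real_affine_iff[THEN iffD1, OF _ 1]) simp
  from has_bochner_integral_add[OF 1 this]
  have "has_bochner_integral lborel (\<lambda>t. indicator {0<..} t *\<^sub>R ((1 - cos (\<bar>x\<bar> * t)) / t\<^sup>2) +
     indicator {0<..} (- t) *\<^sub>R ((1 - cos (\<bar>x\<bar> * t)) / t\<^sup>2)) (pi * \<bar>x\<bar>)"
    by (simp add: mult.commute[of pi])
  moreover have "cos (\<bar>x\<bar> * t) = cos (x * t)" for t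
    by (metis abs_real_def cos_minus minus_mult_commute mult_minus_right)
  then have "(\<lambda>t. indicator {0<..} t *\<^sub>R ((1 - cos (\<bar>x\<bar> * t)) / t\<^sup>2) +
     indicator {0<..} (- t) *\<^sub>R ((1 - cos (\<bar>x\<bar> * t)) / t\<^sup>2)) = (\<lambda>t. (1 - cos (x * t)) / t\<^sup>2)"
    by (auto simp: fun_eq_iff indicator_def)
  ultimately show ?thesis by simp
qed

text \<open>
  Up to the removable singularity at 0 this is
  \<open>(cos (L * t) - cos (L' * t)) / (pi * (L' - L) * t\<^sup>2)\<close>. The product form is continuous on the whole
  line, and it shows both factors that control the \<open>L\<^sup>1\<close> norm.
\<close>

definition trapezoid_kernel :: "real \<Rightarrow> real \<Rightarrow> real \<Rightarrow> real" where
  "trapezoid_kernel L L' t =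
     (L + L') / (2 * pi) * sinc ((L + L') / 2 * t) * sinc ((L' - L) / 2 * t)"

lemma continuous_on_trapezoid_kernel [continuous_intros]:
  "continuous_on S (trapezoid_kernel L L')"
proof -
  have "continuous_on S (\<lambda>t. (L + L') / (2 * pi) * sinc ((L + L') / 2 * t) * sinc ((L' - L) / 2 * t))"
    by (intro continuous_intros)
  then show ?thesis
    unfolding trapezoid_kernel_def .
qed

lemma borel_measurable_trapezoid_kernel [measurable]:
  "trapezoid_kernel L L' \<in> borel_measurable borel"
  by (intro borel_measurable_continuous_onI continuous_on_trapezoid_kernel)

lemma trapezoid_kernel_even [simp]: "trapezoid_kernel L L' (-t) = trapezoid_kernel L L' t"
  unfolding trapezoid_kernel_def by simp

lemma trapezoid_kernel_nonzero:
  assumes "0 \<le> L" "L < L'" "t \<noteq> 0"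
  shows "trapezoid_kernel L L' t = (cos (L * t) - cos (L' * t)) / (pi * (L' - L) * t\<^sup>2)"
proof -
  have "cos (L * t) - cos (L' * t) = 2 * sin ((L + L') / 2 * t) * sin ((L' - L) / 2 * t)"
    by (simp add: cos_diff_cos field_simps)
  moreover have "(L + L') / 2 * t \<noteq> 0" "(L' - L) / 2 * t \<noteq> 0"
    using assms by auto
  moreover have "A / (2 * pi) * (u / (A / 2 * t)) * (v / (D / 2 * t)) = (2 * u * v) / (pi * D * t\<^sup>2)"
    if "A \<noteq> 0" "D \<noteq> 0" for A D u v
    using that assms(3) by (simp add: field_simps power2_eq_square)
  from this[of "L + L'" "L' - L"] assms
  have "(L + L') / (2 * pi) * (u / ((L + L') / 2 * t)) * (v / ((L' - L) / 2 * t))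
    = (2 * u * v) / (pi * (L' - L) * t\<^sup>2)" for u v
    by auto
  ultimately show ?thesis
    unfolding trapezoid_kernel_def by presburger
qed

text \<open>
  The product formula for cosines splits the integrand into four terms
  \<open>(1 - cos (y * t)) / t\<^sup>2\<close> with \<open>y = x \<plusminus> L, x \<plusminus> L'\<close>. The resulting function of \<open>x\<close> is the
  trapezoid with plateau \<open>[-L, L]\<close> and support \<open>[-L', L']\<close>.
\<close>

lemma has_bochner_integral_trapezoid_kernel_cos:
  assumes "0 \<le> L" "L < L'"
  shows "has_bochner_integral lborel (\<lambda>t. trapezoid_kernel L L' t * cos (x * t))
    ((\<bar>x + L'\<bar> + \<bar>x - L'\<bar> - \<bar>x + L\<bar> - \<bar>x - L\<bar>) / (2 * (L' - L)))"
proof -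
  let ?h = "\<lambda>y t. (1 - cos (y * t)) / t\<^sup>2 :: real"
  have "has_bochner_integral lborel
     (\<lambda>t. (?h (x + L') t + ?h (x - L') t - ?h (x + L) t - ?h (x - L) t) / (2 * pi * (L' - L)))
     ((pi * \<bar>x + L'\<bar> + pi * \<bar>x - L'\<bar> - pi * \<bar>x + L\<bar> - pi * \<bar>x - L\<bar>) / (2 * pi * (L' - L)))"
    by (intro has_bochner_integral_divide_zero has_bochner_integral_add has_bochner_integral_diff
        has_bochner_integral_one_minus_cos)
  also have "(pi * \<bar>x + L'\<bar> + pi * \<bar>x - L'\<bar> - pi * \<bar>x + L\<bar> - pi * \<bar>x - L\<bar>) / (2 * pi * (L' - L))
     = (\<bar>x + L'\<bar> + \<bar>x - L'\<bar> - \<bar>x + L\<bar> - \<bar>x - L\<bar>) / (2 * (L' - L))"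
    using assms by (simp add: field_simps)
  finally have *: "has_bochner_integral lborel
     (\<lambda>t. (?h (x + L') t + ?h (x - L') t - ?h (x + L) t - ?h (x - L) t) / (2 * pi * (L' - L))) \<dots>" .
  have eq: "(?h (x + L') t + ?h (x - L') t - ?h (x + L) t - ?h (x - L) t) / (2 * pi * (L' - L))
      = trapezoid_kernel L L' t * cos (x * t)" if "t \<noteq> 0" for t
  proof -
    have "cos ((x + L) * t) + cos ((x - L) * t) = 2 * cos (x * t) * cos (L * t)" for L
      by (simp add: ring_distribs cos_add cos_diff)
    then have "(1 - cos ((x + L') * t)) + (1 - cos ((x - L') * t)) - (1 - cos ((x + L) * t))
       - (1 - cos ((x - L) * t)) = 2 * cos (x * t) * (cos (L * t) - cos (L' * t))"
      by (smt (verit) right_diff_distrib)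
    then have "(?h (x + L') t + ?h (x - L') t - ?h (x + L) t - ?h (x - L) t)
        = 2 * cos (x * t) * (cos (L * t) - cos (L' * t)) / t\<^sup>2"
      by (simp add: add_divide_distrib [symmetric] diff_divide_distrib [symmetric])
    then show ?thesis
      using assms that by (simp add: trapezoid_kernel_nonzero) (simp add: mult.commute mult.left_commute)
  qed
  have "AE t in lborel. (?h (x + L') t + ?h (x - L') t - ?h (x + L) t - ?h (x - L) t) / (2 * pi * (L' - L))
      = trapezoid_kernel L L' t * cos (x * t)"
    using AE_lborel_singleton[of 0] by eventually_elim (rule eq)
  then show ?thesis
    by (rule has_bochner_integral_cong_AE[THEN iffD1, rotated 2, OF _ *]) measurable
qed

lemma has_bochner_integral_powr_tail:
  fixes \<eta> :: real
  assumes "\<eta> > 0"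
  shows "has_bochner_integral lborel (\<lambda>t. indicator {1..} t * t powr (-1 - \<eta>)) (1 / \<eta>)"
proof -
  have "(\<integral>\<^sup>+ t. ennreal (t powr (-1 - \<eta>)) * indicator {1..} t \<partial>lborel) = ennreal (0 - (- (1 powr (-\<eta>) / \<eta>)))"
  proof (rule nn_integral_FTC_atLeast[where F="\<lambda>t. - (t powr (-\<eta>) / \<eta>)"])
    show "((\<lambda>t. - (t powr - \<eta> / \<eta>)) \<longlongrightarrow> 0) at_top"
      using assms by real_asymp
    fix t :: real assume "1 \<le> t"
    then show "((\<lambda>t. - (t powr - \<eta> / \<eta>)) has_real_derivative t powr (- 1 - \<eta>)) (at t)"
      using assms by (auto intro!: derivative_eq_intros simp: powr_diff powr_minus field_simps)
  qed auto
  then have "(\<integral>\<^sup>+ t. ennreal (indicator {1..} t * t powr (-1 - \<eta>)) \<partial>lborel) = ennreal (1 / \<eta>)"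
    by (simp add: ennreal_mult' mult.commute ennreal_indicator)
  then show ?thesis
    using assms by (intro has_bochner_integral_nn_integral) auto
qed

lemma abs_sinc_le_1: "\<bar>sinc x\<bar> \<le> 1"
  using abs_sin_x_le_abs_x[of x] by (auto simp: divide_le_eq)

text \<open>
  Near 0 both sinc factors are bounded by 1. For \<open>\<bar>t\<bar> \<ge> 1\<close> the wide factor contributes
  \<open>1 / \<bar>t\<bar>\<close>, while \<open>min 1 (1 / y) \<le> y powr (- \<eta>)\<close> for the narrow one makes the product
  integrable at the cost of a small power of \<open>1 / (L' - L)\<close>. The true order is logarithmic, but an
  arbitrarily small power is enough for Bohr's theorem.
\<close>

lemma trapezoid_kernel_L1:
  assumes "0 \<le> L" "L < L'" "0 < \<eta>" "\<eta> \<le> 1"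
  shows "integrable lborel (trapezoid_kernel L L')"
    and "(\<integral>t. \<bar>trapezoid_kernel L L' t\<bar> \<partial>lborel) \<le> L + L' + ((L' - L) / 2) powr (-\<eta>) / \<eta>"
proof -
  define a where "a = (L + L') / 2"
  define d where "d = (L' - L) / 2"
  have a: "a > 0" and d: "d > 0" using assms by (auto simp: a_def d_def)
  have a': "\<bar>a / pi\<bar> = a / pi" using a by simp
  have k: "trapezoid_kernel L L' t = a / pi * sinc (a * t) * sinc (d * t)" for t
    unfolding trapezoid_kernel_def a_def d_def by simp
  \<comment> \<open>An integrable majorant: constant on \<open>[-1, 1]\<close>, a power of \<open>\<bar>t\<bar>\<close> outside. The term \<open>0 + (-1) * t\<close> has the shape of the affine substitution rule.\<close>
  define B where "B t = a / pi * indicator {-1..1} t +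
     d powr (-\<eta>) / pi * (indicator {1..} t * t powr (-1 - \<eta>) + indicator {1..} (0 + (-1) * t) * (0 + (-1) * t) powr (-1 - \<eta>))" for t :: real
  have hp: "has_bochner_integral lborel (\<lambda>t. indicator {1..} (0 + (-1) * t) * (0 + (-1) * t) powr (-1 - \<eta>)) ((1 / \<eta>) /\<^sub>R \<bar>-1\<bar>)"
    by (rule lborel_has_bochner_integral_real_affine_iff[THEN iffD1, OF _ has_bochner_integral_powr_tail]) (use assms in auto)
  have i1: "has_bochner_integral lborel (indicator {-1..1::real}) (2::real)"
    using has_bochner_integral_real_indicator[of "{-1..1::real}" lborel] by simp
  have B: "has_bochner_integral lborel B (a / pi * 2 + d powr (-\<eta>) / pi * (1/\<eta> + (1/\<eta>) /\<^sub>R \<bar>-1\<bar>))"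
    unfolding B_def
    by (intro has_bochner_integral_add has_bochner_integral_mult_right hp has_bochner_integral_powr_tail assms i1)
  have Bge: "\<bar>trapezoid_kernel L L' t\<bar> \<le> B t" for t
  proof (cases "\<bar>t\<bar> \<le> 1")
    case True
    have "\<bar>trapezoid_kernel L L' t\<bar> = a / pi * (\<bar>sinc (a * t)\<bar> * \<bar>sinc (d * t)\<bar>)"
      by (simp only: k abs_mult mult.assoc a')
    also have "\<dots> \<le> a / pi * (1 * 1)"
      using a by (intro mult_left_mono mult_mono abs_sinc_le_1) auto
    also have "\<dots> \<le> B t"
      using True a unfolding B_def by (auto simp: indicator_def)
    finally show ?thesis .
  next
    case False
    then have t: "\<bar>t\<bar> > 1" by simp
    have 1: "\<bar>sinc (a * t)\<bar> \<le> 1 / (a * \<bar>t\<bar>)"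
      using a t abs_sin_le_one[of "a * t"] by (auto simp: abs_mult divide_right_mono)
    have 2: "\<bar>sinc (d * t)\<bar> \<le> (d * \<bar>t\<bar>) powr (-\<eta>)"
    proof (cases "d * \<bar>t\<bar> \<le> 1")
      case True
      then have "(d * \<bar>t\<bar>) powr (-\<eta>) \<ge> 1 powr (-\<eta>)"
        using d t assms by (intro powr_mono2') auto
      then show ?thesis using abs_sinc_le_1[of "d*t"] by simp
    next
      case False
      have "\<bar>sinc (d * t)\<bar> \<le> 1 / (d * \<bar>t\<bar>)"
        using d t abs_sin_le_one[of "d * t"] by (auto simp: abs_mult divide_right_mono)
      also have "\<dots> = (d * \<bar>t\<bar>) powr (-1)" using d t by (simp add: powr_minus_divide)
      also have "\<dots> \<le> (d * \<bar>t\<bar>) powr (-\<eta>)" using False assms by (intro powr_mono) auto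
      finally show ?thesis .
    qed
    have "\<bar>trapezoid_kernel L L' t\<bar> = a / pi * (\<bar>sinc (a * t)\<bar> * \<bar>sinc (d * t)\<bar>)"
      by (simp only: k abs_mult mult.assoc a')
    also have "\<dots> \<le> a / pi * (1 / (a * \<bar>t\<bar>) * (d * \<bar>t\<bar>) powr (-\<eta>))"
      using a by (intro mult_left_mono mult_mono 1 2) auto
    also have "\<dots> = d powr (-\<eta>) / pi * \<bar>t\<bar> powr (-1 - \<eta>)"
      using a d t by (simp add: powr_mult powr_diff powr_minus field_simps)
    also have "\<dots> = B t"
      using t unfolding B_def by (cases "t > 0") (auto simp: indicator_def)
    finally show ?thesis .
  qed
  show int: "integrable lborel (trapezoid_kernel L L')"
    by (rule Bochner_Integration.integrable_bound[of _ B]) (use B Bge in \<open>auto simp: has_bochner_integral_iff intro!: AE_I2 order_trans[OF Bge abs_ge_self]\<close>)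
  have "(\<integral>t. \<bar>trapezoid_kernel L L' t\<bar> \<partial>lborel) \<le> (\<integral>t. B t \<partial>lborel)"
    using int B Bge by (intro integral_mono) (auto simp: has_bochner_integral_iff)
  also have "\<dots> = (2 * a + d powr (-\<eta>) * (2 / \<eta>)) / pi"
    using B by (simp add: has_bochner_integral_iff field_simps)
  also have "\<dots> \<le> (2 * a + d powr (-\<eta>) * (2 / \<eta>)) / 2"
    using a assms pi_ge_two by (intro divide_left_mono add_nonneg_nonneg) auto
  also have "\<dots> \<le> L + L' + d powr (-\<eta>) / \<eta>"
    using assms unfolding a_def by simp
  finally show "(\<integral>t. \<bar>trapezoid_kernel L L' t\<bar> \<partial>lborel) \<le> L + L' + ((L' - L) / 2) powr (-\<eta>) / \<eta>"
    unfolding d_def .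
qed

text \<open>
  The sine part vanishes because the kernel is even. Frequencies strictly between \<open>L\<close> and \<open>L'\<close> are left
  out: no \<open>ln n\<close> lies between \<open>ln N\<close> and \<open>ln (N + 1)\<close>.
\<close>

lemma trapezoid_kernel_Fourier:
  assumes "0 \<le> L" "L < L'" "0 \<le> x" "x \<le> L \<or> L' \<le> x"
  shows "has_bochner_integral lborel (\<lambda>t. of_real (trapezoid_kernel L L' t) * exp (- \<i> * of_real (x * t)))
    (if x \<le> L then 1 else 0)"
proof -
  let ?k = "trapezoid_kernel L L'"
  have int: "integrable lborel ?k" using trapezoid_kernel_L1(1)[of L L' 1] assms by auto
  have c: "has_bochner_integral lborel (\<lambda>t. ?k t * cos (x * t)) (if x \<le> L then 1 else 0)"
    using has_bochner_integral_trapezoid_kernel_cos[OF assms(1,2), of x] assms by (auto simp: field_simps split: if_splits)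
  have si: "integrable lborel (\<lambda>t. ?k t * sin (x * t))"
    by (rule Bochner_Integration.integrable_bound[OF int]) (auto simp: abs_mult intro!: AE_I2 mult_left_le)
  have "(\<integral>t. ?k t * sin (x * t) \<partial>lborel) = \<bar>-1\<bar> *\<^sub>R (\<integral>t. ?k (0 + (-1) * t) * sin (x * (0 + (-1) * t)) \<partial>lborel)"
    by (rule lborel_integral_real_affine) simp
  then have "(\<integral>t. ?k t * sin (x * t) \<partial>lborel) = 0" by simp
  then have s: "has_bochner_integral lborel (\<lambda>t. ?k t * sin (x * t)) 0"
    using si by (simp add: has_bochner_integral_iff)
  have "has_bochner_integral lborel (\<lambda>t. of_real (?k t * cos (x * t)) - \<i> * of_real (?k t * sin (x * t)))
     (of_real (if x \<le> L then 1 else 0) - \<i> * of_real 0)"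
    by (intro has_bochner_integral_diff has_bochner_integral_mult_right has_bochner_integral_of_real c s)
  also have "(\<lambda>t. of_real (?k t * cos (x * t)) - \<i> * of_real (?k t * sin (x * t)))
     = (\<lambda>t. of_real (?k t) * exp (- \<i> * of_real (x * t)))"
  proof
    fix t
    have "exp (- \<i> * of_real (x * t)) = of_real (cos (x * t)) - \<i> * of_real (sin (x * t))"
      by (simp add: complex_eq_iff Re_exp Im_exp)
    then show "of_real (?k t * cos (x * t)) - \<i> * of_real (?k t * sin (x * t))
      = of_real (?k t) * exp (- \<i> * of_real (x * t))"
      unfolding \<open>exp _ = _\<close> by (simp add: algebra_simps)
  qed
  finally show ?thesis by (simp only: of_real_0 mult_zero_right diff_zero of_real_1 if_distrib[of of_real] cong: if_cong)
qed

section \<open>Absolute convergence and uniqueness of coefficients\<close>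

lemma open_half_plane [simp, intro]: "open (half_plane \<theta>)"
  unfolding half_plane_def by (simp add: open_halfspace_Re_gt)

lemma convex_half_plane [simp, intro]: "convex (half_plane \<theta>)"
  unfolding half_plane_def by (simp add: convex_halfspace_Re_gt)

text \<open>
  The term with index 0 is 0 because \<open>0 powr z = 0\<close>, so partial sums are those of an ordinary series over all
  natural numbers.
\<close>

lemma dirichlet_partial_eq_sum:
  "dirichlet_partial a N s = (\<Sum>n<Suc N. a n * of_nat n powr (- s))"
  unfolding dirichlet_partial_def
  by (rule sum.mono_neutral_left) (auto simp: not_less_eq_eq)

lemma dirichlet_partial_tendsto_iff_sums:
  "(\<lambda>N. dirichlet_partial a N s) \<longlonglongrightarrow> l \<longleftrightarrow> (\<lambda>n. a n * of_nat n powr (- s)) sums l"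
  unfolding dirichlet_partial_eq_sum sums_def by (rule filterlim_sequentially_Suc)

lemma norm_nat_powr: "norm (of_nat n powr (z::complex)) = (if n = 0 then 0 else real n powr Re z)"
  using norm_powr_real_powr[of "of_nat n" z] by auto

lemma norm_nat_powr_le: "norm (of_nat n powr (z::complex)) \<le> real n powr Re z"
  by (simp add: norm_nat_powr)

lemma holomorphic_on_dirichlet_partial [holomorphic_intros]:
  "dirichlet_partial a N holomorphic_on S"
  unfolding dirichlet_partial_def by (auto intro!: holomorphic_intros)

text \<open>
  Convergence at one point bounds the terms there, and moving more than 1 to the right gains a summable
  factor \<open>n powr (-1 - \<epsilon>)\<close>.
\<close>

lemma represented_by_absolutely:
  assumes "represented_by g b"
  shows "\<exists>\<theta>\<ge>0. \<forall>s. Re s > \<theta> \<longrightarrow> summable (\<lambda>n. norm (b n * of_nat n powr (- s))) \<and>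
    (\<lambda>n. b n * of_nat n powr (- s)) sums g s"
proof -
  obtain \<theta>0 where \<theta>0: "\<And>s. Re s > \<theta>0 \<Longrightarrow> (\<lambda>n. b n * of_nat n powr (- s)) sums g s"
    using assms unfolding represented_by_def dirichlet_partial_tendsto_iff_sums half_plane_def by auto
  \<comment> \<open>A point at which the series converges.\<close>
  define s0 where "s0 = \<theta>0 + 1"
  have "(\<lambda>n. b n * of_nat n powr (- of_real s0)) \<longlonglongrightarrow> 0"
    by (rule summable_LIMSEQ_zero, rule sums_summable, rule \<theta>0) (simp add: s0_def)
  then have "Bseq (\<lambda>n. b n * of_nat n powr (- of_real s0))"
    using convergentI convergent_imp_Bseq by blast
  then obtain K where K: "\<And>n. norm (b n * of_nat n powr (- of_real s0)) \<le> K"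
    by (auto simp: Bseq_def)
  show ?thesis
  proof (intro exI[of _ "max 0 (s0 + 1)"] conjI allI impI)
    fix s assume s: "Re s > max 0 (s0 + 1)"
    show "(\<lambda>n. b n * of_nat n powr (- s)) sums g s"
      using s by (intro \<theta>0) (auto simp: s0_def)
    show "summable (\<lambda>n. norm (b n * of_nat n powr (- s)))"
    proof (rule summable_comparison_test')
      show "summable (\<lambda>n. K * real n powr (- (Re s - s0)))"
        using s by (intro summable_mult) (simp add: summable_real_powr_iff)
      fix n :: nat
      have "of_nat n powr (- s) = of_nat n powr (- of_real s0) * of_nat n powr (- (s - of_real s0))"
        by (simp flip: powr_add)
      then have "norm (norm (b n * of_nat n powr (- s)))
          = norm (b n * of_nat n powr (- of_real s0)) * norm (of_nat n powr (- (s - of_real s0)))"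
        by (simp add: norm_mult)
      also have "\<dots> \<le> K * real n powr (- (Re s - s0))"
        using K[of n] K[of 0] norm_nat_powr_le[of n "- (s - of_real s0)"]
        by (intro mult_mono order_trans[OF norm_ge_zero K]) auto
      finally show "norm (norm (b n * of_nat n powr (- s))) \<le> K * real n powr (- (Re s - s0))" .
    qed
  qed auto
qed

text \<open>
  As \<open>Re s \<rightarrow> \<infinity>\<close> the first nonzero term of a Dirichlet series dominates all later ones, so a series
  with sum 0 cannot have a first nonzero term. Uniqueness is what makes boundary values independent of
  the chosen representing series.
\<close>

lemma dirichlet_coefficients_unique:
  assumes "represented_by g b" "represented_by g b'" "n \<ge> 1"
  shows "b n = b' n"
proof -
  obtain \<theta>1 where "\<forall>s. Re s > \<theta>1 \<longrightarrow> summable (\<lambda>n. norm (b n * of_nat n powr (- s))) \<and>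
    (\<lambda>n. b n * of_nat n powr (- s)) sums g s"
    using represented_by_absolutely[OF assms(1)] by blast
  then have 1: "\<And>s. Re s > \<theta>1 \<Longrightarrow> summable (\<lambda>n. norm (b n * of_nat n powr (- s)))"
    "\<And>s. Re s > \<theta>1 \<Longrightarrow> (\<lambda>n. b n * of_nat n powr (- s)) sums g s"
    by auto
  obtain \<theta>2 where "\<forall>s. Re s > \<theta>2 \<longrightarrow> summable (\<lambda>n. norm (b' n * of_nat n powr (- s))) \<and>
    (\<lambda>n. b' n * of_nat n powr (- s)) sums g s"
    using represented_by_absolutely[OF assms(2)] by blast
  then have 2: "\<And>s. Re s > \<theta>2 \<Longrightarrow> summable (\<lambda>n. norm (b' n * of_nat n powr (- s)))"
    "\<And>s. Re s > \<theta>2 \<Longrightarrow> (\<lambda>n. b' n * of_nat n powr (- s)) sums g s"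
    by auto
  define \<sigma> where "\<sigma> = max \<theta>1 \<theta>2 + 1"
  define d where "d n = b n - b' n" for n
  have d0: "(\<lambda>n. d n * of_nat n powr (- s)) sums 0" if "Re s \<ge> \<sigma>" for s
    using sums_diff[OF 1(2) 2(2), of s s] that by (simp add: \<sigma>_def d_def algebra_simps)
  have dn: "summable (\<lambda>n. norm (d n * of_nat n powr (- s)))" if "Re s \<ge> \<sigma>" for s
  proof (rule summable_comparison_test')
    show "summable (\<lambda>n. norm (b n * of_nat n powr (- s)) + norm (b' n * of_nat n powr (- s)))"
      using that by (intro summable_add 1 2) (auto simp: \<sigma>_def)
    show "norm (norm (d n * of_nat n powr (- s)))
      \<le> norm (b n * of_nat n powr (- s)) + norm (b' n * of_nat n powr (- s))" for n
      unfolding d_def left_diff_distrib by (simp add: norm_triangle_ineq4)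
  qed
  have "d n = 0" using \<open>n \<ge> 1\<close>
  proof (induction n rule: less_induct)
    case (less n)
    define S where "S = (\<Sum>m. norm (d m * of_nat m powr (- of_real \<sigma>)))"
    \<comment> \<open>Evaluate the zero sum at \<open>\<sigma> + k\<close>; every later term is smaller than at \<open>\<sigma>\<close> by at least \<open>(n + 1) powr (- k)\<close>.\<close>
    have le: "norm (d n) \<le> S * real n powr \<sigma> * (real n / (real n + 1)) ^ k" for k :: nat
    proof -
      define x where "x m = d m * of_nat m powr (- of_real (\<sigma> + real k))" for m
      define y where "y m = norm (d m * of_nat m powr (- of_real \<sigma>))" for m
      have sx: "x sums 0" and nx: "summable (\<lambda>m. norm (x m))" and ny: "summable y"
        using d0[of "of_real (\<sigma> + real k)"] dn[of "of_real (\<sigma> + real k)"] dn[of "of_real \<sigma>"]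
        unfolding x_def y_def by auto
      have nx': "summable (\<lambda>m. norm (x (m + Suc n)))" and ny': "summable (\<lambda>m. y (m + Suc n))"
        by (rule summable_ignore_initial_segment[OF nx], rule summable_ignore_initial_segment[OF ny])
      have "x m = 0" if "m < n" for m
        using less that by (cases "m = 0") (auto simp: x_def)
      then have "(\<Sum>m<Suc n. x m) = x n"
        by simp
      moreover have "(\<Sum>m. x (m + Suc n)) = 0 - (\<Sum>m<Suc n. x m)"
        using sums_split_initial_segment[OF sx, of "Suc n"] sums_unique by fastforce
      ultimately have "norm (x n) = norm (\<Sum>m. x (m + Suc n))"
        by simp
      also have "\<dots> \<le> (\<Sum>m. norm (x (m + Suc n)))"
        using nx by (intro summable_norm summable_ignore_initial_segment[where f="\<lambda>m. norm (x m)"])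
      also have "\<dots> \<le> (\<Sum>m. y (m + Suc n) * (1 / (real n + 1)) ^ k)"
      proof (rule suminf_le)
        fix m
        have "x (m + Suc n) = d (m + Suc n) * of_nat (m + Suc n) powr (- of_real \<sigma>) * of_nat (m + Suc n) powr (- of_real (real k))"
          unfolding x_def mult.assoc powr_add[symmetric] by simp
        then have "norm (x (m + Suc n)) = y (m + Suc n) * real (m + Suc n) powr (- real k)"
          using norm_nat_powr[of "m + Suc n" "- of_real (real k)"]
          by (simp only: y_def norm_mult) simp
        also have "\<dots> = y (m + Suc n) * (1 / real (m + Suc n)) ^ k"
          by (simp add: powr_minus powr_realpow power_divide field_simps)
        also have "\<dots> \<le> y (m + Suc n) * (1 / (real n + 1)) ^ k"
          by (intro mult_left_mono power_mono divide_left_mono) (auto simp: y_def)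
        finally show "norm (x (m + Suc n)) \<le> y (m + Suc n) * (1 / (real n + 1)) ^ k" .
      qed (use nx' summable_mult2[OF ny'] in simp_all)
      also have "\<dots> = (\<Sum>m. y (m + Suc n)) * (1 / (real n + 1)) ^ k"
        by (intro suminf_mult2[symmetric] summable_ignore_initial_segment ny)
      also have "\<dots> \<le> S * (1 / (real n + 1)) ^ k"
      proof (intro mult_right_mono)
        have "0 \<le> (\<Sum>m<Suc n. y m)" by (intro sum_nonneg) (auto simp: y_def)
        then show "(\<Sum>m. y (m + Suc n)) \<le> S"
          using suminf_split_initial_segment[OF ny, of "Suc n"] unfolding S_def y_def by simp
      qed auto
      finally have *: "norm (x n) \<le> S * (1 / (real n + 1)) ^ k" .
      have "norm (x n) = norm (d n) * real n powr (- (\<sigma> + real k))"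
        using less.prems by (simp add: x_def norm_mult norm_nat_powr)
      moreover have "real n powr (- (\<sigma> + real k)) * (real n powr \<sigma> * real n ^ k) = 1"
        using less.prems by (simp flip: powr_add powr_realpow)
      ultimately have "norm (d n) = norm (x n) * (real n powr \<sigma> * real n ^ k)"
        by (simp add: mult.assoc)
      also have "\<dots> \<le> S * (1 / (real n + 1)) ^ k * (real n powr \<sigma> * real n ^ k)"
        by (intro mult_right_mono *) auto
      also have "\<dots> = S * real n powr \<sigma> * (real n / (real n + 1)) ^ k"
        by (simp add: power_divide)
      finally show ?thesis .
    qed
    have "(\<lambda>k. S * real n powr \<sigma> * (real n / (real n + 1)) ^ k) \<longlonglongrightarrow> S * real n powr \<sigma> * 0"
      by (intro tendsto_intros LIMSEQ_power_zero) auto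
    then have "norm (d n) \<le> S * real n powr \<sigma> * 0"
      by (rule LIMSEQ_le_const) (use le in auto)
    then show ?case by simp
  qed
  then show ?thesis by (simp add: d_def)
qed

section \<open>Bohr's theorem for bounded Dirichlet series\<close>

lemma half_plane_nonempty [simp]: "half_plane \<theta> \<noteq> {}"
proof -
  have "complex_of_real (\<theta> + 1) \<in> half_plane \<theta>" by (simp add: half_plane_def)
  then show ?thesis by blast
qed

lemma continuous_on_vertical_line:
  assumes "g holomorphic_on half_plane 0" "Re s > 0"
  shows "continuous_on S (\<lambda>t. g (s + \<i> * of_real t))"
  by (rule continuous_on_compose2[OF holomorphic_on_imp_continuous_on[OF assms(1)]])
     (use assms(2) in \<open>auto intro!: continuous_intros simp: half_plane_def\<close>)

text \<open>
  Over a compact range of \<open>t\<close> the integral is holomorphic by differentiation under the integral sign. As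
  \<open>g\<close> is bounded, the tails are at most \<open>M\<close> times the tail of \<open>\<integral> \<bar>k\<bar>\<close>, uniformly in \<open>s\<close>.
\<close>

lemma holomorphic_vertical_convolution:
  assumes g: "g holomorphic_on half_plane 0" and M: "\<And>s. s \<in> half_plane 0 \<Longrightarrow> norm (g s) \<le> M"
    and k: "continuous_on UNIV k" "integrable lborel (k :: real \<Rightarrow> real)"
  shows "(\<lambda>s. \<integral>t. of_real (k t) * g (s + \<i> * of_real t) \<partial>lborel) holomorphic_on half_plane 0"
proof -
  define H where "H n s = integral (cbox (- real n) (real n)) (\<lambda>t. of_real (k t) * g (s + \<i> * of_real t))" for n s
  \<comment> \<open>The mass of \<open>\<bar>k\<bar>\<close> outside \<open>[-n, n]\<close>.\<close>
  define R where "R n = (\<integral>t. \<bar>k t\<bar> \<partial>lborel) - (\<integral>t. indicator {- real n..real n} t * \<bar>k t\<bar> \<partial>lborel)" for n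
  let ?H = "\<lambda>s. \<integral>t. of_real (k t) * g (s + \<i> * of_real t) \<partial>lborel"
  have M0: "M \<ge> 0" by (rule order_trans[OF norm_ge_zero M[of 1]]) (simp add: half_plane_def)
  have cont: "continuous_on S (\<lambda>t. of_real (k t) * g (s + \<i> * of_real t))" if "s \<in> half_plane 0" for s S
    using that g by (intro continuous_intros continuous_on_vertical_line continuous_on_subset[OF k(1)])
      (auto simp: half_plane_def)
  have holo: "H n holomorphic_on half_plane 0" for n
    unfolding H_def
  proof (rule leibniz_rule_holomorphic)
    fix s :: complex and t :: real assume s: "s \<in> half_plane 0"
    have "(g has_field_derivative deriv g (s + \<i> * of_real t)) (at (s + \<i> * of_real t))"
      using s by (intro holomorphic_derivI[OF g open_half_plane]) (auto simp: half_plane_def)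
    then have "((\<lambda>s. g (s + \<i> * of_real t)) has_field_derivative deriv g (s + \<i> * of_real t) * 1) (at s within half_plane 0)"
      by (rule DERIV_chain2) (auto intro!: derivative_eq_intros)
    then show "((\<lambda>s. of_real (k t) * g (s + \<i> * of_real t)) has_field_derivative
      of_real (k t) * deriv g (s + \<i> * of_real t)) (at s within half_plane 0)"
      by (auto intro!: derivative_eq_intros)
  next
    fix s assume "s \<in> half_plane 0"
    then show "(\<lambda>t. of_real (k t) * g (s + \<i> * of_real t)) integrable_on cbox (- real n) (real n)"
      by (intro integrable_continuous cont)
  next
    have dg: "continuous_on (half_plane 0) (deriv g)"
      by (intro holomorphic_on_imp_continuous_on holomorphic_deriv g open_half_plane)
    have "continuous_on (half_plane 0 \<times> cbox (- real n) (real n)) (\<lambda>x. k (snd x))"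
      by (rule continuous_on_compose2[OF k(1)]) (auto intro: continuous_on_snd)
    moreover have "continuous_on (half_plane 0 \<times> cbox (- real n) (real n))
        (\<lambda>x. deriv g (fst x + \<i> * of_real (snd x)))"
      by (rule continuous_on_compose2[OF dg])
         (auto intro!: continuous_on_add continuous_on_mult continuous_on_const continuous_on_fst continuous_on_snd
           continuous_on_of_real continuous_on_id simp: half_plane_def)
    ultimately show "continuous_on (half_plane 0 \<times> cbox (- real n) (real n))
        (\<lambda>(s, t). of_real (k t) * deriv g (s + \<i> * of_real t))"
      unfolding case_prod_beta by (intro continuous_on_mult continuous_on_of_real)
  qed auto
  have int: "integrable lborel (\<lambda>t. of_real (k t) * g (s + \<i> * of_real t))" if "s \<in> half_plane 0" for s
  proof (rule Bochner_Integration.integrable_bound[of _ "\<lambda>t. M * k t"])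
    show "integrable lborel (\<lambda>t. M * k t)" using k by simp
    show "(\<lambda>t. of_real (k t) * g (s + \<i> * of_real t)) \<in> borel_measurable lborel"
      using cont[OF that, of UNIV] by (simp add: borel_measurable_continuous_onI)
    show "AE t in lborel. norm (of_real (k t) * g (s + \<i> * of_real t)) \<le> norm (M * k t)"
    proof (rule AE_I2)
      fix t :: real
      have "norm (g (s + \<i> * of_real t)) \<le> M" using that by (intro M) (auto simp: half_plane_def)
      then have "\<bar>k t\<bar> * norm (g (s + \<i> * of_real t)) \<le> \<bar>k t\<bar> * M" by (intro mult_left_mono) auto
      then show "norm (of_real (k t) * g (s + \<i> * of_real t)) \<le> norm (M * k t)"
        using M0 by (simp add: norm_mult abs_mult mult.commute)
    qed
  qed
  have R: "R \<longlonglongrightarrow> 0"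
  proof -
    have "(\<lambda>n. \<integral>t. indicator {- real n..real n} t * \<bar>k t\<bar> \<partial>lborel) \<longlonglongrightarrow> (\<integral>t. \<bar>k t\<bar> \<partial>lborel)"
    proof (rule integral_dominated_convergence[where w="\<lambda>t. \<bar>k t\<bar>"])
      show "AE t in lborel. (\<lambda>n. indicator {- real n..real n} t * \<bar>k t\<bar>) \<longlonglongrightarrow> \<bar>k t\<bar>"
      proof (rule AE_I2, rule tendsto_eventually)
        fix t :: real
        show "\<forall>\<^sub>F n in sequentially. indicator {- real n..real n} t * \<bar>k t\<bar> = \<bar>k t\<bar>"
          using eventually_ge_at_top[of "nat \<lceil>\<bar>t\<bar>\<rceil>"]
        proof eventually_elim
          case (elim n)
          then have "t \<in> {- real n..real n}" using of_nat_ceiling[of "\<bar>t\<bar>"] by (auto simp: nat_le_iff)  linarith+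
          then show ?case by simp
        qed
      qed
      show "AE t in lborel. norm (indicator {- real n..real n} t * \<bar>k t\<bar>) \<le> \<bar>k t\<bar>" for n
        by (auto simp: indicator_def)
    qed (use k in auto)
    then have "(\<lambda>n. (\<integral>t. \<bar>k t\<bar> \<partial>lborel) - (\<integral>t. indicator {- real n..real n} t * \<bar>k t\<bar> \<partial>lborel)) \<longlonglongrightarrow> (\<integral>t. \<bar>k t\<bar> \<partial>lborel) - (\<integral>t. \<bar>k t\<bar> \<partial>lborel)"
      by (intro tendsto_intros)
    then show ?thesis unfolding R_def by simp
  qed
  have est: "norm (?H s - H n s) \<le> M * R n" if s: "s \<in> half_plane 0" for n s
  proof -
    have si: "set_integrable lborel {- real n..real n} (\<lambda>t. of_real (k t) * g (s + \<i> * of_real t))"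
      unfolding set_integrable_def using int[OF s] by (intro integrable_mult_indicator) auto
    have "H n s = (LINT t:{- real n..real n}|lborel. of_real (k t) * g (s + \<i> * of_real t))"
      unfolding H_def using set_borel_integral_eq_integral(2)[OF si] by simp
    then have "?H s - H n s = (\<integral>t. (of_real (k t) * g (s + \<i> * of_real t)) -
        indicator {- real n..real n} t *\<^sub>R (of_real (k t) * g (s + \<i> * of_real t)) \<partial>lborel)"
      using int[OF s] si unfolding set_lebesgue_integral_def set_integrable_def by simp
    also have "norm \<dots> \<le> (\<integral>t. M * (\<bar>k t\<bar> - indicator {- real n..real n} t * \<bar>k t\<bar>) \<partial>lborel)"
    proof (rule Bochner_Integration.integral_norm_bound_integral)
      have "integrable lborel (\<lambda>t. indicator {- real n..real n} t * \<bar>k t\<bar>)"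
        using integrable_mult_indicator[of "{- real n..real n}" lborel "\<lambda>t. \<bar>k t\<bar>"] k by simp
      then show "integrable lborel (\<lambda>t. M * (\<bar>k t\<bar> - indicator {- real n..real n} t * \<bar>k t\<bar>))"
        using k by (intro integrable_mult_right Bochner_Integration.integrable_diff) auto
      fix t :: real
      have "norm (g (s + \<i> * of_real t)) \<le> M" using s by (intro M) (auto simp: half_plane_def)
      then have "\<bar>k t\<bar> * norm (g (s + \<i> * of_real t)) \<le> \<bar>k t\<bar> * M" by (intro mult_left_mono) auto
      then show "norm ((of_real (k t) * g (s + \<i> * of_real t)) -
        indicator {- real n..real n} t *\<^sub>R (of_real (k t) * g (s + \<i> * of_real t)))
        \<le> M * (\<bar>k t\<bar> - indicator {- real n..real n} t * \<bar>k t\<bar>)"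
        by (auto simp: indicator_def norm_mult mult.commute)
    qed (use int[OF s] si in \<open>auto simp: set_integrable_def\<close>)
    also have "\<dots> = M * R n"
      unfolding R_def using k integrable_mult_indicator[of "{- real n..real n}" lborel "\<lambda>t. \<bar>k t\<bar>"] by simp
    finally show ?thesis .
  qed
  have unif: "uniform_limit (half_plane 0) H ?H sequentially"
  proof (rule uniform_limitI)
    fix e :: real assume "e > 0"
    have "(\<lambda>n. M * R n) \<longlonglongrightarrow> M * 0" by (intro tendsto_intros R)
    then have "\<forall>\<^sub>F n in sequentially. M * R n < e" using \<open>e > 0\<close> by (intro order_tendstoD) auto
    then show "\<forall>\<^sub>F n in sequentially. \<forall>s\<in>half_plane 0. dist (H n s) (?H s) < e"
    proof eventually_elim
      case (elim n)
      have "dist (H n s) (?H s) < e" if "s \<in> half_plane 0" for s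
      proof -
        have "dist (H n s) (?H s) = norm (?H s - H n s)" by (simp add: dist_norm norm_minus_commute)
        also have "\<dots> \<le> M * R n" by (rule est[OF that])
        also have "\<dots> < e" by (rule elim)
        finally show ?thesis .
      qed
      then show ?case by blast
    qed
  qed
  show ?thesis
  proof (rule holomorphic_uniform_sequence[OF open_half_plane holo])
    fix s assume "s \<in> half_plane 0"
    then obtain d where "d > 0" "cball s d \<subseteq> half_plane 0"
      using open_contains_cball[of "half_plane 0"] by auto
    then show "\<exists>d>0. cball s d \<subseteq> half_plane 0 \<and> uniform_limit (cball s d) H ?H sequentially"
      using uniform_limit_on_subset[OF unif] by blast
  qed
qed

text \<open>
  Translating by \<open>t\<close> multiplies the \<open>n\<close>-th term by \<open>exp (- \<i> * ln n * t)\<close>, so termwise integration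
  multiplies it by the trapezoid at \<open>ln n\<close>. This is 1 for \<open>n \<le> N\<close> and 0 for \<open>n \<ge> N + 1\<close>.
\<close>

lemma dirichlet_partial_eq_convolution_abs:
  assumes N: "N \<ge> 1" and s: "summable (\<lambda>n. norm (b n * of_nat n powr (- s)))"
    and g: "\<And>t. (\<lambda>n. b n * of_nat n powr (- (s + \<i> * of_real t))) sums g (s + \<i> * of_real t)"
  shows "dirichlet_partial b N s =
    (\<integral>t. of_real (trapezoid_kernel (ln (real N)) (ln (real N + 1)) t) * g (s + \<i> * of_real t) \<partial>lborel)"
proof -
  define L where "L = ln (real N)"
  define L' where "L' = ln (real N + 1)"
  have L: "0 \<le> L" "L < L'" using N by (auto simp: L_def L'_def)
  let ?k = "trapezoid_kernel L L'"
  have kint: "integrable lborel ?k" using trapezoid_kernel_L1(1)[OF L, of 1] by simp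
  define c where "c n = b n * of_nat n powr (- s)" for n
  define f where "f n t = c n * (of_real (?k t) * exp (- \<i> * of_real (ln (real n) * t)))" for n t
  have pw: "of_nat n powr (- (s + \<i> * of_real t)) = of_nat n powr (- s) * exp (- \<i> * of_real (ln (real n) * t))" for n t
  proof (cases "n = 0")
    case False
    have "of_nat n powr (- (s + \<i> * of_real t)) = of_nat n powr (- s) * (of_nat n powr (- \<i> * of_real t))"
      by (simp flip: powr_add)
    also have "of_nat n powr (- \<i> * of_real t) = exp (- \<i> * of_real (ln (real n) * t))"
      using False by (simp add: powr_def Ln_of_nat mult_ac)
    finally show ?thesis .
  qed auto
  have bI: "has_bochner_integral lborel (f n) (if n \<le> N then c n else 0)" for n
  proof (cases "n = 0")
    case True
    then have "f n = (\<lambda>_. 0)" "c n = 0" by (auto simp: f_def c_def fun_eq_iff)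
    then show ?thesis by (simp add: has_bochner_integral_zero)
  next
    case False
    have "ln (real n) \<le> L \<longleftrightarrow> n \<le> N" "L' \<le> ln (real n) \<longleftrightarrow> N + 1 \<le> n"
      using False N unfolding L_def L'_def by auto
    moreover have "has_bochner_integral lborel (f n) (c n * (if ln (real n) \<le> L then 1 else 0))"
      unfolding f_def using False calculation
      by (intro has_bochner_integral_mult_right trapezoid_kernel_Fourier L) auto
    ultimately show ?thesis by auto
  qed
  have nf: "norm (f n t) = norm (c n) * \<bar>?k t\<bar>" for n t
    unfolding f_def by (simp add: norm_mult norm_exp_imaginary[of "- (ln (real n) * t)", simplified])
  have sc: "summable (\<lambda>n. norm (c n))" using s by (simp add: c_def)
  have "(\<lambda>n. \<integral>t. f n t \<partial>lborel) sums (\<integral>t. (\<Sum>n. f n t) \<partial>lborel)"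
  proof (rule sums_integral)
    show "integrable lborel (f n)" for n using bI[of n] by (simp add: has_bochner_integral_iff)
    show "AE t in lborel. summable (\<lambda>n. norm (f n t))"
      unfolding nf by (intro AE_I2 summable_mult2 sc)
    show "summable (\<lambda>n. \<integral>t. norm (f n t) \<partial>lborel)"
      unfolding nf using kint by (auto intro: summable_mult2 sc)
  qed
  moreover have "(\<Sum>n. f n t) = of_real (?k t) * g (s + \<i> * of_real t)" for t
    using sums_mult[OF g[of t], of "of_real (?k t)"]
    unfolding f_def c_def pw by (intro sums_unique[symmetric]) (simp add: mult_ac)
  moreover have "(\<integral>t. f n t \<partial>lborel) = (if n \<le> N then c n else 0)" for n
    using bI[of n] by (simp add: has_bochner_integral_iff)
  ultimately have "(\<lambda>n. if n \<le> N then c n else 0) sums (\<integral>t. of_real (?k t) * g (s + \<i> * of_real t) \<partial>lborel)"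
    by simp
  moreover have "(\<lambda>n. if n \<in> {..<Suc N} then c n else 0) sums (\<Sum>n<Suc N. c n)"
    by (rule sums_If_finite_set) auto
  then have "(\<lambda>n. if n \<le> N then c n else 0) sums dirichlet_partial b N s"
    by (simp only: lessThan_Suc_atMost atMost_iff dirichlet_partial_eq_sum c_def)
  ultimately show ?thesis
    unfolding L_def L'_def by (rule sums_unique2[symmetric])
qed

text \<open>
  Both sides are holomorphic on \<open>half_plane 0\<close> and agree far to the right. The gain is that the
  right-hand side involves only the values of the bounded function \<open>g\<close>.
\<close>

lemma dirichlet_partial_eq_convolution:
  assumes g: "g holomorphic_on half_plane 0" and M: "\<And>s. s \<in> half_plane 0 \<Longrightarrow> norm (g s) \<le> M"
    and b: "represented_by g b" and N: "N \<ge> 1" and s: "s \<in> half_plane 0"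
  shows "dirichlet_partial b N s =
    (\<integral>t. of_real (trapezoid_kernel (ln (real N)) (ln (real N + 1)) t) * g (s + \<i> * of_real t) \<partial>lborel)"
proof -
  let ?k = "trapezoid_kernel (ln (real N)) (ln (real N + 1))"
  let ?H = "\<lambda>s. \<integral>t. of_real (?k t) * g (s + \<i> * of_real t) \<partial>lborel"
  from represented_by_absolutely[OF b] obtain \<theta> where *: "\<theta> \<ge> 0 \<and>
    (\<forall>s. Re s > \<theta> \<longrightarrow> summable (\<lambda>n. norm (b n * of_nat n powr (- s))) \<and>
      (\<lambda>n. b n * of_nat n powr (- s)) sums g s)" by (rule exE)
  then have \<theta>0: "\<theta> \<ge> 0" by (rule conjunct1)
  from * have \<theta>: "\<And>s. Re s > \<theta> \<Longrightarrow> summable (\<lambda>n. norm (b n * of_nat n powr (- s)))"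
    "\<And>s. Re s > \<theta> \<Longrightarrow> (\<lambda>n. b n * of_nat n powr (- s)) sums g s"
    by auto
  have eq: "dirichlet_partial b N s = ?H s" if "s \<in> half_plane \<theta>" for s
    using that by (intro dirichlet_partial_eq_convolution_abs N \<theta>) (auto simp: half_plane_def)
  show ?thesis
  proof (rule analytic_continuation_open[of "half_plane \<theta>" "half_plane 0" _ _ s, OF _ _ _ _ _ _ _ eq s])
    show "half_plane \<theta> \<noteq> {}"
      by simp
    show "half_plane \<theta> \<subseteq> half_plane 0" using \<theta>0 by (auto simp: half_plane_def)
    show "?H holomorphic_on half_plane 0"
      using N trapezoid_kernel_L1(1)[of "ln (real N)" "ln (real N + 1)" 1]
      by (intro holomorphic_vertical_convolution[OF g M] continuous_intros) auto
  qed (auto intro: holomorphic_intros convex_connected)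
qed

text \<open>
  Here \<open>ln (N + 1) - ln N \<ge> 1 / (N + 1)\<close>, so the narrow sinc factor costs at most
  \<open>(2 * (N + 1)) powr \<eta>\<close>; the logarithms are absorbed by the same power.
\<close>

lemma trapezoid_L1_growth:
  fixes \<eta> :: real
  assumes "0 < \<eta>" "\<eta> \<le> 1" "N \<ge> 1"
  shows "ln (real N) + ln (real N + 1) + ((ln (real N + 1) - ln (real N)) / 2) powr (-\<eta>) / \<eta>
    \<le> 4 / \<eta> * (real N + 1) powr \<eta>"
proof -
  have 1: "ln (real N + 1) \<le> (real N + 1) powr \<eta> / \<eta>"
    using assms by (intro ln_powr_bound) auto
  have 2: "ln (real N) \<le> ln (real N + 1)" using assms by simp
  have "ln (real N / (real N + 1)) \<le> real N / (real N + 1) - 1"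
    using assms by (intro ln_le_minus_one) auto
  also have "\<dots> = - (1 / (real N + 1))" by (simp add: field_simps)
  finally have "1 / (real N + 1) \<le> ln (real N + 1) - ln (real N)"
    using assms by (simp add: ln_div)
  then have "((ln (real N + 1) - ln (real N)) / 2) powr (-\<eta>) \<le> (1 / (2 * (real N + 1))) powr (-\<eta>)"
    using assms by (intro powr_mono2') (auto simp: field_simps)
  also have "\<dots> = (2 * (real N + 1)) powr \<eta>"
    by (simp add: powr_minus powr_divide)
  also have "\<dots> = 2 powr \<eta> * (real N + 1) powr \<eta>" by (subst powr_mult) auto
  also have "\<dots> \<le> 2 powr 1 * (real N + 1) powr \<eta>"
    using assms by (intro mult_right_mono powr_mono) auto
  finally have "((ln (real N + 1) - ln (real N)) / 2) powr (-\<eta>) / \<eta> \<le> 2 * (real N + 1) powr \<eta> / \<eta>"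
    using assms by (intro divide_right_mono) auto
  then show ?thesis using 1 2 by simp
qed

lemma dirichlet_partial_growth:
  assumes g: "g holomorphic_on half_plane 0" and M: "\<And>s. s \<in> half_plane 0 \<Longrightarrow> norm (g s) \<le> M"
    and b: "represented_by g b" and \<eta>: "0 < \<eta>" "\<eta> \<le> 1" and s: "s \<in> half_plane 0"
  shows "norm (dirichlet_partial b N s) \<le> M * (4 / \<eta>) * (real N + 1) powr \<eta>"
proof (cases "N \<ge> 1")
  case False
  have "M \<ge> 0" by (rule order_trans[OF norm_ge_zero M[OF s]])
  then show ?thesis using False \<eta> by (simp add: dirichlet_partial_def)
next
  case N: True
  let ?k = "trapezoid_kernel (ln (real N)) (ln (real N + 1))"
  have M0: "M \<ge> 0" by (rule order_trans[OF norm_ge_zero M[OF s]])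
  have kint: "integrable lborel ?k"
    and kle: "(\<integral>t. \<bar>?k t\<bar> \<partial>lborel) \<le> ln (real N) + ln (real N + 1) + ((ln (real N + 1) - ln (real N)) / 2) powr (-\<eta>) / \<eta>"
    using N by (auto intro!: trapezoid_kernel_L1 \<eta>)
  have eq: "dirichlet_partial b N s = (\<integral>t. of_real (?k t) * g (s + \<i> * of_real t) \<partial>lborel)"
    by (rule dirichlet_partial_eq_convolution[OF g M b N s])
  have "norm (dirichlet_partial b N s) \<le> (\<integral>t. M * \<bar>?k t\<bar> \<partial>lborel)"
    unfolding eq
  proof (rule Bochner_Integration.integral_norm_bound_integral)
    show "integrable lborel (\<lambda>t. M * \<bar>?k t\<bar>)" using kint by simp
    have le: "norm (of_real (?k t) * g (s + \<i> * of_real t)) \<le> M * \<bar>?k t\<bar>" for t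
    proof -
      have "norm (g (s + \<i> * of_real t)) \<le> M" using s by (intro M) (auto simp: half_plane_def)
      then have "\<bar>?k t\<bar> * norm (g (s + \<i> * of_real t)) \<le> \<bar>?k t\<bar> * M" by (intro mult_left_mono) auto
      then show ?thesis by (simp add: norm_mult mult.commute)
    qed
    then show "norm (of_real (?k t) * g (s + \<i> * of_real t)) \<le> M * \<bar>?k t\<bar>" for t .
    have "continuous_on UNIV (\<lambda>t. of_real (?k t) * g (s + \<i> * of_real t))"
      using s by (intro continuous_intros continuous_on_vertical_line[OF g]) (auto simp: half_plane_def)
    then have "(\<lambda>t. of_real (?k t) * g (s + \<i> * of_real t)) \<in> borel_measurable lborel"
      by (simp add: borel_measurable_continuous_onI)
    then show "integrable lborel (\<lambda>t. of_real (?k t) * g (s + \<i> * of_real t))"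
      by (rule Bochner_Integration.integrable_bound[of _ "\<lambda>t. M * \<bar>?k t\<bar>", rotated])
         (use kint le in \<open>auto intro!: AE_I2 order_trans[OF le abs_ge_self]\<close>)
  qed
  also have "\<dots> = M * (\<integral>t. \<bar>?k t\<bar> \<partial>lborel)" using kint by simp
  also have "\<dots> \<le> M * (4 / \<eta> * (real N + 1) powr \<eta>)"
    using trapezoid_L1_growth[OF \<eta> N] kle M0 by (intro mult_left_mono) auto
  finally show ?thesis by simp
qed

lemma nat_powr_neg_diff_le:
  fixes \<theta> :: real
  assumes "\<theta> > 0" "n \<ge> 1"
  shows "real n powr (-\<theta>) - (real n + 1) powr (-\<theta>) \<le> \<theta> * real n powr (-\<theta> - 1)"
proof -
  have "\<exists>z. real n < z \<and> z < real n + 1 \<and>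
     (real n + 1) powr (-\<theta>) - real n powr (-\<theta>) = (real n + 1 - real n) * (- \<theta> * z powr (-\<theta> - 1))"
    by (rule MVT2) (use assms in \<open>auto intro!: derivative_eq_intros\<close>)
  then obtain z where z: "real n < z"
     "(real n + 1) powr (-\<theta>) - real n powr (-\<theta>) = - \<theta> * z powr (-\<theta> - 1)" by auto
  have "z powr (-\<theta> - 1) \<le> real n powr (-\<theta> - 1)"
    using z assms by (intro powr_mono2') auto
  then have "\<theta> * z powr (-\<theta> - 1) \<le> \<theta> * real n powr (-\<theta> - 1)"
    using assms by (intro mult_left_mono) auto
  then show ?thesis using z by simp
qed

text \<open>
  Summation by parts: the factor \<open>n powr (- \<theta>)\<close> gained by moving \<open>\<theta>\<close> to the right is differenced, the
  coefficients are summed.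
\<close>

lemma dirichlet_partial_shift:
  "dirichlet_partial b N (s + of_real \<theta>) =
     dirichlet_partial b N s * of_real ((real N + 1) powr (-\<theta>)) +
     (\<Sum>n=1..N. dirichlet_partial b n s * of_real (real n powr (-\<theta>) - (real n + 1) powr (-\<theta>)))"
proof (induction N)
  case 0
  then show ?case by (simp add: dirichlet_partial_def)
next
  case (Suc N)
  have P: "dirichlet_partial b (Suc N) z = dirichlet_partial b N z + b (Suc N) * of_nat (Suc N) powr (- z)" for z
    by (simp add: dirichlet_partial_def)
  have e: "of_nat (Suc N) powr (- (s + of_real \<theta>)) = of_nat (Suc N) powr (- s) * of_real ((real N + 1) powr (-\<theta>))"
  proof -
    have "of_nat (Suc N) powr (- (s + of_real \<theta>)) = of_nat (Suc N) powr (- s) * of_nat (Suc N) powr (- of_real \<theta>)"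
      by (simp flip: powr_add)
    also have "of_nat (Suc N) powr (- of_real \<theta> :: complex) = of_real (real (Suc N) powr (-\<theta>))"
      using powr_of_real[of "real (Suc N)" "-\<theta>"] by simp
    finally show ?thesis by (simp add: add.commute)
  qed
  show ?case
    unfolding P[of "s + of_real \<theta>"] Suc.IH e by (simp add: P algebra_simps)
qed

text \<open>
  Bohr's theorem. On \<open>half_plane \<theta>\<close> the partial sums are obtained from those on \<open>half_plane 0\<close> by a
  shift of \<open>\<theta>\<close>. After summation by parts the growth \<open>O(n powr \<eta>)\<close> with \<open>\<eta> \<le> \<theta> / 2\<close> meets
  differences of size \<open>n powr (- \<theta> - 1)\<close>, and Weierstrass' test applies. The limit is \<open>g\<close> by the
  identity theorem.
\<close>

theorem Bohr_uniform_convergence: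
  assumes g: "g holomorphic_on half_plane 0" and M: "\<And>s. s \<in> half_plane 0 \<Longrightarrow> norm (g s) \<le> M"
    and b: "represented_by g b" and "\<theta> > 0"
  shows "uniform_limit (half_plane \<theta>) (dirichlet_partial b) g sequentially"
proof -
  define \<eta> where "\<eta> = min 1 (\<theta> / 2)"
  have \<eta>: "0 < \<eta>" "\<eta> \<le> 1" "\<eta> \<le> \<theta> / 2" using \<open>\<theta> > 0\<close> by (auto simp: \<eta>_def)
  define C where "C = M * (4 / \<eta>)"
  have gr: "norm (dirichlet_partial b N s) \<le> C * (real N + 1) powr \<eta>" if "s \<in> half_plane 0" for N s
    unfolding C_def using dirichlet_partial_growth[OF g M b \<eta>(1,2) that] .
  have "M \<ge> 0" by (rule order_trans[OF norm_ge_zero M[of 1]]) (simp add: half_plane_def)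
  then have C0: "C \<ge> 0" using \<eta> by (simp add: C_def)
  \<comment> \<open>The summands and the boundary term of the summation by parts, in terms of the partial sums at \<open>s - \<theta>\<close>.\<close>
  define A where "A n s = (if n = 0 then 0 else dirichlet_partial b n (s - of_real \<theta>) *
      of_real (real n powr (-\<theta>) - (real n + 1) powr (-\<theta>)))" for n s
  define E where "E N s = dirichlet_partial b N (s - of_real \<theta>) * of_real ((real N + 1) powr (-\<theta>))" for N s
  have split: "dirichlet_partial b N s = E N s + (\<Sum>n<Suc N. A n s)" for N s
  proof -
    have "(\<Sum>n<Suc N. A n s) = (\<Sum>n=1..N. A n s)"
      by (rule sum.mono_neutral_right) (auto simp: A_def not_less_eq_eq)
    then show ?thesis
      using dirichlet_partial_shift[of b N "s - of_real \<theta>" \<theta>] by (simp add: E_def A_def)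
  qed
  have shift: "s - of_real \<theta> \<in> half_plane 0" if "s \<in> half_plane \<theta>" for s
    using that by (auto simp: half_plane_def)
  have E: "uniform_limit (half_plane \<theta>) E (\<lambda>_. 0) sequentially"
  proof (rule uniform_limitI)
    fix e :: real assume "e > 0"
    have "(\<lambda>N. C * (real N + 1) powr (\<eta> - \<theta>)) \<longlonglongrightarrow> 0"
    proof -
      have "\<eta> - \<theta> < 0" using \<eta> \<open>\<theta> > 0\<close> by simp
      then show ?thesis by real_asymp
    qed
    then have "\<forall>\<^sub>F N in sequentially. C * (real N + 1) powr (\<eta> - \<theta>) < e"
      using \<open>e > 0\<close> by (rule order_tendstoD)
    then show "\<forall>\<^sub>F N in sequentially. \<forall>s\<in>half_plane \<theta>. dist (E N s) 0 < e"
    proof eventually_elim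
      case (elim N)
      show ?case
      proof
        fix s assume "s \<in> half_plane \<theta>"
        have "norm (E N s) = norm (dirichlet_partial b N (s - of_real \<theta>)) * (real N + 1) powr (-\<theta>)"
          by (simp add: E_def norm_mult)
        also have "\<dots> \<le> C * (real N + 1) powr \<eta> * (real N + 1) powr (-\<theta>)"
          by (intro mult_right_mono gr shift \<open>s \<in> _\<close>) auto
        also have "\<dots> = C * (real N + 1) powr (\<eta> - \<theta>)" by (simp add: powr_diff powr_minus field_simps)
        finally show "dist (E N s) 0 < e" using elim by simp
      qed
    qed
  qed
  have "uniform_limit (half_plane \<theta>) (\<lambda>N s. \<Sum>n<N. A n s) (\<lambda>s. \<Sum>n. A n s) sequentially"
  proof (rule Weierstrass_m_test)
    show "summable (\<lambda>n. C * 2 * \<theta> * real n powr (\<eta> - \<theta> - 1))"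
      using \<eta> \<open>\<theta> > 0\<close> by (intro summable_mult) (simp add: summable_real_powr_iff)
    fix n s assume s: "s \<in> half_plane \<theta>"
    show "norm (A n s) \<le> C * 2 * \<theta> * real n powr (\<eta> - \<theta> - 1)"
    proof (cases "n = 0")
      case False
      have pos: "real n powr (-\<theta>) - (real n + 1) powr (-\<theta>) \<ge> 0"
        using False \<open>\<theta> > 0\<close> by (simp add: powr_mono2')
      have two: "(real n + 1) powr \<eta> \<le> 2 * real n powr \<eta>"
      proof -
        have "(real n + 1) powr \<eta> \<le> (2 * real n) powr \<eta>"
          using False \<eta> by (intro powr_mono2) auto
        also have "\<dots> = 2 powr \<eta> * real n powr \<eta>" by (simp add: powr_mult)
        also have "\<dots> \<le> 2 powr 1 * real n powr \<eta>"
          using \<eta> by (intro mult_right_mono powr_mono) auto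
        finally show ?thesis by simp
      qed
      have "norm (A n s) = norm (dirichlet_partial b n (s - of_real \<theta>)) * (real n powr (-\<theta>) - (real n + 1) powr (-\<theta>))"
        unfolding A_def using False pos by (simp add: norm_mult del: of_real_diff)
      also have "\<dots> \<le> (C * (real n + 1) powr \<eta>) * (\<theta> * real n powr (-\<theta> - 1))"
        using False \<open>\<theta> > 0\<close> C0 by (intro mult_mono gr shift s nat_powr_neg_diff_le pos) auto
      also have "\<dots> \<le> (C * (2 * real n powr \<eta>)) * (\<theta> * real n powr (-\<theta> - 1))"
        using C0 \<open>\<theta> > 0\<close> by (intro mult_right_mono mult_left_mono two) auto
      also have "\<dots> = C * 2 * \<theta> * (real n powr \<eta> * real n powr (-\<theta> - 1))" by simp
      also have "real n powr \<eta> * real n powr (-\<theta> - 1) = real n powr (\<eta> - \<theta> - 1)"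
        by (simp add: algebra_simps flip: powr_add)
      finally show ?thesis .
    qed (simp add: A_def)
  qed
  then have "uniform_limit (half_plane \<theta>) (\<lambda>N s. \<Sum>n<Suc N. A n s) (\<lambda>s. \<Sum>n. A n s) sequentially"
    using filterlim_compose[OF _ filterlim_Suc] by blast
  from uniform_limit_add[OF E this]
  have lim: "uniform_limit (half_plane \<theta>) (dirichlet_partial b) (\<lambda>s. \<Sum>n. A n s) sequentially"
    unfolding split[abs_def] by simp
  define h where "h = (\<lambda>s. \<Sum>n. A n s)"
  have hol: "h holomorphic_on half_plane \<theta>"
    unfolding h_def
  proof (rule holomorphic_uniform_sequence[OF open_half_plane holomorphic_on_dirichlet_partial])
    fix s assume "s \<in> half_plane \<theta>"
    then obtain d where "d > 0" "cball s d \<subseteq> half_plane \<theta>"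
      using open_contains_cball[of "half_plane \<theta>"] by auto
    then show "\<exists>d>0. cball s d \<subseteq> half_plane \<theta> \<and> uniform_limit (cball s d) (dirichlet_partial b) (\<lambda>s. \<Sum>n. A n s) sequentially"
      using uniform_limit_on_subset[OF lim] by blast
  qed
  obtain \<theta>' where \<theta>': "\<And>s. s \<in> half_plane \<theta>' \<Longrightarrow> (\<lambda>N. dirichlet_partial b N s) \<longlonglongrightarrow> g s"
    using b by (auto simp: represented_by_def)
  have "h s = g s" if s: "s \<in> half_plane \<theta>" for s
  proof (rule analytic_continuation_open[of "half_plane (max \<theta> \<theta>')" "half_plane \<theta>" h g s])
    show "half_plane (max \<theta> \<theta>') \<noteq> {}"
      by simp
    show "half_plane (max \<theta> \<theta>') \<subseteq> half_plane \<theta>" by (auto simp: half_plane_def)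
    show "g holomorphic_on half_plane \<theta>"
      by (rule holomorphic_on_subset[OF g]) (use \<open>\<theta> > 0\<close> in \<open>auto simp: half_plane_def\<close>)
    fix z assume z: "z \<in> half_plane (max \<theta> \<theta>')"
    then have "z \<in> half_plane \<theta>" "z \<in> half_plane \<theta>'" by (auto simp: half_plane_def)
    then show "h z = g z"
      unfolding h_def by (intro LIMSEQ_unique[OF tendsto_uniform_limitI[OF lim] \<theta>'])
  qed (use hol s in \<open>auto intro: convex_connected\<close>)
  then show ?thesis
    using lim unfolding h_def by (simp cong: uniform_limit_cong')
qed

section \<open>Completely multiplicative functions and Kronecker's theorem\<close>

lemma bij_betw_nth_prime: "bij_betw nth_prime UNIV {p. prime p}"
proof -
  have "bij_betw (enumerate {p::nat. prime p}) UNIV {p. prime p}"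
    by (rule bij_enumerate[OF primes_infinite])
  moreover have "nth_prime = enumerate {p::nat. prime p}" by (auto simp: nth_prime_def)
  ultimately show ?thesis by simp
qed

lemma prime_nth_prime [simp]: "prime (nth_prime j)"
  using bij_betw_nth_prime by (auto simp: bij_betw_def)

lemma nth_prime_eq_iff [simp]: "nth_prime i = nth_prime j \<longleftrightarrow> i = j"
  using bij_betw_nth_prime by (auto simp: bij_betw_def inj_on_def)

lemma nth_prime_pos [simp]: "nth_prime j > 0"
  using prime_gt_0_nat[OF prime_nth_prime] .

lemma ex_nth_prime: "prime p \<Longrightarrow> \<exists>j. p = nth_prime j"
  using bij_betw_nth_prime by (auto simp: bij_betw_def image_iff set_eq_iff)

lemma finite_nth_prime_dvd:
  assumes "n \<ge> 1"
  shows "finite {j. nth_prime j dvd n}"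
proof (rule finite_imageD)
  show "finite (nth_prime ` {j. nth_prime j dvd n})"
    by (rule finite_subset[of _ "{..n}"]) (use assms in \<open>auto dest!: dvd_imp_le\<close>)
qed (auto simp: inj_on_def)

text \<open>
  A common index set for several arguments is what makes multiplicativity visible.
\<close>

lemma multiplicative_ext_eq_prod:
  assumes "finite J" "{j. nth_prime j dvd n} \<subseteq> J"
  shows "multiplicative_ext \<omega> n = (\<Prod>j\<in>J. \<omega> j ^ multiplicity (nth_prime j) n)"
  unfolding multiplicative_ext_def
  by (rule prod.mono_neutral_left) (use assms in \<open>auto simp: not_dvd_imp_multiplicity_0\<close>)

lemma multiplicative_ext_1 [simp]: "multiplicative_ext \<omega> (Suc 0) = 1"
  unfolding multiplicative_ext_def by (rule prod.neutral) auto

lemma multiplicative_ext_mult: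
  assumes "m \<ge> 1" "n \<ge> 1"
  shows "multiplicative_ext \<omega> (m * n) = multiplicative_ext \<omega> m * multiplicative_ext \<omega> n"
proof -
  define J where "J = {j. nth_prime j dvd m * n}"
  have J: "finite J" "{j. nth_prime j dvd m} \<subseteq> J" "{j. nth_prime j dvd n} \<subseteq> J"
    using finite_nth_prime_dvd[of "m * n"] assms by (auto simp: J_def)
  have "multiplicity (nth_prime j) (m * n) = multiplicity (nth_prime j) m + multiplicity (nth_prime j) n" for j
    using assms by (intro prime_elem_multiplicity_mult_distrib) auto
  then show ?thesis
    using multiplicative_ext_eq_prod[OF J(1,2)] multiplicative_ext_eq_prod[OF J(1,3)]
      multiplicative_ext_eq_prod[of J "m * n"] J(1)
    by (simp add: J_def power_add prod.distrib)
qed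

lemma multiplicative_ext_nth_prime [simp]: "multiplicative_ext \<omega> (nth_prime j) = \<omega> j"
proof -
  have "{i. nth_prime i dvd nth_prime j} = {j}"
    using primes_dvd_imp_eq[OF prime_nth_prime prime_nth_prime] by auto
  then show ?thesis by (simp add: multiplicative_ext_def)
qed

lemma norm_multiplicative_ext:
  assumes "\<And>j. norm (\<omega> j) = 1"
  shows "norm (multiplicative_ext \<omega> n) = 1"
  unfolding multiplicative_ext_def by (simp add: assms norm_power flip: prod_norm)

text \<open>
  The point of the polytorus that belongs to the completely multiplicative function
  \<open>n \<mapsto> n powr (- \<i> * t)\<close>. Twisting by it is vertical translation by \<open>t\<close>.
\<close>

definition Kronecker_flow :: "real \<Rightarrow> nat \<Rightarrow> complex" where
  "Kronecker_flow t j = of_nat (nth_prime j) powr (- \<i> * of_real t)"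

lemma norm_Kronecker_flow [simp]: "norm (Kronecker_flow t j) = 1"
  unfolding Kronecker_flow_def norm_nat_powr by (simp add: less_imp_neq[OF nth_prime_pos, symmetric])

lemma multiplicative_ext_Kronecker_flow:
  assumes "n \<ge> 1"
  shows "multiplicative_ext (Kronecker_flow t) n = of_nat n powr (- \<i> * of_real t)"
  using assms
proof (induction n rule: less_induct)
  case (less n)
  show ?case
  proof (cases "n = 1")
    case True then show ?thesis by simp
  next
    case False
    then obtain p where p: "prime p" "p dvd n" using prime_factor_nat by blast
    then obtain m where n: "n = p * m" by (auto elim: dvdE)
    obtain j where j: "p = nth_prime j" using ex_nth_prime p(1) by blast
    have "m \<ge> 1" "m < n" using less.prems n prime_gt_1_nat[OF p(1)] by (auto intro: Suc_leI Nat.gr0I)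
    then have "multiplicative_ext (Kronecker_flow t) n =
        of_nat p powr (- \<i> * of_real t) * of_nat m powr (- \<i> * of_real t)"
      using less.IH[of m] unfolding n
      by (subst multiplicative_ext_mult) (auto simp: j Suc_leI Kronecker_flow_def[of t j])
    also have "\<dots> = (of_nat p * of_nat m) powr (- \<i> * of_real t)"
      by (rule powr_times_real[symmetric]) auto
    finally show ?thesis by (simp add: n)
  qed
qed

text \<open>
  Unique factorization: splitting the exponents into positive and negative parts gives two equal products
  of powers of the same primes.
\<close>

lemma independent_ln_primes:
  assumes "finite P" "\<And>p. p \<in> P \<Longrightarrow> prime (p::nat)"
    and "(\<Sum>p\<in>P. real_of_int (u p) * ln (real p)) = 0" and "q \<in> P"
  shows "u q = 0"
proof -
  have ln_prod: "ln (real (\<Prod>p\<in>P. p ^ f p)) = (\<Sum>p\<in>P. real (f p) * ln (real p))" for f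
  proof -
    have "ln (real (\<Prod>p\<in>P. p ^ f p)) = (\<Sum>p\<in>P. ln (real p ^ f p))"
      unfolding of_nat_prod of_nat_power
      by (rule ln_prod) (use assms prime_gt_0_nat in \<open>auto intro!: zero_less_power\<close>)
    also have "\<dots> = (\<Sum>p\<in>P. real (f p) * ln (real p))"
      by (intro sum.cong) (use assms prime_gt_0_nat in \<open>auto simp: ln_realpow\<close>)
    finally show ?thesis .
  qed
  have pos: "(\<Prod>p\<in>P. p ^ f p) > 0" for f
    using assms prime_gt_0_nat by (intro prod_pos) auto
  have "(\<Sum>p\<in>P. real_of_int (u p) * ln (real p)) =
    (\<Sum>p\<in>P. real (nat (u p)) * ln (real p)) - (\<Sum>p\<in>P. real (nat (- u p)) * ln (real p))"
    unfolding sum_subtractf[symmetric] left_diff_distrib[symmetric]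
    by (intro sum.cong refl) (auto simp: of_nat_nat)
  then have "ln (real (\<Prod>p\<in>P. p ^ nat (u p))) = ln (real (\<Prod>p\<in>P. p ^ nat (- u p)))"
    using assms(3) by (simp only: ln_prod)
  then have "(\<Prod>p\<in>P. p ^ nat (u p)) = (\<Prod>p\<in>P. p ^ nat (- u p))"
    using pos[of "\<lambda>p. nat (u p)"] pos[of "\<lambda>p. nat (- u p)"]
    by (metis ln_inj_iff of_nat_0_less_iff of_nat_eq_iff)
  then have "multiplicity q (\<Prod>p\<in>P. p ^ nat (u p)) = multiplicity q (\<Prod>p\<in>P. p ^ nat (- u p))" by simp
  then have "nat (u q) = nat (- u q)"
    using assms by (simp add: multiplicity_prod_prime_powers)
  then show ?thesis by linarith
qed

text \<open>
  Kronecker's theorem for the rationally independent numbers \<open>ln p / (2 * pi)\<close>. For each \<open>m\<close> it is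
  applied to the first \<open>m\<close> primes with precision \<open>1 / (m + 1)\<close>, so that a single sequence of times works
  for all coordinates.
\<close>

lemma Kronecker_flow_dense:
  assumes \<omega>: "\<And>j. norm (\<omega> j) = 1"
  obtains \<tau> :: "nat \<Rightarrow> real" where "\<And>j. (\<lambda>m. Kronecker_flow (\<tau> m) j) \<longlonglongrightarrow> \<omega> j"
proof -
  define \<theta> where "\<theta> j = ln (real (nth_prime j)) / (2 * pi)" for j
  define \<alpha> where "\<alpha> j = - Arg (\<omega> j) / (2 * pi)" for j
  interpret Modules.module "(\<lambda>r. (*) (real_of_int r))"
    by (simp add: Modules.module.intro distrib_left mult.commute)
  have inj: "inj_on \<theta> A" for A
    by (auto simp: inj_on_def \<theta>_def)
  have indep: "independent (\<theta> ` A)" for A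
    unfolding independent_explicit_module
  proof (intro allI impI)
    fix t u v assume t: "finite t" "t \<subseteq> \<theta> ` A" "(\<Sum>v\<in>t. real_of_int (u v) * v) = 0" "v \<in> t"
    then obtain B where B: "B \<subseteq> A" "t = \<theta> ` B" "finite B"
      by (meson finite_subset_image)
    obtain q where q: "q \<in> B" "v = \<theta> q" using t B by auto
    have "0 = (\<Sum>j\<in>B. real_of_int (u (\<theta> j)) * \<theta> j)"
      using t(3) unfolding B(2) by (simp add: sum.reindex[OF inj])
    also have "\<dots> = (\<Sum>j\<in>B. real_of_int (u (\<theta> j)) * ln (real (nth_prime j))) / (2 * pi)"
      by (simp add: \<theta>_def sum_divide_distrib)
    finally have "(\<Sum>j\<in>B. real_of_int (u (\<theta> j)) * ln (real (nth_prime j))) = 0" by simp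
    moreover have "(\<Sum>j\<in>B. real_of_int (u (\<theta> j)) * ln (real (nth_prime j)))
      = (\<Sum>p\<in>nth_prime ` B. real_of_int (u (ln (real p) / (2 * pi))) * ln (real p))"
      by (subst sum.reindex) (auto simp: inj_on_def \<theta>_def)
    ultimately have "u (ln (real (nth_prime q)) / (2 * pi)) = 0"
      using B(3) q(1) by (intro independent_ln_primes[of "nth_prime ` B" "\<lambda>p. u (ln (real p) / (2 * pi))"]) auto
    then show "u v = 0" by (simp add: q \<theta>_def)
  qed
  have "\<exists>t. \<forall>i<m. \<exists>h::int. \<bar>t * \<theta> i - of_int h - \<alpha> i\<bar> < 1 / (real m + 1)" for m
    by (rule Kronecker_thm_1[OF indep inj, of "1 / (real m + 1)" m \<alpha>]) (auto)
  then obtain \<tau> where \<tau>: "\<And>m i. i < m \<Longrightarrow> \<exists>h::int. \<bar>\<tau> m * \<theta> i - of_int h - \<alpha> i\<bar> < 1 / (real m + 1)"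
    by metis
  show thesis
  proof (rule that)
    fix j
    define h where "h m = (SOME h::int. \<bar>\<tau> m * \<theta> j - of_int h - \<alpha> j\<bar> < 1 / (real m + 1))" for m
    have h: "\<bar>\<tau> m * \<theta> j - of_int (h m) - \<alpha> j\<bar> < 1 / (real m + 1)" if "j < m" for m
      unfolding h_def by (rule someI_ex) (rule \<tau>[OF that])
    \<comment> \<open>The integer part \<open>h m\<close> contributes a full turn, so only \<open>e m\<close> affects the flow.\<close>
    define e where "e m = \<tau> m * \<theta> j - of_int (h m) - \<alpha> j" for m
    have "e \<longlonglongrightarrow> 0"
    proof (rule Lim_null_comparison)
      show "\<forall>\<^sub>F m in sequentially. norm (e m) \<le> 1 / (real m + 1)"
        using eventually_gt_at_top[of j] by eventually_elim (use h in \<open>force simp: e_def\<close>)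
      show "(\<lambda>m. 1 / (real m + 1)) \<longlonglongrightarrow> 0" by real_asymp
    qed
    then have lim: "(\<lambda>m. \<omega> j * cis (- 2 * pi * e m)) \<longlonglongrightarrow> \<omega> j * cis (- 2 * pi * 0)"
      by (intro tendsto_intros)
    have "Kronecker_flow (\<tau> m) j = \<omega> j * cis (- 2 * pi * e m)" for m
    proof -
      have "\<omega> j \<noteq> 0" using \<omega>[of j] by auto
      then have "\<omega> j = cis (Arg (\<omega> j))" using \<omega>[of j] cis_Arg[of "\<omega> j"] by (simp add: sgn_eq)
      then have "\<omega> j = cis (- 2 * pi * \<alpha> j)" by (simp add: \<alpha>_def)
      then have "\<omega> j * cis (- 2 * pi * e m) = cis (- 2 * pi * \<alpha> j - 2 * pi * e m)"
        by (simp add: cis_mult)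
      also have "- 2 * pi * \<alpha> j - 2 * pi * e m = - \<tau> m * ln (real (nth_prime j)) + 2 * pi * of_int (h m)"
        by (simp add: e_def \<theta>_def field_simps)
      also have "cis \<dots> = cis (- \<tau> m * ln (real (nth_prime j))) * cis (2 * pi * of_int (h m))"
        by (rule cis_mult[symmetric])
      also have "cis (2 * pi * of_int (h m)) = 1" by (rule cis_multiple_2pi) auto
      also have "cis (- \<tau> m * ln (real (nth_prime j))) = Kronecker_flow (\<tau> m) j"
        by (simp add: Kronecker_flow_def powr_def Ln_of_nat cis_conv_exp less_imp_neq[OF nth_prime_pos, symmetric] mult_ac)
      finally show ?thesis by simp
    qed
    then show "(\<lambda>m. Kronecker_flow (\<tau> m) j) \<longlonglongrightarrow> \<omega> j" using lim by simp
  qed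
qed

lemma tendsto_multiplicative_ext:
  assumes "\<And>j. ((\<lambda>m. W m j) \<longlongrightarrow> \<omega> j) F"
  shows "((\<lambda>m. multiplicative_ext (W m) n) \<longlongrightarrow> multiplicative_ext \<omega> n) F"
  unfolding multiplicative_ext_def by (intro tendsto_intros assms)

lemma dirichlet_partial_vertical_shift:
  "dirichlet_partial b N (s + \<i> * of_real t) =
   dirichlet_partial (\<lambda>n. b n * multiplicative_ext (Kronecker_flow t) n) N s"
  unfolding dirichlet_partial_def
proof (rule sum.cong)
  fix n assume n: "n \<in> {1..N}"
  have "of_nat n powr (- (s + \<i> * of_real t)) = of_nat n powr (- s) * of_nat n powr (- \<i> * of_real t)"
    by (simp flip: powr_add)
  then show "b n * of_nat n powr (- (s + \<i> * of_real t)) =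
     b n * multiplicative_ext (Kronecker_flow t) n * of_nat n powr (- s)"
    using n by (simp add: multiplicative_ext_Kronecker_flow)
qed auto

text \<open>
  A partial sum depends on finitely many coordinates of the twist, and continuously so.
\<close>

lemma twisted_partial_limit_of_translates:
  assumes \<omega>: "\<And>j. norm (\<omega> j) = 1"
  obtains \<tau> :: "nat \<Rightarrow> real" where
    "\<And>b N s. (\<lambda>m. dirichlet_partial b N (s + \<i> * of_real (\<tau> m))) \<longlonglongrightarrow>
       dirichlet_partial (\<lambda>n. b n * multiplicative_ext \<omega> n) N s"
proof -
  obtain \<tau> where \<tau>: "\<And>j. (\<lambda>m. Kronecker_flow (\<tau> m) j) \<longlonglongrightarrow> \<omega> j"
    by (rule Kronecker_flow_dense[of \<omega>, OF \<omega>]) blast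
  show thesis
  proof (rule that)
    show "(\<lambda>m. dirichlet_partial b N (s + \<i> * of_real (\<tau> m))) \<longlonglongrightarrow>
       dirichlet_partial (\<lambda>n. b n * multiplicative_ext \<omega> n) N s" for b N s
      unfolding dirichlet_partial_vertical_shift unfolding dirichlet_partial_def
      by (intro tendsto_sum tendsto_mult tendsto_const tendsto_multiplicative_ext \<tau>)
  qed
qed

text \<open>
  Bounds that hold along a whole vertical line pass to all twists. This makes the
  convergence of the twisted series uniform in the twist.
\<close>

lemma twisted_partial_diff_le:
  assumes \<omega>: "\<And>j. norm (\<omega> j) = 1"
    and le: "\<And>t. norm (dirichlet_partial b M (s + \<i> * of_real t) - dirichlet_partial b N (s + \<i> * of_real t)) \<le> e"
  shows "norm (dirichlet_partial (\<lambda>n. b n * multiplicative_ext \<omega> n) M s -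
    dirichlet_partial (\<lambda>n. b n * multiplicative_ext \<omega> n) N s) \<le> e"
proof -
  obtain \<tau> :: "nat \<Rightarrow> real" where \<tau>:
    "\<And>b N s. (\<lambda>m. dirichlet_partial b N (s + \<i> * of_real (\<tau> m))) \<longlonglongrightarrow>
       dirichlet_partial (\<lambda>n. b n * multiplicative_ext \<omega> n) N s"
    by (rule twisted_partial_limit_of_translates[of \<omega>, OF \<omega>]) blast
  have "(\<lambda>m. norm (dirichlet_partial b M (s + \<i> * of_real (\<tau> m)) - dirichlet_partial b N (s + \<i> * of_real (\<tau> m))))
    \<longlonglongrightarrow> norm (dirichlet_partial (\<lambda>n. b n * multiplicative_ext \<omega> n) M s -
    dirichlet_partial (\<lambda>n. b n * multiplicative_ext \<omega> n) N s)"
    by (intro tendsto_intros \<tau>)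
  then show ?thesis by (rule LIMSEQ_le_const2) (use le in auto)
qed

section \<open>Uniform convergence of the twisted series\<close>

lemma dirichlet_fun_uniform_limit:
  assumes "uniform_limit S (dirichlet_partial b) g sequentially" "s \<in> S"
  shows "dirichlet_fun b s = g s"
  unfolding dirichlet_fun_def by (rule limI) (rule tendsto_uniform_limitI[OF assms])

lemma uniform_limit_dirichlet_fun:
  assumes "uniformly_convergent_on S (dirichlet_partial b)"
  shows "uniform_limit S (dirichlet_partial b) (dirichlet_fun b) sequentially"
  using assms unfolding uniformly_convergent_uniform_limit_iff dirichlet_fun_def .

text \<open>
  The Cauchy estimate for the series itself is invariant under vertical translation, hence
  holds for all twists at once.
\<close>

lemma uniform_limit_twisted:
  assumes "uniform_limit (half_plane \<theta>) (dirichlet_partial b) g sequentially"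
  shows "uniform_limit ({\<omega>. \<forall>j. norm (\<omega> j) = 1} \<times> half_plane \<theta>)
     (\<lambda>N (\<omega>, s). dirichlet_partial (\<lambda>n. b n * multiplicative_ext \<omega> n) N s)
     (\<lambda>(\<omega>, s). dirichlet_fun (\<lambda>n. b n * multiplicative_ext \<omega> n) s) sequentially"
proof -
  let ?P = "\<lambda>N (\<omega>, s). dirichlet_partial (\<lambda>n. b n * multiplicative_ext \<omega> n) N s"
  let ?X = "{\<omega>. \<forall>j. norm (\<omega> j) = 1} \<times> half_plane \<theta>"
  have "uniformly_Cauchy_on (half_plane \<theta>) (dirichlet_partial b)"
    using assms by (auto intro!: uniformly_convergent_Cauchy simp: uniformly_convergent_on_def)
  then have C: "\<exists>M. \<forall>s\<in>half_plane \<theta>. \<forall>m\<ge>M. \<forall>n\<ge>M. dist (dirichlet_partial b m s) (dirichlet_partial b n s) < e"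
    if "e > 0" for e using that unfolding uniformly_Cauchy_on_def by blast
  have "uniformly_Cauchy_on ?X ?P"
    unfolding uniformly_Cauchy_on_def
  proof (intro allI impI)
    fix e :: real assume "e > 0"
    then obtain M where M: "\<And>s m n. s \<in> half_plane \<theta> \<Longrightarrow> m \<ge> M \<Longrightarrow> n \<ge> M \<Longrightarrow>
       dist (dirichlet_partial b m s) (dirichlet_partial b n s) < e / 2"
      using C[of "e / 2"] by auto
    have "dist (?P m x) (?P n x) < e" if x: "x \<in> ?X" and mn: "m \<ge> M" "n \<ge> M" for x m n
    proof -
      obtain \<omega> s where [simp]: "x = (\<omega>, s)" by (cases x)
      have "norm (dirichlet_partial (\<lambda>n. b n * multiplicative_ext \<omega> n) m s -
          dirichlet_partial (\<lambda>n. b n * multiplicative_ext \<omega> n) n s) \<le> e / 2"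
      proof (rule twisted_partial_diff_le)
        fix t :: real
        have "s + \<i> * of_real t \<in> half_plane \<theta>" using x by (auto simp: half_plane_def)
        from M[OF this mn] show "norm (dirichlet_partial b m (s + \<i> * of_real t) -
          dirichlet_partial b n (s + \<i> * of_real t)) \<le> e / 2" by (simp add: dist_norm)
      qed (use x in auto)
      then show ?thesis using \<open>e > 0\<close> by (simp add: dist_norm)
    qed
    then show "\<exists>M. \<forall>x\<in>?X. \<forall>m\<ge>M. \<forall>n\<ge>M. dist (?P m x) (?P n x) < e" by blast
  qed
  then have "uniformly_convergent_on ?X ?P" by (rule Cauchy_uniformly_convergent)
  then show ?thesis
    unfolding uniformly_convergent_uniform_limit_iff dirichlet_fun_def case_prod_beta .
qed

lemma holomorphic_on_dirichlet_limit:
  assumes "\<And>\<theta>. \<theta> > 0 \<Longrightarrow> uniform_limit (half_plane \<theta>) (dirichlet_partial b) g sequentially"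
  shows "g holomorphic_on half_plane 0"
proof (rule holomorphic_uniform_sequence[OF open_half_plane holomorphic_on_dirichlet_partial])
  fix s assume s: "s \<in> half_plane 0"
  then have "s \<in> half_plane (Re s / 2)" by (auto simp: half_plane_def)
  then obtain d where d: "d > 0" "cball s d \<subseteq> half_plane (Re s / 2)"
    using open_contains_cball[of "half_plane (Re s / 2)"] by auto
  moreover have "half_plane (Re s / 2) \<subseteq> half_plane 0" using s by (auto simp: half_plane_def)
  moreover have "uniform_limit (half_plane (Re s / 2)) (dirichlet_partial b) g sequentially"
    using s by (intro assms) (auto simp: half_plane_def)
  ultimately show "\<exists>d>0. cball s d \<subseteq> half_plane 0 \<and> uniform_limit (cball s d) (dirichlet_partial b) g sequentially"
    using uniform_limit_on_subset by blast
qed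

lemma represented_by_dirichlet_limit:
  assumes "uniform_limit (half_plane \<theta>) (dirichlet_partial b) g sequentially"
  shows "represented_by g b"
  unfolding represented_by_def using tendsto_uniform_limitI[OF assms] by blast

text \<open>
  A twisted value is approximated first by a partial sum of the twisted series, then by a translate of the
  untwisted partial sum, then by the value of \<open>g\<close> at the translated point.
\<close>

lemma twisted_in_closure:
  assumes U: "\<And>\<theta>. \<theta> > 0 \<Longrightarrow> uniform_limit (half_plane \<theta>) (dirichlet_partial b) g sequentially"
    and \<omega>: "\<And>j. norm (\<omega> j) = 1" and s: "s \<in> half_plane 0"
  shows "dirichlet_fun (\<lambda>n. b n * multiplicative_ext \<omega> n) s \<in> closure (g ` half_plane 0)"
  unfolding closure_approachable
proof (intro allI impI)
  fix e :: real assume e: "e > 0"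
  define \<theta> where "\<theta> = Re s / 2"
  have \<theta>: "\<theta> > 0" "s \<in> half_plane \<theta>" using s by (auto simp: \<theta>_def half_plane_def)
  let ?P = "\<lambda>\<omega>. dirichlet_partial (\<lambda>n. b n * multiplicative_ext \<omega> n)"
  obtain \<tau> :: "nat \<Rightarrow> real" where \<tau>:
    "\<And>b N s. (\<lambda>m. dirichlet_partial b N (s + \<i> * of_real (\<tau> m))) \<longlonglongrightarrow>
       dirichlet_partial (\<lambda>n. b n * multiplicative_ext \<omega> n) N s"
    by (rule twisted_partial_limit_of_translates[of \<omega>, OF \<omega>]) blast
  \<comment> \<open>One large \<open>N\<close> serves both the series for \<open>g\<close> and its twist.\<close>
  have e3: "e / 3 > 0" using e by simp
  have "\<forall>\<^sub>F N in sequentially. (\<forall>z\<in>half_plane \<theta>. dist (dirichlet_partial b N z) (g z) < e / 3) \<and>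
     dist (?P \<omega> N s) (dirichlet_fun (\<lambda>n. b n * multiplicative_ext \<omega> n) s) < e / 3"
    using uniform_limitD[OF U[OF \<theta>(1)] e3] uniform_limitD[OF uniform_limit_twisted[OF U[OF \<theta>(1)]] e3]
  proof eventually_elim
    case (elim N)
    then show ?case using \<omega> \<theta>(2) by auto
  qed
  then obtain N where N: "\<And>z. z \<in> half_plane \<theta> \<Longrightarrow> dist (dirichlet_partial b N z) (g z) < e / 3"
    "dist (?P \<omega> N s) (dirichlet_fun (\<lambda>n. b n * multiplicative_ext \<omega> n) s) < e / 3"
    by (auto simp: eventually_sequentially)
  have "\<forall>\<^sub>F m in sequentially. dist (dirichlet_partial b N (s + \<i> * of_real (\<tau> m))) (?P \<omega> N s) < e / 3"
    using \<tau> e by (intro tendstoD) auto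
  then obtain m where m: "dist (dirichlet_partial b N (s + \<i> * of_real (\<tau> m))) (?P \<omega> N s) < e / 3"
    by (auto simp: eventually_sequentially)
  have s': "s + \<i> * of_real (\<tau> m) \<in> half_plane \<theta>" using \<theta>(2) by (auto simp: half_plane_def)
  have "dist (g (s + \<i> * of_real (\<tau> m))) (dirichlet_fun (\<lambda>n. b n * multiplicative_ext \<omega> n) s) < e"
    using N(1)[OF s'] N(2) m e
      dist_triangle[of "g (s + \<i> * of_real (\<tau> m))" "dirichlet_fun (\<lambda>n. b n * multiplicative_ext \<omega> n) s" "dirichlet_partial b N (s + \<i> * of_real (\<tau> m))"]
      dist_triangle[of "dirichlet_partial b N (s + \<i> * of_real (\<tau> m))" "dirichlet_fun (\<lambda>n. b n * multiplicative_ext \<omega> n) s" "?P \<omega> N s"]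
    by (simp add: dist_commute)
  moreover have "s + \<i> * of_real (\<tau> m) \<in> half_plane 0" using s by (auto simp: half_plane_def)
  ultimately show "\<exists>y\<in>g ` half_plane 0. dist y (dirichlet_fun (\<lambda>n. b n * multiplicative_ext \<omega> n) s) < e"
    by blast
qed

section \<open>Haar measure on the polytorus\<close>

lemma space_circle_measure [simp]: "space circle_measure = sphere 0 1"
  unfolding circle_measure_def by (simp add: space_restrict_space)

lemma sets_circle_measure [measurable_cong]: "sets circle_measure = sets (restrict_space borel (sphere 0 1))"
  unfolding circle_measure_def by simp

lemma cis_measurable_sphere [measurable]:
  "cis \<in> measurable borel (restrict_space borel (sphere 0 1))"
  by (rule measurable_restrict_space2)
     (auto intro!: borel_measurable_continuous_onI continuous_intros)

lemma prob_space_circle_measure: "prob_space circle_measure"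
  unfolding circle_measure_def
  by (intro prob_space.prob_space_distr prob_space_uniform_measure) auto

lemma integral_circle_measure:
  fixes f :: "complex \<Rightarrow> complex"
  assumes f: "continuous_on UNIV f"
  shows "(\<integral>z. f z \<partial>circle_measure) = integral {0..2 * pi} (\<lambda>x. f (cis x)) / (2 * pi)"
proof -
  have fm [measurable]: "f \<in> borel_measurable borel" using f by (rule borel_measurable_continuous_onI)
  have cont: "continuous_on S (\<lambda>x. f (cis x))" for S
    by (rule continuous_on_compose2[OF f]) (auto intro!: continuous_intros)
  have [measurable]: "(\<lambda>x. f (cis x)) \<in> borel_measurable borel"
    by (intro borel_measurable_continuous_onI cont)
  have "(\<integral>z. f z \<partial>circle_measure) = (\<integral>x. f (cis x) \<partial>uniform_measure lborel {0..<2 * pi})"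
    unfolding circle_measure_def
    by (rule integral_distr) (auto intro: measurable_restrict_space1)
  also have "uniform_measure lborel {0..<2 * pi} = density lborel (\<lambda>x. ennreal (indicator {0..<2 * pi} x / (2 * pi)))"
    unfolding uniform_measure_def
    by (intro density_cong) (auto simp: indicator_def divide_ennreal[symmetric] ennreal_1[symmetric] simp del: ennreal_1)
  also have "(\<integral>x. f (cis x) \<partial>\<dots>) = (\<integral>x. (indicator {0..<2 * pi} x / (2 * pi)) *\<^sub>R f (cis x) \<partial>lborel)"
    by (rule integral_density) auto
  also have "\<dots> = (\<integral>x. (indicator {0..2 * pi} x *\<^sub>R f (cis x)) / (2 * pi) \<partial>lborel)"
  proof (rule integral_cong_AE)
    show "AE x in lborel. (indicator {0..<2 * pi} x / (2 * pi)) *\<^sub>R f (cis x) =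
        (indicator {0..2 * pi} x *\<^sub>R f (cis x)) / (2 * pi)"
      using AE_lborel_singleton[of "2 * pi"]
      by eventually_elim (auto simp: indicator_def scaleR_conv_of_real)
  qed auto
  also have "\<dots> = (LINT x:{0..2 * pi}|lborel. f (cis x)) / (2 * pi)"
    unfolding set_lebesgue_integral_def by (rule integral_divide_zero)
  also have "(LINT x:{0..2 * pi}|lborel. f (cis x)) = integral {0..2 * pi} (\<lambda>x. f (cis x))"
    by (intro set_borel_integral_eq_integral borel_integrable_atLeastAtMost') (rule cont)
  finally show ?thesis by simp
qed

lemma integral_cis_int:
  fixes k :: int
  assumes "k \<noteq> 0"
  shows "integral {0..2 * pi} (\<lambda>x. cis (real_of_int k * x)) = 0"
proof -
  let ?F = "\<lambda>x. cis (real_of_int k * x) / (\<i> * of_int k)"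
  have "((\<lambda>x. cis (real_of_int k * x)) has_integral (?F (2 * pi) - ?F 0)) {0..2 * pi}"
  proof (rule fundamental_theorem_of_calculus)
    fix x :: real
    have "((\<lambda>x. exp (\<i> * of_real (real_of_int k * x)) / (\<i> * of_int k)) has_vector_derivative
      exp (\<i> * of_real (real_of_int k * x))) (at x within {0..2 * pi})"
      using assms by (auto intro!: derivative_eq_intros has_vector_derivative_real_field simp: field_simps)
    then show "(?F has_vector_derivative cis (real_of_int k * x)) (at x within {0..2 * pi})"
      by (simp add: cis_conv_exp)
  qed auto
  moreover have "cis (real_of_int k * (2 * pi)) = 1"
    using cis_multiple_2pi[of "real_of_int k"] by (simp add: mult.commute mult.left_commute)
  ultimately show ?thesis by (simp add: integral_unique)
qed

lemma integral_circle_character: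
  "(\<integral>z. z ^ a * cnj z ^ b \<partial>circle_measure) = (if a = b then 1 else 0)"
proof -
  have c: "continuous_on UNIV (\<lambda>z::complex. z ^ a * cnj z ^ b)" by (intro continuous_intros)
  have e: "cis x ^ a * cnj (cis x) ^ b = cis (real_of_int (int a - int b) * x)" for x
    by (simp add: cis_cnj Complex.DeMoivre cis_mult left_diff_distrib)
  show ?thesis
    unfolding integral_circle_measure[OF c] e
    using integral_cis_int[of "int a - int b"] by (auto simp: scaleR_conv_of_real)
qed

lemma prob_space_polytorus: "prob_space polytorus"
  unfolding polytorus_def by (rule prob_space_PiM) (rule prob_space_circle_measure)

lemma space_polytorus: "space polytorus = {\<omega>. \<forall>j. norm (\<omega> j) = 1}"
  by (auto simp: polytorus_def space_PiM PiE_def Pi_def)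

lemma measurable_polytorus_component [measurable]: "(\<lambda>\<omega>. \<omega> j) \<in> borel_measurable polytorus"
proof -
  have "(\<lambda>\<omega>. \<omega> j) \<in> measurable polytorus circle_measure"
    unfolding polytorus_def by measurable
  then have "(\<lambda>\<omega>. \<omega> j) \<in> measurable polytorus (restrict_space borel (sphere 0 1))"
    by (simp cong: measurable_cong_sets add: sets_circle_measure)
  then show ?thesis by (simp add: measurable_restrict_space2_iff)
qed

lemma measurable_multiplicative_ext [measurable]:
  "(\<lambda>\<omega>. multiplicative_ext \<omega> n) \<in> borel_measurable polytorus"
  unfolding multiplicative_ext_def by measurable

text \<open>
  The integral factorizes over the finitely many primes dividing \<open>n\<close> or \<open>m\<close>. If \<open>n \<noteq> m\<close> then some
  prime occurs with different multiplicities, and the corresponding circle integral is 0.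
\<close>

lemma integral_polytorus_character:
  assumes "m \<ge> 1" "n \<ge> 1"
  shows "(\<integral>\<omega>. multiplicative_ext \<omega> n * cnj (multiplicative_ext \<omega> m) \<partial>polytorus) = (if n = m then 1 else 0)"
proof -
  interpret polytorus: product_prob_space "\<lambda>_. circle_measure" UNIV
    by (simp add: product_prob_space_def product_sigma_finite_def product_prob_space_axioms_def
        prob_space_circle_measure prob_space_imp_sigma_finite)
  define J where "J = {j. nth_prime j dvd n * m}"
  define a where "a j = multiplicity (nth_prime j) n" for j
  define b where "b j = multiplicity (nth_prime j) m" for j
  have J: "finite J" "{j. nth_prime j dvd n} \<subseteq> J" "{j. nth_prime j dvd m} \<subseteq> J"
    using finite_nth_prime_dvd[of "n * m"] assms by (auto simp: J_def)
  have 1: "multiplicative_ext \<omega> n * cnj (multiplicative_ext \<omega> m) = (\<Prod>j\<in>J. \<omega> j ^ a j * cnj (\<omega> j) ^ b j)" for \<omega>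
    unfolding multiplicative_ext_eq_prod[OF J(1,2)] multiplicative_ext_eq_prod[OF J(1,3)]
    by (simp add: prod.distrib a_def b_def)
  have cm: "(\<lambda>z. z ^ k * cnj z ^ l) \<in> borel_measurable circle_measure" for k l
  proof -
    have "(\<lambda>z::complex. z ^ k * cnj z ^ l) \<in> borel_measurable borel"
      by (intro borel_measurable_continuous_onI continuous_intros)
    then have "(\<lambda>z::complex. z ^ k * cnj z ^ l) \<in> borel_measurable (restrict_space borel (sphere 0 1))"
      by (rule measurable_restrict_space1)
    then show ?thesis by (simp cong: measurable_cong_sets add: sets_circle_measure)
  qed
  have pm: "(\<lambda>x. \<Prod>j\<in>J. x j ^ a j * cnj (x j) ^ b j) \<in> borel_measurable (PiM J (\<lambda>_. circle_measure))"
  proof (intro borel_measurable_prod)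
    fix j assume "j \<in> J"
    then have "(\<lambda>x. x j) \<in> measurable (PiM J (\<lambda>_. circle_measure)) circle_measure" by measurable
    from measurable_compose[OF this cm]
    show "(\<lambda>x. x j ^ a j * cnj (x j) ^ b j) \<in> borel_measurable (PiM J (\<lambda>_. circle_measure))" .
  qed
  have "(\<integral>\<omega>. multiplicative_ext \<omega> n * cnj (multiplicative_ext \<omega> m) \<partial>polytorus)
     = (\<integral>\<omega>. (\<Prod>j\<in>J. restrict \<omega> J j ^ a j * cnj (restrict \<omega> J j) ^ b j) \<partial>PiM UNIV (\<lambda>_. circle_measure))"
    unfolding 1 polytorus_def by (intro Bochner_Integration.integral_cong prod.cong) auto
  also have "\<dots> = (\<integral>x. (\<Prod>j\<in>J. x j ^ a j * cnj (x j) ^ b j) \<partial>distr (PiM UNIV (\<lambda>_. circle_measure)) (PiM J (\<lambda>_. circle_measure)) (\<lambda>x. restrict x J))"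
    by (rule integral_distr[OF measurable_restrict_subset pm, symmetric]) auto
  also have "\<dots> = (\<integral>x. (\<Prod>j\<in>J. x j ^ a j * cnj (x j) ^ b j) \<partial>PiM J (\<lambda>_. circle_measure))"
    using J(1) by (subst polytorus.distr_PiM_restrict_finite) auto
  also have "\<dots> = (\<Prod>j\<in>J. \<integral>z. z ^ a j * cnj z ^ b j \<partial>circle_measure)"
  proof (rule polytorus.product_integral_prod[OF J(1), where f="\<lambda>j z. z ^ a j * cnj z ^ b j"])
    fix j
    show "integrable circle_measure (\<lambda>z. z ^ a j * cnj z ^ b j)"
      by (rule finite_measure.integrable_const_bound[OF prob_space.finite_measure[OF prob_space_circle_measure], of _ 1])
         (auto simp: norm_mult norm_power cm)
  qed
  also have "\<dots> = (\<Prod>j\<in>J. if a j = b j then 1 else 0)"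
    by (simp only: integral_circle_character)
  also have "\<dots> = (if n = m then 1 else 0)"
  proof (cases "n = m")
    case True then show ?thesis by (simp add: a_def b_def)
  next
    case False
    then obtain p where p: "prime p" "multiplicity p n \<noteq> multiplicity p m"
      using multiplicity_eq_nat[of n m] assms by auto
    then obtain j where j: "p = nth_prime j" using ex_nth_prime by blast
    have "p dvd n \<or> p dvd m"
      using p(2) by (metis not_dvd_imp_multiplicity_0)
    then have "j \<in> J" by (auto simp: J_def j)
    moreover have "a j \<noteq> b j" using p by (simp add: a_def b_def j)
    ultimately have "(\<Prod>j\<in>J. if a j = b j then 1 else 0) = (0 :: complex)"
      using J(1) by (intro prod_zero) auto
    then show ?thesis using False by simp
  qed
  finally show ?thesis .
qed

section \<open>Means along the Kronecker flow\<close>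

text \<open>
  Time averages along the Kronecker flow through the identity exist and equal the space average.
  Boundedness and continuity along the flow are part of the notion, so that it is closed under uniform
  limits on the torus. The mean is written as a quotient because the values are complex.
\<close>

definition has_ergodic_mean :: "((nat \<Rightarrow> complex) \<Rightarrow> complex) \<Rightarrow> bool" where
  "has_ergodic_mean U \<longleftrightarrow>
     U \<in> borel_measurable polytorus \<and> (\<exists>B. \<forall>\<omega>\<in>space polytorus. norm (U \<omega>) \<le> B) \<and>
     continuous_on UNIV (\<lambda>t. U (Kronecker_flow t)) \<and>
     ((\<lambda>T. integral {-T..T} (\<lambda>t. U (Kronecker_flow t)) / of_real (2 * T)) \<longlongrightarrow>
        (\<integral>\<omega>. U \<omega> \<partial>polytorus)) at_top"

lemma Kronecker_flow_in_space [simp]: "Kronecker_flow t \<in> space polytorus"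
  by (simp add: space_polytorus)

lemma has_ergodic_mean_integrable:
  assumes "has_ergodic_mean U"
  shows "integrable polytorus U"
proof -
  interpret prob_space polytorus by (rule prob_space_polytorus)
  obtain B where "\<forall>\<omega>\<in>space polytorus. norm (U \<omega>) \<le> B" "U \<in> borel_measurable polytorus"
    using assms by (auto simp: has_ergodic_mean_def)
  then show ?thesis by (intro integrable_const_bound[of _ B]) (auto intro: AE_I2)
qed

lemma has_ergodic_mean_add:
  assumes U: "has_ergodic_mean U" and V: "has_ergodic_mean V"
  shows "has_ergodic_mean (\<lambda>\<omega>. U \<omega> + V \<omega>)"
proof -
  note iU = has_ergodic_mean_integrable[OF U] and iV = has_ergodic_mean_integrable[OF V]
  have cU: "continuous_on S (\<lambda>t. U (Kronecker_flow t))" and cV: "continuous_on S (\<lambda>t. V (Kronecker_flow t))" for S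
    using U V by (auto simp: has_ergodic_mean_def intro: continuous_on_subset)
  obtain B C where B: "\<forall>\<omega>\<in>space polytorus. norm (U \<omega>) \<le> B" and C: "\<forall>\<omega>\<in>space polytorus. norm (V \<omega>) \<le> C"
    using U V by (auto simp: has_ergodic_mean_def)
  have "((\<lambda>T. integral {-T..T} (\<lambda>t. U (Kronecker_flow t)) / of_real (2 * T) + integral {-T..T} (\<lambda>t. V (Kronecker_flow t)) / of_real (2 * T)) \<longlongrightarrow>
        (\<integral>\<omega>. U \<omega> \<partial>polytorus) + (\<integral>\<omega>. V \<omega> \<partial>polytorus)) at_top"
    using U V by (intro tendsto_add) (auto simp: has_ergodic_mean_def)
  moreover have "integral {-T..T} (\<lambda>t. U (Kronecker_flow t)) / of_real (2 * T) + integral {-T..T} (\<lambda>t. V (Kronecker_flow t)) / of_real (2 * T)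
     = integral {-T..T} (\<lambda>t. U (Kronecker_flow t) + V (Kronecker_flow t)) / of_real (2 * T)" for T
    by (subst integral_add) (auto intro!: integrable_continuous_interval cU cV simp: add_divide_distrib)
  moreover have "\<forall>\<omega>\<in>space polytorus. norm (U \<omega> + V \<omega>) \<le> B + C"
    using B C by (auto intro!: norm_triangle_mono)
  ultimately show ?thesis
    using U V iU iV unfolding has_ergodic_mean_def
    by (auto intro!: continuous_on_add cU cV borel_measurable_add)
qed

lemma has_ergodic_mean_scale:
  assumes U: "has_ergodic_mean U"
  shows "has_ergodic_mean (\<lambda>\<omega>. c * U \<omega>)"
proof -
  obtain B where B: "\<forall>\<omega>\<in>space polytorus. norm (U \<omega>) \<le> B"
    using U by (auto simp: has_ergodic_mean_def)
  have "((\<lambda>T. c * (integral {-T..T} (\<lambda>t. U (Kronecker_flow t)) / of_real (2 * T))) \<longlongrightarrow>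
        c * (\<integral>\<omega>. U \<omega> \<partial>polytorus)) at_top"
    using U by (intro tendsto_mult_left) (auto simp: has_ergodic_mean_def)
  moreover have "\<forall>\<omega>\<in>space polytorus. norm (c * U \<omega>) \<le> norm c * B"
    using B by (auto simp: norm_mult mult_left_mono)
  ultimately show ?thesis
    using U unfolding has_ergodic_mean_def by (auto intro!: continuous_on_mult_left)
qed

text \<open>
  Along the flow the character is \<open>cis (l * t)\<close> with \<open>l = ln m - ln n\<close>. Its mean over \<open>[-T, T]\<close> is
  \<open>O(1 / T)\<close> unless \<open>l = 0\<close>, in agreement with orthogonality on the torus.
\<close>

lemma has_ergodic_mean_character:
  assumes "m \<ge> 1" "n \<ge> 1"
  shows "has_ergodic_mean (\<lambda>\<omega>. multiplicative_ext \<omega> n * cnj (multiplicative_ext \<omega> m))"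
proof -
  define l where "l = ln (real m) - ln (real n)"
  have e: "multiplicative_ext (Kronecker_flow t) n * cnj (multiplicative_ext (Kronecker_flow t) m) = cis (l * t)" for t
  proof -
    have "multiplicative_ext (Kronecker_flow t) k = cis (- (ln (real k) * t))" if "k \<ge> 1" for k
      using that by (simp add: multiplicative_ext_Kronecker_flow powr_def Ln_of_nat cis_conv_exp mult_ac)
    then show ?thesis using assms by (simp add: cis_cnj cis_mult l_def algebra_simps)
  qed
  have "((\<lambda>T. integral {-T..T} (\<lambda>t. cis (l * t)) / of_real (2 * T)) \<longlongrightarrow> (if n = m then 1 else 0)) at_top"
  proof (cases "n = m")
    case True
    have "\<forall>\<^sub>F T in at_top. integral {-T..T} (\<lambda>t. cis (l * t)) / of_real (2 * T) = (if n = m then 1 else 0)"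
      using eventually_gt_at_top[of 0] by eventually_elim (simp add: True l_def scaleR_conv_of_real)
    then show ?thesis by (rule tendsto_eventually)
  next
    case False
    then have l0: "l \<noteq> 0" using assms by (simp add: l_def)
    have int: "integral {-T..T} (\<lambda>t. cis (l * t)) = (cis (l * T) - cis (l * (-T))) / (\<i> * of_real l)" if "T > 0" for T
    proof -
      let ?F = "\<lambda>x. cis (l * x) / (\<i> * of_real l)"
      have "((\<lambda>x. cis (l * x)) has_integral (?F T - ?F (-T))) {-T..T}"
      proof (rule fundamental_theorem_of_calculus)
        fix x :: real
        have "((\<lambda>x. exp (\<i> * of_real (l * x)) / (\<i> * of_real l)) has_vector_derivative
          exp (\<i> * of_real (l * x))) (at x within {-T..T})"
          using l0 by (auto intro!: derivative_eq_intros has_vector_derivative_real_field simp: field_simps)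
        then show "(?F has_vector_derivative cis (l * x)) (at x within {-T..T})"
          by (simp add: cis_conv_exp)
      qed (use that in auto)
      then show ?thesis by (simp add: integral_unique diff_divide_distrib)
    qed
    have "((\<lambda>T. integral {-T..T} (\<lambda>t. cis (l * t)) / of_real (2 * T)) \<longlongrightarrow> 0) at_top"
    proof (rule Lim_null_comparison)
      show "\<forall>\<^sub>F T in at_top. norm (integral {-T..T} (\<lambda>t. cis (l * t)) / of_real (2 * T)) \<le> 1 / \<bar>l\<bar> / T"
        using eventually_gt_at_top[of 0]
      proof eventually_elim
        case (elim T)
        have "norm (cis (l * T) - cis (l * (-T))) \<le> 1 + 1"
          by (rule order_trans[OF norm_triangle_ineq4]) simp
        then have "norm (cis (l * T) - cis (l * (-T))) / (\<bar>l\<bar> * (2 * T)) \<le> 2 / (\<bar>l\<bar> * (2 * T))"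
          using elim by (intro divide_right_mono) auto
        then show ?case using elim by (simp add: int norm_divide norm_mult)
      qed
      show "((\<lambda>T. 1 / \<bar>l\<bar> / T) \<longlongrightarrow> 0) at_top" by real_asymp
    qed
    then show ?thesis using False by simp
  qed
  moreover have "\<forall>\<omega>\<in>space polytorus. norm (multiplicative_ext \<omega> n * cnj (multiplicative_ext \<omega> m)) \<le> 1"
    by (auto simp: space_polytorus norm_mult norm_multiplicative_ext)
  moreover have "(\<lambda>\<omega>. cnj (multiplicative_ext \<omega> m)) \<in> borel_measurable polytorus"
    by (rule measurable_compose[OF measurable_multiplicative_ext])
       (intro borel_measurable_continuous_onI continuous_intros)
  ultimately show ?thesis
    unfolding has_ergodic_mean_def e integral_polytorus_character[OF assms]
    by (auto intro!: continuous_intros borel_measurable_times)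
qed

text \<open>
  Both averages are contractions for the supremum norm, so replacing \<open>U\<close> by a nearby \<open>V N\<close> changes
  each of them by at most the distance.
\<close>

lemma has_ergodic_mean_uniform_limit:
  assumes V: "\<And>N::nat. has_ergodic_mean (V N)"
    and lim: "uniform_limit (space polytorus) V U sequentially"
  shows "has_ergodic_mean U"
proof -
  interpret prob_space polytorus by (rule prob_space_polytorus)
  have cV: "continuous_on S (\<lambda>t. V N (Kronecker_flow t))" for S N
    using V[of N] by (auto simp: has_ergodic_mean_def intro: continuous_on_subset)
  have meas: "U \<in> borel_measurable polytorus"
    by (rule borel_measurable_LIMSEQ_metric[of V])
       (use V tendsto_uniform_limitI[OF lim] in \<open>auto simp: has_ergodic_mean_def\<close>)
  have near: "\<exists>N. \<forall>\<omega>\<in>space polytorus. norm (V N \<omega> - U \<omega>) \<le> e" if "e > 0" for e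
  proof -
    from uniform_limitD[OF lim that] obtain N where "\<forall>\<omega>\<in>space polytorus. dist (V N \<omega>) (U \<omega>) < e"
      by (auto simp: eventually_sequentially)
    then show ?thesis by (auto simp: dist_norm intro!: exI[of _ N] less_imp_le)
  qed
  obtain N where N: "\<And>\<omega>. \<omega> \<in> space polytorus \<Longrightarrow> norm (V N \<omega> - U \<omega>) \<le> 1" using near[of 1] by auto
  obtain B where B: "\<And>\<omega>. \<omega> \<in> space polytorus \<Longrightarrow> norm (V N \<omega>) \<le> B"
    using V[of N] by (auto simp: has_ergodic_mean_def)
  have bd: "norm (U \<omega>) \<le> B + 1" if "\<omega> \<in> space polytorus" for \<omega>
    using N[OF that] B[OF that] norm_triangle_ineq2[of "U \<omega>" "V N \<omega>"] by (simp add: norm_minus_commute)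
  have limt: "uniform_limit UNIV (\<lambda>N t. V N (Kronecker_flow t)) (\<lambda>t. U (Kronecker_flow t)) sequentially"
    using lim by (rule uniform_limit_compose') auto
  have cont: "continuous_on UNIV (\<lambda>t. U (Kronecker_flow t))"
    by (rule uniform_limit_theorem[OF always_eventually limt]) (auto intro: cV)
  have iU: "integrable polytorus U"
    using bd meas by (intro integrable_const_bound[of _ "B + 1"]) (auto intro: AE_I2)
  let ?m = "\<lambda>W T. integral {-T..T} (\<lambda>t. W (Kronecker_flow t)) / complex_of_real (2 * T)"
  have tri: "dist v y \<le> dist v w + (dist w x + dist x y)" for v w x y :: complex
    using dist_triangle[of v y w] dist_triangle[of w y x] by linarith
  have "((\<lambda>T. ?m U T) \<longlongrightarrow> (\<integral>\<omega>. U \<omega> \<partial>polytorus)) at_top"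
  proof (rule tendstoI)
    fix e :: real assume "e > 0"
    then obtain N where N: "\<And>\<omega>. \<omega> \<in> space polytorus \<Longrightarrow> norm (V N \<omega> - U \<omega>) \<le> e / 4" using near[of "e / 4"] by auto
    have "((\<lambda>T. ?m (V N) T) \<longlongrightarrow> (\<integral>\<omega>. V N \<omega> \<partial>polytorus)) at_top"
      using V[of N] by (simp add: has_ergodic_mean_def)
    then have "\<forall>\<^sub>F T in at_top. dist (?m (V N) T) (\<integral>\<omega>. V N \<omega> \<partial>polytorus) < e / 4"
      using \<open>e > 0\<close> by (intro tendstoD) auto
    then show "\<forall>\<^sub>F T in at_top. dist (?m U T) (\<integral>\<omega>. U \<omega> \<partial>polytorus) < e"
      using eventually_gt_at_top[of 0]
    proof eventually_elim
      case (elim T)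
      have "?m (V N) T - ?m U T = integral {-T..T} (\<lambda>t. V N (Kronecker_flow t) - U (Kronecker_flow t)) / complex_of_real (2 * T)"
        by (subst integral_diff) (auto intro!: integrable_continuous_interval cV continuous_on_subset[OF cont] simp: diff_divide_distrib)
      also have "norm \<dots> = norm (integral {-T..T} (\<lambda>t. V N (Kronecker_flow t) - U (Kronecker_flow t))) / (2 * T)"
        using elim by (simp add: norm_divide norm_mult)
      also have "\<dots> \<le> (e / 4 * (T - (-T))) / (2 * T)"
      proof (intro divide_right_mono integral_bound)
        show "continuous_on {-T..T} (\<lambda>t. V N (Kronecker_flow t) - U (Kronecker_flow t))"
          by (intro continuous_on_diff cV continuous_on_subset[OF cont]) auto
      qed (use elim N in auto)
      finally have 1: "norm (?m (V N) T - ?m U T) \<le> e / 4" using elim by simp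
      have "norm ((\<integral>\<omega>. V N \<omega> \<partial>polytorus) - (\<integral>\<omega>. U \<omega> \<partial>polytorus)) = norm (\<integral>\<omega>. V N \<omega> - U \<omega> \<partial>polytorus)"
        using iU has_ergodic_mean_integrable[OF V] by simp
      also have "\<dots> \<le> (\<integral>\<omega>. norm (V N \<omega> - U \<omega>) \<partial>polytorus)" by (rule integral_norm_bound)
      also have "\<dots> \<le> (\<integral>\<omega>. e / 4 \<partial>polytorus)"
        using iU has_ergodic_mean_integrable[OF V] by (intro integral_mono N) auto
      finally have 2: "norm ((\<integral>\<omega>. V N \<omega> \<partial>polytorus) - (\<integral>\<omega>. U \<omega> \<partial>polytorus)) \<le> e / 4"
        by (simp add: prob_space)
      have "dist (?m U T) (\<integral>\<omega>. U \<omega> \<partial>polytorus) \<le> dist (?m U T) (?m (V N) T) +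
          (dist (?m (V N) T) (\<integral>\<omega>. V N \<omega> \<partial>polytorus) + dist (\<integral>\<omega>. V N \<omega> \<partial>polytorus) (\<integral>\<omega>. U \<omega> \<partial>polytorus))"
        by (rule tri)
      also have "\<dots> \<le> e / 4 + (e / 4 + e / 4)"
        using 1 2 elim by (intro add_mono) (auto simp: dist_norm norm_minus_commute)
      also have "\<dots> < e" using \<open>e > 0\<close> by simp
      finally show ?case .
    qed
  qed
  then show ?thesis
    using meas bd cont unfolding has_ergodic_mean_def by auto
qed

text \<open>
  Linear combinations of the characters \<open>\<chi>(n) cnj (\<chi>(m))\<close>, that is \<open>\<chi>\<close> at the rational number
  \<open>n / m\<close>. They form an algebra closed under conjugation because \<open>\<chi>\<close> is completely multiplicative.
\<close>

inductive trig_polynomial :: "((nat \<Rightarrow> complex) \<Rightarrow> complex) \<Rightarrow> bool" where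
  monomial: "m \<ge> 1 \<Longrightarrow> n \<ge> 1 \<Longrightarrow>
    trig_polynomial (\<lambda>\<omega>. c * (multiplicative_ext \<omega> n * cnj (multiplicative_ext \<omega> m)))"
| add: "trig_polynomial U \<Longrightarrow> trig_polynomial V \<Longrightarrow> trig_polynomial (\<lambda>\<omega>. U \<omega> + V \<omega>)"

lemma trig_polynomial_has_ergodic_mean: "trig_polynomial U \<Longrightarrow> has_ergodic_mean U"
proof (induction rule: trig_polynomial.induct)
  case (monomial m n c)
  then show ?case by (intro has_ergodic_mean_scale has_ergodic_mean_character)
next
  case (add U V)
  then show ?case by (intro has_ergodic_mean_add)
qed

lemma trig_polynomial_const: "trig_polynomial (\<lambda>_. c)"
  using trig_polynomial.monomial[of 1 1 c] by simp

lemma trig_polynomial_mult: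
  assumes "trig_polynomial U" "trig_polynomial V"
  shows "trig_polynomial (\<lambda>\<omega>. U \<omega> * V \<omega>)"
  using assms(1)
proof (induction rule: trig_polynomial.induct)
  case (monomial m n c)
  show ?case using assms(2)
  proof (induction rule: trig_polynomial.induct)
    case (monomial m' n' c')
    have "trig_polynomial (\<lambda>\<omega>. (c * c') * (multiplicative_ext \<omega> (n * n') * cnj (multiplicative_ext \<omega> (m * m'))))"
      using monomial \<open>1 \<le> m\<close> \<open>1 \<le> n\<close> by (intro trig_polynomial.monomial) auto
    then show ?case
      using monomial \<open>1 \<le> m\<close> \<open>1 \<le> n\<close> by (simp add: multiplicative_ext_mult mult_ac)
  next
    case (add U V)
    from trig_polynomial.add[OF add.IH] show ?case by (simp add: ring_distribs)
  qed
next
  case (add U V)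
  from trig_polynomial.add[OF add.IH] show ?case by (simp add: ring_distribs)
qed

lemma trig_polynomial_dirichlet_partial:
  "trig_polynomial (\<lambda>\<omega>. dirichlet_partial (\<lambda>n. b n * multiplicative_ext \<omega> n) N s)"
proof (induction N)
  case 0
  show ?case using trig_polynomial_const[of 0] by (simp add: dirichlet_partial_def)
next
  case (Suc N)
  have "trig_polynomial (\<lambda>\<omega>. (b (Suc N) * of_nat (Suc N) powr (- s)) *
     (multiplicative_ext \<omega> (Suc N) * cnj (multiplicative_ext \<omega> 1)))"
    by (rule trig_polynomial.monomial) auto
  from trig_polynomial.add[OF Suc this] show ?case
    by (simp add: dirichlet_partial_def mult_ac)
qed

lemma trig_polynomial_cnj: "trig_polynomial U \<Longrightarrow> trig_polynomial (\<lambda>\<omega>. cnj (U \<omega>))"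
proof (induction rule: trig_polynomial.induct)
  case (monomial m n c)
  from trig_polynomial.monomial[OF monomial(2,1), of "cnj c"] show ?case by (simp add: mult_ac)
next
  case (add U V)
  from trig_polynomial.add[OF add.IH] show ?case by simp
qed

text \<open>
  The square of the modulus is \<open>P * cnj P\<close>, so real polynomials in it stay in the algebra. The modulus
  itself would not.
\<close>

lemma trig_polynomial_real_polynomial_norm:
  assumes "real_polynomial_function q" "trig_polynomial P"
  shows "trig_polynomial (\<lambda>\<omega>. of_real (q ((norm (P \<omega>))\<^sup>2)))"
  using assms(1)
proof (induction rule: real_polynomial_function.induct)
  case (linear f)
  then interpret bounded_linear f .
  have "trig_polynomial (\<lambda>\<omega>. of_real (f 1) * (P \<omega> * cnj (P \<omega>)))"
    by (intro trig_polynomial_mult trig_polynomial_const trig_polynomial_cnj assms)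
  moreover have "of_real (f ((norm (P \<omega>))\<^sup>2)) = of_real (f 1) * (P \<omega> * cnj (P \<omega>))" for \<omega>
    using scaleR[of "(norm (P \<omega>))\<^sup>2" 1]
    by (simp add: complex_norm_square[symmetric] mult.commute)
  ultimately show ?case by simp
next
  case (const c)
  show ?case by (rule trig_polynomial_const)
next
  case (add f g)
  from trig_polynomial.add[OF add.IH] show ?case by simp
next
  case (mult f g)
  from trig_polynomial_mult[OF mult.IH] show ?case by simp
qed

text \<open>
  Weierstrass approximation in the single real variable \<open>y = (norm P)\<^sup>2\<close>, applied to
  \<open>\<phi> (sqrt y)\<close>, replaces an approximation theorem for functions on the infinite-dimensional torus.
\<close>

lemma has_ergodic_mean_norm_trig_polynomial:
  assumes P: "trig_polynomial P" and \<phi>: "continuous_on {0..} \<phi>"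
  shows "has_ergodic_mean (\<lambda>\<omega>. of_real (\<phi> (norm (P \<omega>))))"
proof -
  obtain B where B: "\<And>\<omega>. \<omega> \<in> space polytorus \<Longrightarrow> norm (P \<omega>) \<le> B"
    using trig_polynomial_has_ergodic_mean[OF P] by (auto simp: has_ergodic_mean_def)
  have c: "continuous_on {0..B\<^sup>2} (\<lambda>y. \<phi> (sqrt y))"
    by (rule continuous_on_compose2[OF \<phi>]) (auto intro!: continuous_intros)
  have "\<exists>q. real_polynomial_function q \<and> (\<forall>y\<in>{0..B\<^sup>2}. \<bar>\<phi> (sqrt y) - q y\<bar> < 1 / (real N + 1))" for N
    using Stone_Weierstrass_real_polynomial_function[OF _ c, of "1 / (real N + 1)"] by (metis compact_Icc zero_less_divide_1_iff of_nat_0_le_iff add_nonneg_pos zero_less_one)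
  then obtain q where q: "\<And>N. real_polynomial_function (q N)"
    "\<And>N y. y \<in> {0..B\<^sup>2} \<Longrightarrow> \<bar>\<phi> (sqrt y) - q N y\<bar> < 1 / (real N + 1)" by metis
  show ?thesis
  proof (rule has_ergodic_mean_uniform_limit)
    show "has_ergodic_mean (\<lambda>\<omega>. of_real (q N ((norm (P \<omega>))\<^sup>2)))" for N
      by (intro trig_polynomial_has_ergodic_mean trig_polynomial_real_polynomial_norm q P)
    show "uniform_limit (space polytorus) (\<lambda>N \<omega>. of_real (q N ((norm (P \<omega>))\<^sup>2)) :: complex)
       (\<lambda>\<omega>. of_real (\<phi> (norm (P \<omega>)))) sequentially"
    proof (rule uniform_limitI)
      fix e :: real assume "e > 0"
      have "(\<lambda>N. 1 / (real N + 1)) \<longlonglongrightarrow> 0" by real_asymp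
      then have "\<forall>\<^sub>F N in sequentially. 1 / (real N + 1) < e" using \<open>e > 0\<close> by (rule order_tendstoD)
      then show "\<forall>\<^sub>F N in sequentially. \<forall>\<omega>\<in>space polytorus.
          dist (of_real (q N ((norm (P \<omega>))\<^sup>2)) :: complex) (of_real (\<phi> (norm (P \<omega>)))) < e"
      proof eventually_elim
        case (elim N)
        show ?case
        proof
          fix \<omega> assume "\<omega> \<in> space polytorus"
          then have "(norm (P \<omega>))\<^sup>2 \<in> {0..B\<^sup>2}" using B by (auto intro!: power_mono)
          from q(2)[OF this, of N] elim
          show "dist (of_real (q N ((norm (P \<omega>))\<^sup>2)) :: complex) (of_real (\<phi> (norm (P \<omega>)))) < e"
            by (simp add: dist_norm norm_of_real flip: of_real_diff)
        qed
      qed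
    qed
  qed
qed

lemma has_ergodic_mean_norm_limit:
  assumes P: "\<And>N::nat. trig_polynomial (P N)" and \<phi>: "continuous_on {0..} \<phi>"
    and lim: "uniform_limit (space polytorus) P G sequentially"
  shows "has_ergodic_mean (\<lambda>\<omega>. of_real (\<phi> (norm (G \<omega>))))"
proof (rule has_ergodic_mean_uniform_limit)
  show "has_ergodic_mean (\<lambda>\<omega>. of_real (\<phi> (norm (P N \<omega>))))" for N
    by (intro has_ergodic_mean_norm_trig_polynomial P \<phi>)
  have "has_ergodic_mean G"
    by (rule has_ergodic_mean_uniform_limit[OF trig_polynomial_has_ergodic_mean[OF P] lim])
  then obtain B where B: "\<And>\<omega>. \<omega> \<in> space polytorus \<Longrightarrow> norm (G \<omega>) \<le> B"
    by (auto simp: has_ergodic_mean_def)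
  have uc: "uniformly_continuous_on {0..B + 1} \<phi>"
    by (intro compact_uniformly_continuous continuous_on_subset[OF \<phi>]) auto
  show "uniform_limit (space polytorus) (\<lambda>N \<omega>. of_real (\<phi> (norm (P N \<omega>))) :: complex)
     (\<lambda>\<omega>. of_real (\<phi> (norm (G \<omega>)))) sequentially"
  proof (rule uniform_limitI)
    fix e :: real assume "e > 0"
    then obtain d where d: "d > 0" "\<And>x y. x \<in> {0..B + 1} \<Longrightarrow> y \<in> {0..B + 1} \<Longrightarrow> dist y x < d \<Longrightarrow> dist (\<phi> y) (\<phi> x) < e"
      using uc unfolding uniformly_continuous_on_def by metis
    have "\<forall>\<^sub>F N in sequentially. \<forall>\<omega>\<in>space polytorus. dist (P N \<omega>) (G \<omega>) < min d 1"
      using d(1) by (intro uniform_limitD[OF lim]) auto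
    then show "\<forall>\<^sub>F N in sequentially. \<forall>\<omega>\<in>space polytorus.
        dist (of_real (\<phi> (norm (P N \<omega>))) :: complex) (of_real (\<phi> (norm (G \<omega>)))) < e"
    proof eventually_elim
      case (elim N)
      show ?case
      proof
        fix \<omega> assume \<omega>: "\<omega> \<in> space polytorus"
        have le: "\<bar>norm (P N \<omega>) - norm (G \<omega>)\<bar> \<le> dist (P N \<omega>) (G \<omega>)"
          unfolding dist_norm by (rule norm_triangle_ineq3)
        have "dist (\<phi> (norm (P N \<omega>))) (\<phi> (norm (G \<omega>))) < e"
          using elim \<omega> B[OF \<omega>] le norm_ge_zero[of "P N \<omega>"] norm_ge_zero[of "G \<omega>"]
          by (intro d(2)) (auto simp: dist_real_def)
        then show "dist (of_real (\<phi> (norm (P N \<omega>))) :: complex) (of_real (\<phi> (norm (G \<omega>)))) < e"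
          by simp
      qed
    qed
  qed
qed

section \<open>Vertical means as torus integrals\<close>

lemma uniform_limit_twisted_fixed:
  assumes "uniform_limit (half_plane \<theta>) (dirichlet_partial b) g sequentially" "\<omega> \<in> space polytorus"
  shows "uniform_limit (half_plane \<theta>) (dirichlet_partial (\<lambda>n. b n * multiplicative_ext \<omega> n))
     (dirichlet_fun (\<lambda>n. b n * multiplicative_ext \<omega> n)) sequentially"
  using uniform_limit_compose'[OF uniform_limit_twisted[OF assms(1)], of "\<lambda>s. (\<omega>, s)" "half_plane \<theta>"] assms(2)
  by (auto simp: space_polytorus)

lemma uniform_limit_twisted_torus:
  assumes "uniform_limit (half_plane \<theta>) (dirichlet_partial b) g sequentially" "s \<in> half_plane \<theta>"
  shows "uniform_limit (space polytorus) (\<lambda>N \<omega>. dirichlet_partial (\<lambda>n. b n * multiplicative_ext \<omega> n) N s)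
     (\<lambda>\<omega>. dirichlet_fun (\<lambda>n. b n * multiplicative_ext \<omega> n) s) sequentially"
  using uniform_limit_compose'[OF uniform_limit_twisted[OF assms(1)], of "\<lambda>\<omega>. (\<omega>, s)" "space polytorus"] assms(2)
  by (auto simp: space_polytorus)

text \<open>
  Along the Kronecker flow the torus function \<open>\<omega> \<mapsto> g\<^sub>\<omega>(s)\<close> runs through the values of \<open>g\<close> on the vertical line
  through \<open>s\<close>.
\<close>

lemma twisted_by_Kronecker_flow:
  assumes "uniform_limit (half_plane \<theta>) (dirichlet_partial b) g sequentially" "s \<in> half_plane \<theta>"
  shows "dirichlet_fun (\<lambda>n. b n * multiplicative_ext (Kronecker_flow t) n) s = g (s + \<i> * of_real t)"
proof -
  have "s + \<i> * of_real t \<in> half_plane \<theta>" using assms(2) by (simp add: half_plane_def)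
  from tendsto_uniform_limitI[OF assms(1) this]
  show ?thesis unfolding dirichlet_fun_def dirichlet_partial_vertical_shift by (rule limI)
qed

lemma has_ergodic_mean_twisted:
  assumes "uniform_limit (half_plane \<theta>) (dirichlet_partial b) g sequentially" "s \<in> half_plane \<theta>"
    and \<phi>: "continuous_on {0..} \<phi>"
  shows "has_ergodic_mean (\<lambda>\<omega>. of_real (\<phi> (norm (dirichlet_fun (\<lambda>n. b n * multiplicative_ext \<omega> n) s))))"
  by (rule has_ergodic_mean_norm_limit[OF trig_polynomial_dirichlet_partial \<phi> uniform_limit_twisted_torus[OF assms(1,2)]])

lemma integrable_twisted:
  assumes "uniform_limit (half_plane \<theta>) (dirichlet_partial b) g sequentially" "s \<in> half_plane \<theta>"
    and "continuous_on {0..} \<phi>"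
  shows "integrable polytorus (\<lambda>\<omega>. \<phi> (norm (dirichlet_fun (\<lambda>n. b n * multiplicative_ext \<omega> n) s)) :: real)"
  using integrable_Re[OF has_ergodic_mean_integrable[OF has_ergodic_mean_twisted[OF assms]]] by simp

text \<open>
  The vertical mean is the mean of \<open>\<omega> \<mapsto> \<phi> \<bar>g\<^sub>\<omega>(\<sigma>)\<bar>\<close> along the Kronecker flow. In particular the limit that defines the vertical mean exists, so the default value of \<open>Lim\<close> never
  enters.
\<close>

theorem vertical_mean_eq_torus_integral:
  assumes U: "uniform_limit (half_plane \<theta>) (dirichlet_partial b) g sequentially" and \<sigma>: "\<theta> < \<sigma>"
    and \<phi>: "continuous_on {0..} \<phi>"
  shows "vertical_mean \<phi> g \<sigma> =
    (\<integral>\<omega>. \<phi> (norm (dirichlet_fun (\<lambda>n. b n * multiplicative_ext \<omega> n) (of_real \<sigma>))) \<partial>polytorus)"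
proof -
  define h where "h \<omega> = dirichlet_fun (\<lambda>n. b n * multiplicative_ext \<omega> n) (of_real \<sigma>)" for \<omega>
  have s: "of_real \<sigma> \<in> half_plane \<theta>" using \<sigma> by (simp add: half_plane_def)
  have E: "has_ergodic_mean (\<lambda>\<omega>. of_real (\<phi> (norm (h \<omega>))))"
    unfolding h_def by (rule has_ergodic_mean_twisted[OF U s \<phi>])
  have h: "h (Kronecker_flow t) = g (Complex \<sigma> t)" for t
    unfolding h_def twisted_by_Kronecker_flow[OF U s] by (simp add: Complex_eq)
  let ?f = "\<lambda>t. complex_of_real (\<phi> (norm (g (Complex \<sigma> t))))"
  have c: "continuous_on UNIV ?f" using E by (simp add: has_ergodic_mean_def h)
  have "((\<lambda>T. integral {-T..T} ?f / of_real (2 * T)) \<longlongrightarrow> of_real (\<integral>\<omega>. \<phi> (norm (h \<omega>)) \<partial>polytorus)) at_top"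
    using E by (simp add: has_ergodic_mean_def h)
  then have "((\<lambda>T. Re (integral {-T..T} ?f / of_real (2 * T))) \<longlongrightarrow> (\<integral>\<omega>. \<phi> (norm (h \<omega>)) \<partial>polytorus)) at_top"
    by (drule_tac tendsto_Re) simp
  also have "(\<lambda>T. Re (integral {-T..T} ?f / of_real (2 * T))) =
    (\<lambda>T. 1 / (2 * T) * integral {-T..T} (\<lambda>t. \<phi> (norm (g (Complex \<sigma> t)))))"
  proof
    fix T :: real
    have "?f integrable_on {-T..T}"
      by (intro integrable_continuous_interval continuous_on_subset[OF c]) auto
    from integral_linear[OF this bounded_linear_Re]
    have "Re (integral {-T..T} ?f) = integral {-T..T} (\<lambda>t. \<phi> (norm (g (Complex \<sigma> t))))"
      by (simp add: o_def)
    then show "Re (integral {-T..T} ?f / of_real (2 * T)) =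
      1 / (2 * T) * integral {-T..T} (\<lambda>t. \<phi> (norm (g (Complex \<sigma> t))))"
      by (simp add: Re_divide_of_real)
  qed
  finally show ?thesis
    unfolding vertical_mean_def h_def by (intro tendsto_Lim) auto
qed

section \<open>Boundary values\<close>

lemma represented_holomorphic_unique:
  assumes h: "h holomorphic_on half_plane 0" "represented_by h c"
    and h': "h' holomorphic_on half_plane 0" "represented_by h' c'"
    and c: "\<And>n. n \<ge> 1 \<Longrightarrow> c n = c' n" and s: "s \<in> half_plane 0"
  shows "h s = h' s"
proof -
  obtain \<theta> where \<theta>: "\<And>s. s \<in> half_plane \<theta> \<Longrightarrow> (\<lambda>N. dirichlet_partial c N s) \<longlonglongrightarrow> h s"
    using h(2) by (auto simp: represented_by_def)
  obtain \<theta>' where \<theta>': "\<And>s. s \<in> half_plane \<theta>' \<Longrightarrow> (\<lambda>N. dirichlet_partial c' N s) \<longlonglongrightarrow> h' s"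
    using h'(2) by (auto simp: represented_by_def)
  have cc: "dirichlet_partial c N s = dirichlet_partial c' N s" for N s
    unfolding dirichlet_partial_def by (intro sum.cong) (auto simp: c)
  define \<eta> where "\<eta> = max 0 (max \<theta> \<theta>')"
  show ?thesis
  proof (rule analytic_continuation_open[of "half_plane \<eta>" "half_plane 0" h h' s])
    show "half_plane \<eta> \<subseteq> half_plane 0" by (auto simp: half_plane_def \<eta>_def)
    fix z assume "z \<in> half_plane \<eta>"
    then have z: "z \<in> half_plane \<theta>" "z \<in> half_plane \<theta>'" by (auto simp: half_plane_def \<eta>_def)
    show "h z = h' z"
      using LIMSEQ_unique[OF \<theta>[OF z(1)]] \<theta>'[OF z(2)] unfolding cc by blast
  qed (use h(1) h'(1) s in \<open>auto intro: convex_connected\<close>)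
qed

text \<open>
  Coefficients are unique and the identity theorem holds on \<open>half_plane 0\<close>, so the sum of the twisted
  series is the only vertical limit function.
\<close>

lemma has_boundary_value_iff:
  assumes U: "\<And>\<theta>. \<theta> > 0 \<Longrightarrow> uniform_limit (half_plane \<theta>) (dirichlet_partial b) g sequentially"
    and \<omega>: "\<omega> \<in> space polytorus"
  shows "has_boundary_value g \<omega> z \<longleftrightarrow>
    ((\<lambda>\<sigma>. dirichlet_fun (\<lambda>n. b n * multiplicative_ext \<omega> n) (of_real \<sigma>)) \<longlongrightarrow> z) (at_right 0)"
    (is "?L \<longleftrightarrow> (?h \<longlongrightarrow> z) _")
proof -
  let ?c = "\<lambda>n. b n * multiplicative_ext \<omega> n"
  have T: "uniform_limit (half_plane \<theta>) (dirichlet_partial ?c) (dirichlet_fun ?c) sequentially" if "\<theta> > 0" for \<theta>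
    by (rule uniform_limit_twisted_fixed[OF U[OF that] \<omega>])
  have hol: "dirichlet_fun ?c holomorphic_on half_plane 0" by (rule holomorphic_on_dirichlet_limit[OF T])
  have rep: "represented_by (dirichlet_fun ?c) ?c" by (rule represented_by_dirichlet_limit[OF T[of 1]]) simp
  have rg: "represented_by g b" by (rule represented_by_dirichlet_limit[OF U[of 1]]) simp
  show ?thesis
  proof
    assume "(?h \<longlongrightarrow> z) (at_right 0)"
    then show ?L
      unfolding has_boundary_value_def vertical_limit_def using hol rep rg by blast
  next
    assume ?L
    then obtain h b' where h: "h holomorphic_on half_plane 0" "represented_by g b'"
      "represented_by h (\<lambda>n. b' n * multiplicative_ext \<omega> n)" "((\<lambda>\<sigma>. h (of_real \<sigma>)) \<longlongrightarrow> z) (at_right 0)"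
      unfolding has_boundary_value_def vertical_limit_def by blast
    have "h s = dirichlet_fun ?c s" if "s \<in> half_plane 0" for s
      by (rule represented_holomorphic_unique[OF h(1,3) hol rep _ that])
         (simp add: dirichlet_coefficients_unique[OF rg h(2)])
    then have eq: "h (of_real \<sigma>) = ?h \<sigma>" if "\<sigma> > 0" for \<sigma>
      using that by (simp add: half_plane_def)
    have "\<forall>\<^sub>F \<sigma> in at_right 0. h (of_real \<sigma>) = ?h \<sigma>"
      using eventually_at_right_less[of 0] by eventually_elim (rule eq)
    from tendsto_cong[OF this] h(4) show "(?h \<longlongrightarrow> z) (at_right 0)" by simp
  qed
qed

text \<open>
  For a continuous function the Cauchy criterion at 0 can be tested at rational points. Only countably
  many quantifiers remain, which is what measurability in a parameter needs.
\<close>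

lemma right_limit_iff_rational_Cauchy:
  fixes f :: "real \<Rightarrow> complex"
  assumes f: "continuous_on {0<..} f"
  shows "(\<exists>z. (f \<longlongrightarrow> z) (at_right 0)) \<longleftrightarrow>
    (\<forall>k::nat. \<exists>m::nat. \<forall>p q::rat. 0 < p \<and> p < 1 / (of_nat m + 1) \<and> 0 < q \<and> q < 1 / (of_nat m + 1) \<longrightarrow>
       dist (f (of_rat p)) (f (of_rat q)) \<le> 1 / (real k + 1))" (is "?L \<longleftrightarrow> ?R")
proof
  assume ?L
  then obtain z where z: "(f \<longlongrightarrow> z) (at_right 0)" by blast
  show ?R
  proof
    fix k :: nat
    have "\<forall>\<^sub>F \<sigma> in at_right 0. dist (f \<sigma>) z < 1 / (real k + 1) / 2"
      by (intro tendstoD[OF z]) auto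
    then obtain d where d: "d > 0" "\<And>\<sigma>. 0 < \<sigma> \<Longrightarrow> \<sigma> < d \<Longrightarrow> dist (f \<sigma>) z < 1 / (real k + 1) / 2"
      unfolding eventually_at_right_field by auto
    obtain m where m: "1 / (real m + 1) < d"
      using d(1) reals_Archimedean[of d] by (auto simp: inverse_eq_divide add.commute)
    have "dist (f (of_rat p)) (f (of_rat q)) \<le> 1 / (real k + 1)"
      if pq: "0 < p" "p < 1 / (of_nat m + 1)" "0 < q" "q < 1 / (of_nat m + 1)" for p q :: rat
    proof -
      have lt: "(of_rat r :: real) < d" if "r < 1 / (of_nat m + 1)" for r :: rat
      proof -
        have "(of_rat r :: real) < of_rat (1 / (of_nat m + 1))" using that by (simp only: of_rat_less)
        also have "\<dots> = 1 / (real m + 1)" by (simp add: of_rat_divide of_rat_add)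
        finally show ?thesis using m by simp
      qed
      have "dist (f (of_rat p)) z < 1 / (real k + 1) / 2" "dist (f (of_rat q)) z < 1 / (real k + 1) / 2"
        by (rule d(2); use pq lt in simp)+
      then show ?thesis using dist_triangle2[of "f (of_rat p)" "f (of_rat q)" z] by linarith
    qed
    then show "\<exists>m::nat. \<forall>p q::rat. 0 < p \<and> p < 1 / (of_nat m + 1) \<and> 0 < q \<and> q < 1 / (of_nat m + 1) \<longrightarrow>
       dist (f (of_rat p)) (f (of_rat q)) \<le> 1 / (real k + 1)" by blast
  qed
next
  assume R: ?R
  have near: "\<exists>d>0. \<forall>\<sigma> \<tau>. 0 < \<sigma> \<and> \<sigma> < d \<and> 0 < \<tau> \<and> \<tau> < d \<longrightarrow> dist (f \<sigma>) (f \<tau>) \<le> e" if "e > 0" for e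
  proof -
    have "e / 3 > 0" using that by simp
    from reals_Archimedean[OF this] obtain k where "inverse (real (Suc k)) < e / 3" ..
    then have k: "1 / (real k + 1) < e / 3" by (simp add: inverse_eq_divide add.commute)
    obtain m where m: "\<And>p q::rat. 0 < p \<Longrightarrow> p < 1 / (of_nat m + 1) \<Longrightarrow> 0 < q \<Longrightarrow> q < 1 / (of_nat m + 1) \<Longrightarrow>
       dist (f (of_rat p)) (f (of_rat q)) \<le> 1 / (real k + 1)" using R by metis
    define d where "d = 1 / (real m + 1)"
    have approx: "\<exists>p::rat. 0 < p \<and> p < 1 / (of_nat m + 1) \<and> dist (f \<sigma>) (f (of_rat p)) < e / 3"
      if \<sigma>: "0 < \<sigma>" "\<sigma> < d" for \<sigma>
    proof -
      have "isCont f \<sigma>"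
        using f \<sigma> by (simp add: continuous_on_eq_continuous_at)
      then have "\<forall>\<^sub>F x in at \<sigma>. dist (f x) (f \<sigma>) < e / 3"
        unfolding isCont_def using \<open>e > 0\<close> by (intro tendstoD) auto
      then obtain r where r: "r > 0" "\<And>x. x \<noteq> \<sigma> \<Longrightarrow> dist x \<sigma> < r \<Longrightarrow> dist (f x) (f \<sigma>) < e / 3"
        unfolding eventually_at by auto
      obtain p :: rat where p: "\<sigma> < of_rat p" "of_rat p < min d (\<sigma> + r)"
        using of_rat_dense[of \<sigma> "min d (\<sigma> + r)"] \<sigma> r(1) by auto
      have "(of_rat p :: real) < of_rat (1 / (of_nat m + 1))"
        using p by (simp add: of_rat_divide of_rat_add d_def)
      then have "p < 1 / (of_nat m + 1)" by (simp only: of_rat_less)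
      moreover have "0 < p"
      proof -
        have "0 < (of_rat p :: real)" using p(1) \<sigma>(1) by (rule order.strict_trans[rotated])
        then show ?thesis by (simp only: zero_less_of_rat_iff)
      qed
      moreover have "dist (f (of_rat p)) (f \<sigma>) < e / 3"
        using p by (intro r(2)) (auto simp: dist_real_def)
      ultimately show ?thesis by (auto simp: dist_commute)
    qed
    have "dist (f \<sigma>) (f \<tau>) \<le> e" if "0 < \<sigma>" "\<sigma> < d" "0 < \<tau>" "\<tau> < d" for \<sigma> \<tau>
    proof -
      obtain p where p: "0 < p" "p < 1 / (of_nat m + 1)" "dist (f \<sigma>) (f (of_rat p)) < e / 3"
        using approx[OF \<open>0 < \<sigma>\<close> \<open>\<sigma> < d\<close>] by (elim exE conjE)
      obtain q where q: "0 < q" "q < 1 / (of_nat m + 1)" "dist (f \<tau>) (f (of_rat q)) < e / 3"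
        using approx[OF \<open>0 < \<tau>\<close> \<open>\<tau> < d\<close>] by (elim exE conjE)
      have "dist (f \<sigma>) (f \<tau>) \<le> dist (f \<sigma>) (f (of_rat p)) + (dist (f (of_rat p)) (f (of_rat q)) + dist (f (of_rat q)) (f \<tau>))"
        using dist_triangle[of "f \<sigma>" "f \<tau>" "f (of_rat p)"] dist_triangle[of "f (of_rat p)" "f \<tau>" "f (of_rat q)"] by linarith
      then show ?thesis using p(3) q(3) m[OF p(1,2) q(1,2)] k by (simp add: dist_commute)
    qed
    then show ?thesis by (intro exI[of _ d] conjI allI impI) (auto simp: d_def)
  qed
  define x where "x n = f (1 / (real n + 1))" for n
  have small: "\<exists>N. \<forall>n\<ge>N. 1 / (real n + 1) < d" if "d > 0" for d
  proof -
    have "(\<lambda>n. 1 / (real n + 1)) \<longlonglongrightarrow> 0" by real_asymp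
    from order_tendstoD(2)[OF this that] show ?thesis by (simp add: eventually_sequentially)
  qed
  have "Cauchy x"
  proof (rule metric_CauchyI)
    fix e :: real assume "e > 0"
    then have "e / 2 > 0" by simp
    from near[OF this] obtain d where d0: "d > 0 \<and> (\<forall>\<sigma> \<tau>. 0 < \<sigma> \<and> \<sigma> < d \<and> 0 < \<tau> \<and> \<tau> < d \<longrightarrow> dist (f \<sigma>) (f \<tau>) \<le> e / 2)" ..
    then have d: "d > 0" "\<And>\<sigma> \<tau>. 0 < \<sigma> \<Longrightarrow> \<sigma> < d \<Longrightarrow> 0 < \<tau> \<Longrightarrow> \<tau> < d \<Longrightarrow> dist (f \<sigma>) (f \<tau>) \<le> e / 2"
      by simp_all
    from small[OF d(1)] obtain N where N: "\<forall>n\<ge>N. 1 / (real n + 1) < d" ..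
    have "dist (x m) (x n) < e" if "m \<ge> N" "n \<ge> N" for m n
    proof -
      have "dist (x m) (x n) \<le> e / 2"
        unfolding x_def by (intro d(2)) (use that N in auto)
      then show ?thesis using \<open>e > 0\<close> by simp
    qed
    then show "\<exists>M. \<forall>m\<ge>M. \<forall>n\<ge>M. dist (x m) (x n) < e" by blast
  qed
  then have "convergent x" by (rule Cauchy_convergent)
  then obtain z where z: "x \<longlonglongrightarrow> z" unfolding convergent_def ..
  have "(f \<longlongrightarrow> z) (at_right 0)"
  proof (rule tendstoI)
    fix e :: real assume "e > 0"
    then have "e / 2 > 0" by simp
    from near[OF this] obtain d where d0: "d > 0 \<and> (\<forall>\<sigma> \<tau>. 0 < \<sigma> \<and> \<sigma> < d \<and> 0 < \<tau> \<and> \<tau> < d \<longrightarrow> dist (f \<sigma>) (f \<tau>) \<le> e / 2)" ..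
    then have d: "d > 0" "\<And>\<sigma> \<tau>. 0 < \<sigma> \<Longrightarrow> \<sigma> < d \<Longrightarrow> 0 < \<tau> \<Longrightarrow> \<tau> < d \<Longrightarrow> dist (f \<sigma>) (f \<tau>) \<le> e / 2"
      by simp_all
    have "dist (f \<sigma>) z \<le> e / 2" if "0 < \<sigma>" "\<sigma> < d" for \<sigma>
    proof (rule LIMSEQ_le_const2)
      show "(\<lambda>n. dist (f \<sigma>) (x n)) \<longlonglongrightarrow> dist (f \<sigma>) z" by (intro tendsto_intros z)
      from small[OF d(1)] obtain N where N: "\<forall>n\<ge>N. 1 / (real n + 1) < d" ..
      then show "\<exists>N. \<forall>n\<ge>N. dist (f \<sigma>) (x n) \<le> e / 2"
        unfolding x_def by (intro exI[of _ N] allI impI d(2)) (use N that in auto)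
    qed
    then have "\<forall>\<sigma>>0. \<sigma> < d \<longrightarrow> dist (f \<sigma>) z < e"
      using \<open>e > 0\<close> by (auto intro: order.strict_trans1[of _ "e / 2"])
    then show "\<forall>\<^sub>F \<sigma> in at_right 0. dist (f \<sigma>) z < e"
      unfolding eventually_at_right_field using d(1) by (intro exI[of _ d]) simp
  qed
  then show ?L by blast
qed

lemma measurable_twisted:
  assumes "uniform_limit (half_plane \<theta>) (dirichlet_partial b) g sequentially" "s \<in> half_plane \<theta>"
  shows "(\<lambda>\<omega>. dirichlet_fun (\<lambda>n. b n * multiplicative_ext \<omega> n) s) \<in> borel_measurable polytorus"
proof -
  have "has_ergodic_mean (\<lambda>\<omega>. dirichlet_fun (\<lambda>n. b n * multiplicative_ext \<omega> n) s)"
    by (rule has_ergodic_mean_uniform_limit[OF trig_polynomial_has_ergodic_mean[OF trig_polynomial_dirichlet_partial]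
       uniform_limit_twisted_torus[OF assms]])
  then show ?thesis by (simp add: has_ergodic_mean_def)
qed

lemma boundary_fun_eq:
  assumes U: "\<And>\<theta>. \<theta> > 0 \<Longrightarrow> uniform_limit (half_plane \<theta>) (dirichlet_partial b) g sequentially"
    and \<omega>: "\<omega> \<in> space polytorus" and z: "has_boundary_value g \<omega> z"
  shows "boundary_fun g \<omega> = z"
proof -
  have iff: "has_boundary_value g \<omega> y \<longleftrightarrow>
    ((\<lambda>\<sigma>. dirichlet_fun (\<lambda>n. b n * multiplicative_ext \<omega> n) (of_real \<sigma>)) \<longlongrightarrow> y) (at_right 0)" for y
    by (rule has_boundary_value_iff[OF U \<omega>])
  have "z' = z" if "has_boundary_value g \<omega> z'" for z'
    using that[unfolded iff] z[unfolded iff] by (rule tendsto_unique[rotated 1]) simp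
  then have "(THE z. has_boundary_value g \<omega> z) = z"
    by (intro the_equality[where P="has_boundary_value g \<omega>"] z)
  moreover have "\<exists>z. has_boundary_value g \<omega> z" using z by (rule exI)
  ultimately show ?thesis unfolding boundary_fun_def by simp
qed

text \<open>
  Each radial value \<open>\<omega> \<mapsto> g\<^sub>\<omega>(\<sigma>)\<close> is a limit of trigonometric polynomials, hence measurable. The set where
  the radial limit exists is described by a countable Cauchy condition, and there the limit may be
  taken along \<open>1 / (n + 1)\<close>.
\<close>

lemma boundary_fun_measurable:
  assumes U: "\<And>\<theta>. \<theta> > 0 \<Longrightarrow> uniform_limit (half_plane \<theta>) (dirichlet_partial b) g sequentially"
  shows "boundary_fun g \<in> borel_measurable polytorus"
proof -
  define h where "h \<omega> \<sigma> = dirichlet_fun (\<lambda>n. b n * multiplicative_ext \<omega> n) (of_real \<sigma>)" for \<omega> \<sigma>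
  have hm: "(\<lambda>\<omega>. h \<omega> \<sigma>) \<in> borel_measurable polytorus" if "\<sigma> > 0" for \<sigma>
    unfolding h_def by (rule measurable_twisted[OF U[of "\<sigma> / 2"]]) (use that in \<open>auto simp: half_plane_def\<close>)
  \<comment> \<open>Existence of the radial limit, with quantifiers over countable types only.\<close>
  define C where "C \<omega> \<longleftrightarrow> (\<forall>k::nat. \<exists>m::nat. \<forall>p q::rat. 0 < p \<and> p < 1 / (of_nat m + 1) \<and> 0 < q \<and> q < 1 / (of_nat m + 1) \<longrightarrow>
       dist (h \<omega> (of_rat p)) (h \<omega> (of_rat q)) \<le> 1 / (real k + 1))" for \<omega>
  have Cm: "Measurable.pred polytorus C"
    unfolding C_def
  proof (intro pred_intros_countable)
    fix k m :: nat and p q :: rat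
    show "Measurable.pred polytorus (\<lambda>\<omega>. 0 < p \<and> p < 1 / (of_nat m + 1) \<and> 0 < q \<and> q < 1 / (of_nat m + 1) \<longrightarrow>
       dist (h \<omega> (of_rat p)) (h \<omega> (of_rat q)) \<le> 1 / (real k + 1))"
    proof (cases "0 < p \<and> 0 < q")
      case True
      then have [measurable]: "(\<lambda>\<omega>. h \<omega> (of_rat p)) \<in> borel_measurable polytorus" "(\<lambda>\<omega>. h \<omega> (of_rat q)) \<in> borel_measurable polytorus"
        by (auto intro!: hm)
      show ?thesis by measurable
    next
      case False
      then have "(\<lambda>\<omega>. 0 < p \<and> p < 1 / (of_nat m + 1) \<and> 0 < q \<and> q < 1 / (of_nat m + 1) \<longrightarrow>
       dist (h \<omega> (of_rat p)) (h \<omega> (of_rat q)) \<le> 1 / (real k + 1)) = (\<lambda>_. True)" by auto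
      then show ?thesis by simp
    qed
  qed
  have eq: "boundary_fun g \<omega> = (if C \<omega> then lim (\<lambda>n. h \<omega> (1 / (real n + 1))) else 0)" if \<omega>: "\<omega> \<in> space polytorus" for \<omega>
  proof -
    have hbv: "has_boundary_value g \<omega> z \<longleftrightarrow> (h \<omega> \<longlongrightarrow> z) (at_right 0)" for z
      unfolding h_def by (rule has_boundary_value_iff[OF U \<omega>])
    have "dirichlet_fun (\<lambda>n. b n * multiplicative_ext \<omega> n) holomorphic_on half_plane 0"
      by (rule holomorphic_on_dirichlet_limit[OF uniform_limit_twisted_fixed[OF U \<omega>]])
    then have "continuous_on {0<..} (h \<omega>)"
      unfolding h_def
      by (rule continuous_on_compose2[OF holomorphic_on_imp_continuous_on])
         (auto intro!: continuous_intros simp: half_plane_def)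
    from right_limit_iff_rational_Cauchy[OF this]
    have C: "(\<exists>z. has_boundary_value g \<omega> z) \<longleftrightarrow> C \<omega>" unfolding C_def hbv .
    show ?thesis
    proof (cases "C \<omega>")
      case True
      then obtain z where z: "has_boundary_value g \<omega> z" using C by blast
      have "filterlim (\<lambda>n. 1 / (real n + 1)) (at_right 0) sequentially" by real_asymp
      from filterlim_compose[OF z[unfolded hbv] this]
      have "lim (\<lambda>n. h \<omega> (1 / (real n + 1))) = z" by (rule limI)
      then show ?thesis using True boundary_fun_eq[OF U \<omega> z] by simp
    next
      case False
      then show ?thesis using C by (auto simp: boundary_fun_def)
    qed
  qed
  have "(\<lambda>\<omega>. if C \<omega> then lim (\<lambda>n. h \<omega> (1 / (real n + 1))) else 0) \<in> borel_measurable polytorus"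
    by (intro measurable_If borel_measurable_lim_metric hm Cm[unfolded pred_def] borel_measurable_const) auto
  then show ?thesis by (rule measurable_cong[THEN iffD2, rotated]) (rule eq)
qed

lemma boundary_value_in_closure:
  assumes U: "\<And>\<theta>. \<theta> > 0 \<Longrightarrow> uniform_limit (half_plane \<theta>) (dirichlet_partial b) g sequentially"
    and \<omega>: "\<omega> \<in> space polytorus" and z: "has_boundary_value g \<omega> z"
  shows "z \<in> closure (g ` half_plane 0)"
proof (rule Lim_in_closed_set)
  show "((\<lambda>\<sigma>. dirichlet_fun (\<lambda>n. b n * multiplicative_ext \<omega> n) (of_real \<sigma>)) \<longlongrightarrow> z) (at_right 0)"
    using z has_boundary_value_iff[of b g \<omega> z, OF U \<omega>] by simp
  show "\<forall>\<^sub>F \<sigma> in at_right 0. dirichlet_fun (\<lambda>n. b n * multiplicative_ext \<omega> n) (of_real \<sigma>) \<in> closure (g ` half_plane 0)"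
    using eventually_at_right_less[of 0]
  proof eventually_elim
    case (elim \<sigma>)
    show ?case
      by (rule twisted_in_closure[OF U]) (use \<omega> elim in \<open>auto simp: space_polytorus half_plane_def\<close>)
  qed
qed auto

text \<open>
  A function that leaves \<open>S\<close> on a null set is not measurable into \<open>restrict_space borel S\<close>, so the usual
  rules for \<open>distr\<close> do not apply to it. Its preimages of subsets of \<open>S\<close> are measurable nevertheless, and
  they change by null sets when the exceptional values are replaced.
\<close>

lemma distr_restrict_space_AE:
  assumes f: "f \<in> borel_measurable M" and S: "S \<in> sets borel" and AE: "AE x in M. f x \<in> S" and c: "c \<in> S"
  shows "distr M (restrict_space borel S) f = distr M (restrict_space borel S) (\<lambda>x. if f x \<in> S then f x else c)"
proof -
  have "emeasure M (f -` A \<inter> space M) = emeasure M ((\<lambda>x. if f x \<in> S then f x else c) -` A \<inter> space M)"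
    if "A \<in> sets (restrict_space borel S)" for A
  proof (rule emeasure_eq_AE)
    have A: "A \<in> sets borel" using that S by (auto simp: sets_restrict_space)
    have g: "(\<lambda>x. if f x \<in> S then f x else c) \<in> borel_measurable M"
      using f S by measurable
    show "f -` A \<inter> space M \<in> sets M" "(\<lambda>x. if f x \<in> S then f x else c) -` A \<inter> space M \<in> sets M"
      using measurable_sets[OF f A] measurable_sets[OF g A] .
    show "AE x in M. (x \<in> f -` A \<inter> space M) = (x \<in> (\<lambda>x. if f x \<in> S then f x else c) -` A \<inter> space M)"
      using AE by eventually_elim auto
  qed
  then show ?thesis
    unfolding distr_def by (intro measure_of_eq) (auto simp: sets.space_closed sets.sigma_sets_eq)
qed

lemma norm_twisted_le:
  assumes U: "\<And>\<theta>. \<theta> > 0 \<Longrightarrow> uniform_limit (half_plane \<theta>) (dirichlet_partial b) g sequentially"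
    and M: "\<And>s. s \<in> half_plane 0 \<Longrightarrow> norm (g s) \<le> M"
    and \<omega>: "\<omega> \<in> space polytorus" and s: "s \<in> half_plane 0"
  shows "norm (dirichlet_fun (\<lambda>n. b n * multiplicative_ext \<omega> n) s) \<le> M"
proof -
  have "closure (g ` half_plane 0) \<subseteq> cball 0 M"
    by (rule closure_minimal) (use M in auto)
  moreover have "dirichlet_fun (\<lambda>n. b n * multiplicative_ext \<omega> n) s \<in> closure (g ` half_plane 0)"
    by (rule twisted_in_closure[OF U _ s]) (use \<omega> in \<open>auto simp: space_polytorus\<close>)
  ultimately show ?thesis by auto
qed

section \<open>The Nevanlinna norm as a boundary integral\<close>

text \<open>
  The set of admissible abscissas is an up-set, so every \<open>\<theta>\<close> above its infimum belongs to it.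
\<close>

lemma Nevanlinna_u_uniform_limit:
  assumes "a \<in> Nevanlinna_u" "\<theta> > 0"
  shows "uniform_limit (half_plane \<theta>) (dirichlet_partial a) (dirichlet_fun a) sequentially"
proof -
  have "abscissa_unif a < ereal \<theta>"
    using assms by (auto simp: Nevanlinna_u_def intro: order.strict_trans1)
  then obtain \<theta>' where \<theta>': "\<theta>' < \<theta>" "uniformly_convergent_on (half_plane \<theta>') (dirichlet_partial a)"
    unfolding abscissa_unif_def Inf_less_iff by auto
  have "half_plane \<theta> \<subseteq> half_plane \<theta>'" using \<theta>'(1) by (auto simp: half_plane_def)
  then show ?thesis
    using uniform_limit_on_subset[OF uniform_limit_dirichlet_fun[OF \<theta>'(2)]] by blast
qed

lemma log_plus_le: "x \<ge> 0 \<Longrightarrow> log_plus x \<le> x"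
  unfolding log_plus_def using ln_le_minus_one[of x] by (cases "x = 0") auto

text \<open>
  Continuity at 0 holds because \<open>ln 0 = 0\<close>, by which \<open>log_plus x = ln (max x 1)\<close> for all \<open>x \<ge> 0\<close>.
\<close>

lemma continuous_on_log_plus: "continuous_on {0..} log_plus"
proof -
  have eq: "ln (max x 1) = log_plus x" if "x \<in> {0..}" for x
    using that by (cases "x = 0") (auto simp: log_plus_def max_def)
  have "continuous_on {0..} (\<lambda>x::real. ln (max x 1))"
    by (intro continuous_intros) auto
  then show ?thesis by (rule continuous_on_eq) (rule eq)
qed

text \<open>
  Bohr's theorem gives the abscissa condition, and the vertical means of \<open>log_plus\<close> are torus integrals
  of functions bounded by \<open>M\<close>.
\<close>

lemma bounded_dirichlet_in_Nevanlinna_u: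
  assumes g: "g holomorphic_on half_plane 0" and M: "\<And>s. s \<in> half_plane 0 \<Longrightarrow> norm (g s) \<le> M"
    and b: "represented_by g b"
  shows "b \<in> Nevanlinna_u" and "\<And>s. s \<in> half_plane 0 \<Longrightarrow> dirichlet_fun b s = g s"
proof -
  interpret prob_space polytorus by (rule prob_space_polytorus)
  have U: "uniform_limit (half_plane \<theta>) (dirichlet_partial b) g sequentially" if "\<theta> > 0" for \<theta>
    by (rule Bohr_uniform_convergence[OF g M b that])
  show eq: "dirichlet_fun b s = g s" if "s \<in> half_plane 0" for s
    by (rule dirichlet_fun_uniform_limit[OF U[of "Re s / 2"]]) (use that in \<open>auto simp: half_plane_def\<close>)
  have le: "abscissa_unif b \<le> ereal \<theta>" if "\<theta> > 0" for \<theta>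
    unfolding abscissa_unif_def
  proof (rule Inf_lower)
    show "ereal \<theta> \<in> {ereal \<theta> |\<theta>. uniformly_convergent_on (half_plane \<theta>) (dirichlet_partial b)}"
      using U[OF that] by (auto simp: uniformly_convergent_on_def)
  qed
  have "abscissa_unif b \<le> 0"
  proof (rule ereal_le_epsilon2)
    fix e :: real assume "0 < e"
    from le[OF this] show "abscissa_unif b \<le> 0 + ereal e" by simp
  qed
  moreover have "Limsup (at_right 0) (\<lambda>\<sigma>. ereal (vertical_mean log_plus (dirichlet_fun b) \<sigma>)) \<le> ereal M"
  proof (rule Limsup_bounded)
    show "\<forall>\<^sub>F \<sigma> in at_right 0. ereal (vertical_mean log_plus (dirichlet_fun b) \<sigma>) \<le> ereal M"
      using eventually_at_right_less[of 0]
    proof eventually_elim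
      case (elim \<sigma>)
      have hp: "half_plane (\<sigma> / 2) \<subseteq> half_plane 0" "of_real \<sigma> \<in> half_plane (\<sigma> / 2)" "of_real \<sigma> \<in> half_plane 0"
        using elim by (auto simp: half_plane_def)
      have U': "uniform_limit (half_plane (\<sigma> / 2)) (dirichlet_partial b) (dirichlet_fun b) sequentially"
        by (rule uniform_limit_dirichlet_fun) (use U[of "\<sigma> / 2"] elim in \<open>auto simp: uniformly_convergent_on_def\<close>)
      let ?h = "\<lambda>\<omega>. dirichlet_fun (\<lambda>n. b n * multiplicative_ext \<omega> n) (of_real \<sigma>)"
      have hM: "norm (?h \<omega>) \<le> M" if "\<omega> \<in> space polytorus" for \<omega>
        by (rule norm_twisted_le[OF U M that hp(3)])
      have "vertical_mean log_plus (dirichlet_fun b) \<sigma> = (\<integral>\<omega>. log_plus (norm (?h \<omega>)) \<partial>polytorus)"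
        using elim by (intro vertical_mean_eq_torus_integral[OF U' _ continuous_on_log_plus]) auto
      also have "\<dots> \<le> (\<integral>\<omega>. M \<partial>polytorus)"
      proof (rule integral_mono)
        show "integrable polytorus (\<lambda>\<omega>. log_plus (norm (?h \<omega>)))"
          by (rule integrable_twisted[OF U' hp(2) continuous_on_log_plus])
        show "log_plus (norm (?h \<omega>)) \<le> M" if "\<omega> \<in> space polytorus" for \<omega>
          using log_plus_le[of "norm (?h \<omega>)"] hM[OF that] by simp
      qed simp
      finally show ?case by (simp add: prob_space)
    qed
  qed
  ultimately show "b \<in> Nevanlinna_u"
    unfolding Nevanlinna_u_def by (auto intro: order.strict_trans1)
qed

text \<open>
  The vertical means are torus integrals of \<open>ln (1 + \<bar>g\<^sub>\<omega>(\<sigma>)\<bar>)\<close>, which are dominated by \<open>M\<close> and converge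
  almost everywhere as \<open>\<sigma> \<rightarrow> 0\<close>. In particular the upper limit in the norm is a limit.
\<close>

lemma Nevanlinna_norm_eq_boundary_integral:
  assumes U: "\<And>\<theta>. \<theta> > 0 \<Longrightarrow> uniform_limit (half_plane \<theta>) (dirichlet_partial b) g sequentially"
    and M: "\<And>s. s \<in> half_plane 0 \<Longrightarrow> norm (g s) \<le> M"
    and B: "B \<in> borel_measurable polytorus"
    and bv: "AE \<omega> in polytorus. has_boundary_value g \<omega> (B \<omega>)"
  shows "Nevanlinna_norm g = ereal (\<integral>\<omega>. ln (1 + norm (B \<omega>)) \<partial>polytorus)"
    and "integrable polytorus (\<lambda>\<omega>. ln (1 + norm (B \<omega>)))"
proof -
  interpret prob_space polytorus by (rule prob_space_polytorus)
  define h where "h \<omega> \<sigma> = dirichlet_fun (\<lambda>n. b n * multiplicative_ext \<omega> n) (of_real \<sigma>)" for \<omega> \<sigma>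
  have lc: "continuous_on {0..} (\<lambda>x::real. ln (1 + x))" by (intro continuous_intros) auto
  have hM: "norm (h \<omega> \<sigma>) \<le> M" if "\<omega> \<in> space polytorus" "\<sigma> > 0" for \<omega> \<sigma>
    unfolding h_def by (rule norm_twisted_le[OF U M that(1)]) (use that(2) in \<open>auto simp: half_plane_def\<close>)
  have vm: "vertical_mean (\<lambda>x. ln (1 + x)) g \<sigma> = (\<integral>\<omega>. ln (1 + norm (h \<omega> \<sigma>)) \<partial>polytorus)"
    and int: "integrable polytorus (\<lambda>\<omega>. ln (1 + norm (h \<omega> \<sigma>)))" if "\<sigma> > 0" for \<sigma>
    unfolding h_def using that
    by (auto intro!: vertical_mean_eq_torus_integral[OF U[of "\<sigma> / 2"] _ lc] integrable_twisted[OF U[of "\<sigma> / 2"] _ lc]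
        simp: half_plane_def)
  have lim: "AE \<omega> in polytorus. ((\<lambda>\<sigma>. h \<omega> \<sigma>) \<longlongrightarrow> B \<omega>) (at_right 0)"
    using bv AE_space
  proof eventually_elim
    case (elim \<omega>)
    show ?case unfolding h_def
      by (rule has_boundary_value_iff[where g=g and b=b, OF U elim(2), THEN iffD1]) (use elim(1) in auto)
  qed
  have inv: "filterlim (\<lambda>x. inverse x) (at_right 0) (at_top :: real filter)"
    by (rule filterlim_inverse_at_right_top)
  \<comment> \<open>With \<open>\<sigma> = 1 / x\<close> the limit is taken at infinity; the cut-off \<open>max 1 x\<close> keeps \<open>\<sigma>\<close> positive for every \<open>x\<close>.\<close>
  let ?F = "\<lambda>x \<omega>. ln (1 + norm (h \<omega> (inverse (max 1 x))))"
  have max: "\<forall>\<^sub>F x::real in at_top. inverse (max 1 x) = inverse x"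
    using eventually_ge_at_top[of 1] by eventually_elim simp
  have D: "has_bochner_integral polytorus (\<lambda>\<omega>. ln (1 + norm (B \<omega>))) (\<integral>\<omega>. ln (1 + norm (B \<omega>)) \<partial>polytorus)
    \<and> ((\<lambda>x. \<integral>\<omega>. ?F x \<omega> \<partial>polytorus) \<longlongrightarrow> (\<integral>\<omega>. ln (1 + norm (B \<omega>)) \<partial>polytorus)) at_top"
  proof
    have lim': "AE \<omega> in polytorus. ((\<lambda>x. ?F x \<omega>) \<longlongrightarrow> ln (1 + norm (B \<omega>))) at_top"
      using lim
    proof eventually_elim
      case (elim \<omega>)
      have "((\<lambda>x. h \<omega> (inverse x)) \<longlongrightarrow> B \<omega>) at_top" by (rule filterlim_compose[OF elim inv])
      then have "((\<lambda>x. h \<omega> (inverse (max 1 x))) \<longlongrightarrow> B \<omega>) at_top"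
        using max by (subst tendsto_cong[where g="\<lambda>x. h \<omega> (inverse x)"]) (auto elim: eventually_mono)
      then show ?case by (intro tendsto_ln tendsto_add tendsto_const tendsto_norm) (auto simp: add_nonneg_eq_0_iff)
    qed
    have bd: "norm (?F x \<omega>) \<le> M" if "\<omega> \<in> space polytorus" for x \<omega>
    proof -
      have "norm (h \<omega> (inverse (max 1 x))) \<le> M" by (rule hM[OF that]) auto
      then show ?thesis using ln_add_one_self_le_self[of "norm (h \<omega> (inverse (max 1 x)))"] by simp
    qed
    have Fm: "?F x \<in> borel_measurable polytorus" for x
      using int[of "inverse (max 1 x)"] by (auto dest: borel_measurable_integrable)
    have Lm: "(\<lambda>\<omega>. ln (1 + norm (B \<omega>))) \<in> borel_measurable polytorus" using B by measurable
    have bdAE: "\<forall>\<^sub>F x in at_top. AE \<omega> in polytorus. norm (?F x \<omega>) \<le> M" using bd by (auto intro!: always_eventually AE_I2)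
    show "((\<lambda>x. \<integral>\<omega>. ?F x \<omega> \<partial>polytorus) \<longlongrightarrow> (\<integral>\<omega>. ln (1 + norm (B \<omega>)) \<partial>polytorus)) at_top"
      by (rule integral_dominated_convergence_at_top[where w="\<lambda>_. M", OF _ _ _ lim' bdAE]) (use Fm Lm in auto)
    have "integrable polytorus (\<lambda>\<omega>. ln (1 + norm (B \<omega>)))"
      by (rule integrable_dominated_convergence_at_top[where w="\<lambda>_. M", OF _ _ _ lim' bdAE]) (use Fm Lm in auto)
    then show "has_bochner_integral polytorus (\<lambda>\<omega>. ln (1 + norm (B \<omega>))) (\<integral>\<omega>. ln (1 + norm (B \<omega>)) \<partial>polytorus)"
      by (rule has_bochner_integral_integrable)
  qed
  then show "integrable polytorus (\<lambda>\<omega>. ln (1 + norm (B \<omega>)))"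
    by (simp add: has_bochner_integral_iff)
  have "((\<lambda>x. vertical_mean (\<lambda>x. ln (1 + x)) g (inverse x)) \<longlongrightarrow> (\<integral>\<omega>. ln (1 + norm (B \<omega>)) \<partial>polytorus)) at_top"
  proof (rule Lim_transform_eventually[OF conjunct2[OF D]])
    show "\<forall>\<^sub>F x in at_top. (\<integral>\<omega>. ?F x \<omega> \<partial>polytorus) = vertical_mean (\<lambda>x. ln (1 + x)) g (inverse x)"
      using eventually_ge_at_top[of 1] by eventually_elim (simp add: vm)
  qed
  then have "((\<lambda>\<sigma>. vertical_mean (\<lambda>x. ln (1 + x)) g \<sigma>) \<longlongrightarrow> (\<integral>\<omega>. ln (1 + norm (B \<omega>)) \<partial>polytorus)) (at_right 0)"
    by (simp add: filterlim_at_right_to_top)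
  then show "Nevanlinna_norm g = ereal (\<integral>\<omega>. ln (1 + norm (B \<omega>)) \<partial>polytorus)"
    unfolding Nevanlinna_norm_def by (intro lim_imp_Limsup) (auto intro: tendsto_ereal)
qed

text \<open>
  Change of variables, after the boundary function has been redirected to a point \<open>c\<close> of the half-plane on
  the null set where it leaves it.
\<close>

lemma nn_integral_boundary_pushforward:
  assumes bf: "boundary_fun \<Phi> \<in> borel_measurable polytorus"
    and AE: "AE \<omega> in polytorus. boundary_fun \<Phi> \<omega> \<in> half_plane 0"
    and F: "F \<in> borel_measurable (restrict_space borel (half_plane 0))" and c: "c \<in> half_plane 0"
  shows "(\<integral>\<^sup>+ s. F s \<partial>boundary_pushforward \<Phi>) =
    (\<integral>\<^sup>+ \<omega>. F (if boundary_fun \<Phi> \<omega> \<in> half_plane 0 then boundary_fun \<Phi> \<omega> else c) \<partial>polytorus)"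
proof -
  have S: "half_plane 0 \<in> sets borel" by (simp add: borel_open)
  have "(\<lambda>\<omega>. if boundary_fun \<Phi> \<omega> \<in> half_plane 0 then boundary_fun \<Phi> \<omega> else c) \<in> borel_measurable polytorus"
    using bf S by measurable
  then have "(\<lambda>\<omega>. if boundary_fun \<Phi> \<omega> \<in> half_plane 0 then boundary_fun \<Phi> \<omega> else c)
      \<in> measurable polytorus (restrict_space borel (half_plane 0))"
    using c by (intro measurable_restrict_space2) auto
  then show ?thesis
    unfolding boundary_pushforward_def distr_restrict_space_AE[OF bf S AE c]
    using F by (intro nn_integral_distr) auto
qed

text \<open>
  Compactness of the closed range enters twice: it makes \<open>f \<circ> \<Phi>\<close> bounded, and it keeps the boundary values of
  \<open>\<Phi>\<close> inside the half-plane where \<open>f\<close> lives. With both, the norm of \<open>f \<circ> \<Phi>\<close> is the integral of its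
  boundary function, which the change of variables turns into the Carleson integral.
\<close>

theorem compact_symbol_identity:
  assumes \<Phi>: "char_zero_symbol \<Phi>"
    and bv: "AE \<omega> in polytorus. \<exists>z. has_boundary_value \<Phi> \<omega> z"
    and comp: "AE \<omega> in polytorus.
             has_boundary_value (dirichlet_fun a \<circ> \<Phi>) \<omega> (dirichlet_fun a (boundary_fun \<Phi> \<omega>))"
    and K: "compact (closure (\<Phi> ` half_plane 0))" "closure (\<Phi> ` half_plane 0) \<subseteq> half_plane 0"
    and a: "a \<in> Nevanlinna_u"
  shows "\<exists>b\<in>Nevanlinna_u. \<forall>s\<in>half_plane 0. dirichlet_fun a (\<Phi> s) = dirichlet_fun b s"
    and "enn2ereal (\<integral>\<^sup>+ s. ennreal (ln (1 + norm (dirichlet_fun a s))) \<partial>boundary_pushforward \<Phi>)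
      = Nevanlinna_norm (dirichlet_fun a \<circ> \<Phi>)"
proof -
  interpret prob_space polytorus by (rule prob_space_polytorus)
  let ?f = "dirichlet_fun a" and ?K = "closure (\<Phi> ` half_plane 0)"
  let ?g = "?f \<circ> \<Phi>"
  obtain c where \<Phi>h: "\<Phi> holomorphic_on half_plane 0" and c: "represented_by \<Phi> c"
    using \<Phi> unfolding char_zero_symbol_def by blast
  have inK: "\<Phi> s \<in> ?K" if "s \<in> half_plane 0" for s
    by (intro subsetD[OF closure_subset] imageI that)
  obtain M\<Phi> where "\<And>z. z \<in> ?K \<Longrightarrow> norm z \<le> M\<Phi>"
    using compact_imp_bounded[OF K(1)] by (auto simp: bounded_iff)
  then have U\<Phi>: "uniform_limit (half_plane \<theta>) (dirichlet_partial c) \<Phi> sequentially" if "\<theta> > 0" for \<theta>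
    using that inK by (intro Bohr_uniform_convergence[OF \<Phi>h _ c, of M\<Phi>]) auto
  have fh: "?f holomorphic_on half_plane 0"
    by (rule holomorphic_on_dirichlet_limit[OF Nevanlinna_u_uniform_limit[OF a]])
  have gh: "?g holomorphic_on half_plane 0"
    by (rule holomorphic_on_compose_gen[OF \<Phi>h fh]) (use inK K(2) in auto)
  have fc: "continuous_on (half_plane 0) ?f" by (rule holomorphic_on_imp_continuous_on[OF fh])
  have "compact (?f ` ?K)"
    by (rule compact_continuous_image[OF continuous_on_subset[OF fc K(2)] K(1)])
  then obtain M where "\<And>z. z \<in> ?f ` ?K \<Longrightarrow> norm z \<le> M"
    using compact_imp_bounded bounded_iff by metis
  then have M: "norm (?g s) \<le> M" if "s \<in> half_plane 0" for s
    using inK[OF that] by auto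
  \<comment> \<open>A property that holds almost everywhere holds somewhere, and one boundary value already provides a Dirichlet series for \<open>g\<close>.\<close>
  have "\<exists>\<omega>. has_boundary_value ?g \<omega> (?f (boundary_fun \<Phi> \<omega>))"
    by (rule eventually_happens'[OF _ comp]) (simp add: ae_filter_eq_bot_iff emeasure_space_1)
  then obtain b where b: "represented_by ?g b"
    by (auto simp: has_boundary_value_def vertical_limit_def)
  have Ug: "uniform_limit (half_plane \<theta>) (dirichlet_partial b) ?g sequentially" if "\<theta> > 0" for \<theta>
    by (rule Bohr_uniform_convergence[OF gh M b that])
  show "\<exists>b\<in>Nevanlinna_u. \<forall>s\<in>half_plane 0. ?f (\<Phi> s) = dirichlet_fun b s"
    using bounded_dirichlet_in_Nevanlinna_u[OF gh M b] by (auto intro!: bexI[of _ b])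
  have bf: "boundary_fun \<Phi> \<in> borel_measurable polytorus"
    by (rule boundary_fun_measurable[OF U\<Phi>])
  have hp: "AE \<omega> in polytorus. boundary_fun \<Phi> \<omega> \<in> half_plane 0"
    using bv AE_space
  proof eventually_elim
    case (elim \<omega>)
    then obtain z where z: "has_boundary_value \<Phi> \<omega> z" by blast
    have "boundary_fun \<Phi> \<omega> = z" by (rule boundary_fun_eq[OF U\<Phi> elim(2) z])
    moreover have "z \<in> ?K" by (rule boundary_value_in_closure[OF U\<Phi> elim(2) z])
    ultimately show ?case using K(2) by auto
  qed
  \<comment> \<open>The boundary function, moved to the point 1 where it leaves the half-plane.\<close>
  define \<beta> where "\<beta> \<omega> = (if boundary_fun \<Phi> \<omega> \<in> half_plane 0 then boundary_fun \<Phi> \<omega> else 1)" for \<omega>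
  have one: "1 \<in> half_plane 0" by (simp add: half_plane_def)
  have \<beta>m: "\<beta> \<in> measurable polytorus (restrict_space borel (half_plane 0))"
  proof (rule measurable_restrict_space2)
    have "half_plane 0 \<in> sets borel" by (simp add: borel_open)
    then show "\<beta> \<in> borel_measurable polytorus" unfolding \<beta>_def[abs_def] using bf by measurable
  qed (auto simp: \<beta>_def one)
  have fm: "?f \<in> borel_measurable (restrict_space borel (half_plane 0))"
    by (rule borel_measurable_continuous_on_restrict[OF fc])
  have f\<beta>m: "(\<lambda>\<omega>. ?f (\<beta> \<omega>)) \<in> borel_measurable polytorus"
    by (rule measurable_compose[OF \<beta>m fm])
  have bvg: "AE \<omega> in polytorus. has_boundary_value ?g \<omega> (?f (\<beta> \<omega>))"
    using comp hp by eventually_elim (simp add: \<beta>_def)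
  have norm_eq: "Nevanlinna_norm ?g = ereal (\<integral>\<omega>. ln (1 + norm (?f (\<beta> \<omega>))) \<partial>polytorus)"
    by (rule Nevanlinna_norm_eq_boundary_integral(1)[OF Ug M f\<beta>m bvg])
  have int: "integrable polytorus (\<lambda>\<omega>. ln (1 + norm (?f (\<beta> \<omega>))))"
    by (rule Nevanlinna_norm_eq_boundary_integral(2)[OF Ug M f\<beta>m bvg])
  have "(\<integral>\<^sup>+ s. ennreal (ln (1 + norm (?f s))) \<partial>boundary_pushforward \<Phi>)
      = (\<integral>\<^sup>+ \<omega>. ennreal (ln (1 + norm (?f (\<beta> \<omega>)))) \<partial>polytorus)"
    unfolding \<beta>_def
    by (rule nn_integral_boundary_pushforward[OF bf hp _ one]) (use fm in measurable)
  also have "\<dots> = ennreal (\<integral>\<omega>. ln (1 + norm (?f (\<beta> \<omega>))) \<partial>polytorus)"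
    by (intro nn_integral_eq_integral int AE_I2) auto
  finally show "enn2ereal (\<integral>\<^sup>+ s. ennreal (ln (1 + norm (?f s))) \<partial>boundary_pushforward \<Phi>)
      = Nevanlinna_norm ?g"
    unfolding norm_eq by (simp add: enn2ereal_ennreal)
qed

theorem theorem4p4:
  fixes \<Phi> :: "complex \<Rightarrow> complex"
  assumes "char_zero_symbol \<Phi>"
    and "AE \<omega> in polytorus. \<exists>z. has_boundary_value \<Phi> \<omega> z"
    and "\<And>a. a \<in> Nevanlinna_u \<Longrightarrow>
           AE \<omega> in polytorus.
             has_boundary_value (dirichlet_fun a \<circ> \<Phi>) \<omega> (dirichlet_fun a (boundary_fun \<Phi> \<omega>))"
    and "compact (closure (\<Phi> ` half_plane 0))"
    and "closure (\<Phi> ` half_plane 0) \<subseteq> half_plane 0"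
  shows "composition_bounded \<Phi> \<longleftrightarrow> Carleson_embedding (boundary_pushforward \<Phi>)"
proof -
  note * = compact_symbol_identity[OF assms(1,2) assms(3) assms(4,5)]
  have "\<Phi> ` half_plane 0 \<subseteq> half_plane 0" by (rule order_trans[OF closure_subset assms(5)])
  then show ?thesis
    unfolding composition_bounded_def Carleson_embedding_def using *(1) by (simp add: *(2) cong: ball_cong)
qed

end
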